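(* Let the cost $c:\mathcal S\times\mathcal U\to[0,\infty)$ be time-independent and assume: (1) for each $x$, $u\mapsto c(x,u)$ is lower semicontinuous and convex on $\mathcal U$; (2) $\mathcal U$ is convex and $u\mapsto\mathcal G^uf(x)$ is affine for every $f\in\mathcal D$, $x\in\mathcal S$; (3) $\sup_{x,u}q(x,\mathcal S;u)<\infty$, and there is $\kappa_V<\infty$ with $\sup_{u\in\mathcal U}\int_{\mathcal S}(1+V(y))\,q(x,dy;u)\le\kappa_V(1+V(x))$ for all $x$; (4) there exist $h:\mathcal S\to\mathbb R$ with $\|h\|_V<\infty$ and $g^*\in\mathbb R$ such that, with a (measurable) pointwise maximizer $u^{**}(x)\in\arg\max_{u\in\mathcal U}\{\mathcal G^uh(x)-c(x,u)\}$, the Poisson equation holds: $$g^*+\mathcal G^{u^{**}}h(x)=c(x,u^{**}(x))\qquad\text{for all }x\in\mathcal S;$$ (5) $x\mapsto\inf_{u\in\mathcal U}c(x,u)$ has relatively compact sublevel sets and $c$ is bounded on compact subsets of $\mathcal S\times\mathcal U$; $-h$ is bounded below with relatively compact sublevel sets; and the process generated by $u^{**}$ is irreducible. Then the controlled process generated by $u^{**}$ is positive Harris recurrent with a unique invariant probability measure $\tilde\pi^*$, $(\mathcal G^{u^{**}})^*\tilde\pi^*=0$. Assume in addition that $\langle V,\tilde\pi^*\rangle<\infty$. Then, for every $T>0$, the function $f^*(t,x):=h(x)+(t-T)g^*$ satisfies: (i) $f^*$ solves $\partial_tf^*(t,x)+\mathcal Hf^*(t,x)=0$ on $[0,T]\times\mathcal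 S$, hence $f^*\in\mathcal F$; (ii) $f^*$ attains the dual supremum at $\tilde\pi^*$, with $\langle f^*_T-f^*_0,\tilde\pi^*\rangle=Tg^*=\sup_{f\in\mathcal F}\langle f_T-f_0,\tilde\pi^*\rangle$; (iii) for every $\tilde\pi\in\mathcal P(\mathcal S)$, $g_T(\tilde\pi)\ge Tg^*$; hence $g_T^*:=\inf_{\tilde\pi\in\mathcal P(\mathcal S)}g_T(\tilde\pi)=Tg^*$, and the infimum is attained at $\tilde\pi^*$.
   Context: Setting. $\mathcal S$ is a countable set with the discrete topology; $\mathcal U$ is a compact metric space (when convex, a compact convex subset of $\mathbb R^k$). The controlled jump generators are $\mathcal G^uf(x)=\int_{\mathcal S}[f(y)-f(x)]\,q(x,dy;u)$, with $q(x,\cdot\,;u)$ a (measurable) jump-rate kernel, acting on a common core $\mathcal D\subseteq C_b(\mathcal S)$ (on countable $\mathcal S$: the linear span of constants and singleton indicators). For a map $\mu:\mathcal S\to\mathcal U$ (a stationary control), $\mathcal G^\mu f(x)=\mathcal G^{\mu(x)}f(x)$; the process generated by $\mu$ is the Markov jump process with generator $\mathcal G^\mu$. Standing stability assumption: $V:\mathcal S\to[0,\infty)$ has relatively compact (finite) sublevel sets, and there are $W:\mathcal S\to[1,\infty)$, a compact $C\subset\mathcal S$ and $b<\infty$ such that every admissible stationary control $\mu$ generates an irreducible (Harris) process with $\mathcal G^\mu V\le -W+b\mathbf 1_C$; and $0\le c\le W$. $\|\phi\|_V=\sup_{x}|\phi(x)|/(1+V(x))$; $\langle\phi,\nu\rangle=\int\phi\,d\nu$;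 $f_t=f(t,\cdot)$. Hamiltonian: $\mathcal Hf(t,x)=\sup_{u\in\mathcal U}\{\mathcal G^uf(t,x)-c(x,u)\}$. Dual class on $[0,T]$: $\mathcal F$ is the set of $f:[0,T]\times\mathcal S\to\mathbb R$ with $f(\cdot,x)\in C^1$ for each $x$, $\sup_t\|f(t,\cdot)\|_V+\sup_t\|\partial_tf(t,\cdot)\|_V<\infty$, and $\partial_tf+\mathcal Hf=0$ on $[0,T]\times\mathcal S$. Primal value on $[0,T]$: $g_T(\tilde\pi)=\inf_\pi\int c(x,u)\,\pi(dt,dx,du)$ over measures $\pi$ on $[0,T]\times\mathcal S\times\mathcal U$ such that: (a) $\pi(dt,dx,du)=\pi_t(dx,du)\,dt$ with each $\pi_t$ a probability measure; (b) the state marginal $\pi_{1,t}(dx)=\int_{\mathcal U}\pi_t(dx,du)$ has a weakly continuous version with $\pi_{1,0}=\pi_{1,T}=\tilde\pi$; (c) for all $f:[0,T]\times\mathcal S\to\mathbb R$ with $f,\partial_tf$ bounded and uniformly continuous, $\int(f(T,x)-f(0,x))\,\tilde\pi(dx)=\int\{\partial_tf+\mathcal G^uf\}\,d\pi$; (d) $\int(1+V(x))\,\pi(dt,dx,du)<\infty$. The infimum over the empty set is $+\infty$. *)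

theory Defs
  imports "HOL-Probability.Probability"
begin

section \<open>Controlled jump generators\<close>

text \<open>The countable discrete state space is a type of class \<open>{countable, discrete_topology}\<close>, so
  \<open>borel\<close> consists of all subsets and every map from states to controls is measurable.  The control
  space is a subset \<open>U\<close> of a Euclidean space; behaviour at controls outside \<open>U\<close> is irrelevant.
  A rate kernel \<open>q x u\<close> may charge \<open>{x}\<close>: the generator and the process do not see this mass.\<close>

definition jump_rate_kernel ::
    "'u::euclidean_space set \<Rightarrow> ('s::{countable,discrete_topology} \<Rightarrow> 'u \<Rightarrow> 's measure) \<Rightarrow> bool" where
  "jump_rate_kernel U q \<longleftrightarrow>
     (\<forall>x. \<forall>u\<in>U. finite_measure (q x u) \<and> sets (q x u) = sets borel) \<and>
     (\<forall>x. \<forall>A\<in>sets borel. (\<lambda>u. emeasure (q x u) A) \<in> borel_measurable (restrict_space borel U))"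

definition gen :: "('s \<Rightarrow> 'u \<Rightarrow> 's measure) \<Rightarrow> 'u \<Rightarrow> ('s \<Rightarrow> real) \<Rightarrow> 's \<Rightarrow> real" where
  "gen q u f x = (LINT y|q x u. f y - f x)"

definition controlled_rates :: "('s \<Rightarrow> 'u \<Rightarrow> 's measure) \<Rightarrow> ('s \<Rightarrow> 'u) \<Rightarrow> 's \<Rightarrow> 's measure" where
  "controlled_rates q \<mu> x = q x (\<mu> x)"

text \<open>The linear span of the constants and the singleton indicators.\<close>

definition core :: "('s \<Rightarrow> real) set" where
  "core = {f. \<exists>a b F. finite F \<and> f = (\<lambda>x. a + (\<Sum>y\<in>F. b y * indicator {y} x))}"

definition Vnorm :: "('s \<Rightarrow> real) \<Rightarrow> ('s \<Rightarrow> real) \<Rightarrow> ennreal" where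
  "Vnorm V \<phi> = (SUP x. ennreal (\<bar>\<phi> x\<bar> / (1 + V x)))"

definition lsc_on :: "'u::topological_space set \<Rightarrow> ('u \<Rightarrow> real) \<Rightarrow> bool" where
  "lsc_on U g \<longleftrightarrow> (\<forall>u\<in>U. \<forall>a<g u. \<forall>\<^sub>F v in at u within U. a < g v)"

definition affine_fun_on :: "'u::real_vector set \<Rightarrow> ('u \<Rightarrow> real) \<Rightarrow> bool" where
  "affine_fun_on U g \<longleftrightarrow>
     (\<forall>u\<in>U. \<forall>v\<in>U. \<forall>t\<in>{0..1}. g ((1 - t) *\<^sub>R u + t *\<^sub>R v) = (1 - t) * g u + t * g v)"


section \<open>The Markov jump process of a rate kernel\<close>

text \<open>\<open>Q x\<close> is the finite jump-rate measure out of \<open>x\<close>.  The process is built from its jump chain and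
  its holding times: out of \<open>x\<close> it waits an exponential time of parameter \<open>Q x (S)\<close> and jumps
  according to \<open>Q x / Q x (S)\<close>.  An absorbing state (\<open>Q x (S) = 0\<close>) jumps to itself at rate 1.\<close>

definition hold_rate :: "('s \<Rightarrow> 's measure) \<Rightarrow> 's \<Rightarrow> real" where
  "hold_rate Q x = (if measure (Q x) UNIV = 0 then 1 else measure (Q x) UNIV)"

definition jump_dist :: "('s::topological_space \<Rightarrow> 's measure) \<Rightarrow> 's \<Rightarrow> 's measure" where
  "jump_dist Q x = (if measure (Q x) UNIV = 0 then return borel x else uniform_measure (Q x) UNIV)"

text \<open>The driving noise, common to all initial states: an i.i.d. sequence of pairs (random map, standard
  exponential variable), where the values of the random map at different states are independent and its
  value at \<open>y\<close> has law \<open>jump_dist Q y\<close>.  The chain moves by applying the successive random maps.\<close>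

definition noise :: "('s::topological_space \<Rightarrow> 's measure) \<Rightarrow> (('s \<Rightarrow> 's) \<times> real) stream measure" where
  "noise Q = stream_space (PiM UNIV (jump_dist Q) \<Otimes>\<^sub>M density lborel (exponential_density 1))"

primrec jump_chain :: "'s \<Rightarrow> (('s \<Rightarrow> 's) \<times> real) stream \<Rightarrow> nat \<Rightarrow> 's" where
  "jump_chain x \<omega> 0 = x"
| "jump_chain x \<omega> (Suc n) = fst (\<omega> !! n) (jump_chain x \<omega> n)"

definition holding_time ::
    "('s \<Rightarrow> 's measure) \<Rightarrow> 's \<Rightarrow> (('s \<Rightarrow> 's) \<times> real) stream \<Rightarrow> nat \<Rightarrow> real" where
  "holding_time Q x \<omega> n = snd (\<omega> !! n) / hold_rate Q (jump_chain x \<omega> n)"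

text \<open>State at time \<open>t\<close>, started from \<open>x\<close>; unspecified after an explosion, which has probability 0
  when the rates are bounded.\<close>

definition state_at ::
    "('s \<Rightarrow> 's measure) \<Rightarrow> 's \<Rightarrow> real \<Rightarrow> (('s \<Rightarrow> 's) \<times> real) stream \<Rightarrow> 's" where
  "state_at Q x t \<omega> = jump_chain x \<omega> (LEAST n. t < (\<Sum>k\<le>n. holding_time Q x \<omega> k))"

definition transition :: "('s::topological_space \<Rightarrow> 's measure) \<Rightarrow> real \<Rightarrow> 's \<Rightarrow> 's measure" where
  "transition Q t x = distr (noise Q) borel (state_at Q x t)"

definition occupation_time ::
    "('s \<Rightarrow> 's measure) \<Rightarrow> 's \<Rightarrow> 's set \<Rightarrow> (('s \<Rightarrow> 's) \<times> real) stream \<Rightarrow> ennreal" where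
  "occupation_time Q x A \<omega> = (\<integral>\<^sup>+t\<in>{0..}. indicator A (state_at Q x t \<omega>) \<partial>lborel)"

text \<open>Irreducibility with respect to some irreducibility measure \<open>\<phi>\<close>, as in the theory of Harris
  processes; communication of all states is the case where \<open>\<phi>\<close> is counting measure.\<close>

definition irreducible_process :: "('s::topological_space \<Rightarrow> 's measure) \<Rightarrow> bool" where
  "irreducible_process Q \<longleftrightarrow>
     (\<exists>\<phi>. sigma_finite_measure \<phi> \<and> sets \<phi> = sets borel \<and> emeasure \<phi> UNIV \<noteq> 0 \<and>
        (\<forall>A\<in>sets borel. emeasure \<phi> A > 0 \<longrightarrow> (\<forall>x. (\<integral>\<^sup>+\<omega>. occupation_time Q x A \<omega> \<partial>noise Q) > 0)))"

definition harris_recurrent :: "('s::topological_space \<Rightarrow> 's measure) \<Rightarrow> bool" where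
  "harris_recurrent Q \<longleftrightarrow>
     (\<exists>\<phi>. sigma_finite_measure \<phi> \<and> sets \<phi> = sets borel \<and> emeasure \<phi> UNIV \<noteq> 0 \<and>
        (\<forall>A\<in>sets borel. emeasure \<phi> A > 0 \<longrightarrow> (\<forall>x. AE \<omega> in noise Q. occupation_time Q x A \<omega> = \<infinity>)))"

definition invariant_prob :: "('s::topological_space \<Rightarrow> 's measure) \<Rightarrow> 's measure \<Rightarrow> bool" where
  "invariant_prob Q \<pi> \<longleftrightarrow>
     \<pi> \<in> space (prob_algebra borel) \<and> (\<forall>t\<ge>0. \<pi> \<bind> transition Q t = \<pi>)"

definition positive_harris_recurrent :: "('s::topological_space \<Rightarrow> 's measure) \<Rightarrow> bool" where
  "positive_harris_recurrent Q \<longleftrightarrow> harris_recurrent Q \<and> (\<exists>\<pi>. invariant_prob Q \<pi>)"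


section \<open>Dual and primal problems on \<open>[0,T]\<close>\<close>

definition time_deriv :: "real \<Rightarrow> (real \<Rightarrow> 's \<Rightarrow> real) \<Rightarrow> real \<Rightarrow> 's \<Rightarrow> real" where
  "time_deriv T f t x = vector_derivative (\<lambda>s. f s x) (at t within {0..T})"

definition time_differentiable :: "real \<Rightarrow> (real \<Rightarrow> 's \<Rightarrow> real) \<Rightarrow> bool" where
  "time_differentiable T f \<longleftrightarrow> (\<forall>x. (\<lambda>s. f s x) differentiable_on {0..T})"

text \<open>A real supremum: for \<open>c \<ge> 0\<close>, nonempty \<open>U\<close> and \<open>V\<close>-bounded \<open>f\<close> it is finite whenever
  \<open>u \<mapsto> q x u\<close> integrates \<open>1 + V\<close> uniformly.\<close>

definition Ham ::
    "('s \<Rightarrow> 'u \<Rightarrow> 's measure) \<Rightarrow> 'u set \<Rightarrow> ('s \<Rightarrow> 'u \<Rightarrow> real) \<Rightarrow> ('s \<Rightarrow> real) \<Rightarrow> 's \<Rightarrow> real" where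
  "Ham q U c f x = (SUP u\<in>U. gen q u f x - c x u)"

definition solves_HJB ::
    "('s \<Rightarrow> 'u \<Rightarrow> 's measure) \<Rightarrow> 'u set \<Rightarrow> ('s \<Rightarrow> 'u \<Rightarrow> real) \<Rightarrow> real \<Rightarrow> (real \<Rightarrow> 's \<Rightarrow> real) \<Rightarrow> bool" where
  "solves_HJB q U c T f \<longleftrightarrow> (\<forall>t\<in>{0..T}. \<forall>x. time_deriv T f t x + Ham q U c (f t) x = 0)"

definition dual_class ::
    "('s \<Rightarrow> 'u \<Rightarrow> 's measure) \<Rightarrow> 'u set \<Rightarrow> ('s \<Rightarrow> 'u \<Rightarrow> real) \<Rightarrow> ('s \<Rightarrow> real) \<Rightarrow> real
      \<Rightarrow> (real \<Rightarrow> 's \<Rightarrow> real) set" where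
  "dual_class q U c V T = {f.
     time_differentiable T f \<and> (\<forall>x. continuous_on {0..T} (\<lambda>t. time_deriv T f t x)) \<and>
     (SUP t\<in>{0..T}. Vnorm V (f t)) + (SUP t\<in>{0..T}. Vnorm V (time_deriv T f t)) < \<infinity> \<and>
     solves_HJB q U c T f}"

text \<open>Bounded and uniformly continuous on \<open>[0,T] \<times> S\<close>, for the 0-1 metric on \<open>S\<close>.\<close>

definition bdd_unif_cont :: "real \<Rightarrow> (real \<Rightarrow> 's \<Rightarrow> real) \<Rightarrow> bool" where
  "bdd_unif_cont T f \<longleftrightarrow>
     (\<exists>B. \<forall>t\<in>{0..T}. \<forall>x. \<bar>f t x\<bar> \<le> B) \<and>
     (\<forall>e>0. \<exists>d>0. \<forall>s\<in>{0..T}. \<forall>t\<in>{0..T}. \<bar>s - t\<bar> < d \<longrightarrow> (\<forall>x. \<bar>f s x - f t x\<bar> < e))"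

definition test_functions :: "real \<Rightarrow> (real \<Rightarrow> 's \<Rightarrow> real) set" where
  "test_functions T = {f. time_differentiable T f \<and> bdd_unif_cont T f \<and> bdd_unif_cont T (time_deriv T f)}"

text \<open>\<open>p\<close> is the disintegration of \<open>\<pi>\<close> and \<open>m\<close> the weakly continuous version of its state marginal.\<close>

definition primal_feasible ::
    "('s::{countable,discrete_topology} \<Rightarrow> 'u::euclidean_space \<Rightarrow> 's measure) \<Rightarrow> 'u set \<Rightarrow> ('s \<Rightarrow> real)
      \<Rightarrow> real \<Rightarrow> 's measure \<Rightarrow> (real \<times> 's \<times> 'u) measure \<Rightarrow> bool" where
  "primal_feasible q U V T \<nu> \<pi> \<longleftrightarrow>
     sets \<pi> = sets (restrict_space borel {0..T} \<Otimes>\<^sub>M borel \<Otimes>\<^sub>M restrict_space borel U) \<and>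
     (\<exists>p m.
        p \<in> restrict_space borel {0..T} \<rightarrow>\<^sub>M prob_algebra (borel \<Otimes>\<^sub>M restrict_space borel U) \<and>
        (\<forall>A\<in>sets \<pi>. emeasure \<pi> A = (\<integral>\<^sup>+t\<in>{0..T}. emeasure (p t) (Pair t -` A) \<partial>lborel)) \<and>
        (\<forall>t\<in>{0..T}. m t \<in> space (prob_algebra borel)) \<and>
        (AE t in lborel. t \<in> {0..T} \<longrightarrow> distr (p t) borel fst = m t) \<and>
        (\<forall>\<phi> :: 's \<Rightarrow> real. continuous_on UNIV \<phi> \<longrightarrow> bounded (range \<phi>) \<longrightarrow>
           continuous_on {0..T} (\<lambda>t. LINT x|m t. \<phi> x)) \<and>
        m 0 = \<nu> \<and> m T = \<nu>) \<and>
     (\<forall>f\<in>test_functions T.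
        (LINT x|\<nu>. f T x - f 0 x) = (LINT (t, x, u)|\<pi>. time_deriv T f t x + gen q u (f t) x)) \<and>
     (\<integral>\<^sup>+(t, x, u). ennreal (1 + V x) \<partial>\<pi>) < \<infinity>"

text \<open>The infimum over the empty set is \<open>\<infinity>\<close> in \<open>ereal\<close>.\<close>

definition primal_value ::
    "('s::{countable,discrete_topology} \<Rightarrow> 'u::euclidean_space \<Rightarrow> 's measure) \<Rightarrow> 'u set
      \<Rightarrow> ('s \<Rightarrow> 'u \<Rightarrow> real) \<Rightarrow> ('s \<Rightarrow> real) \<Rightarrow> real \<Rightarrow> 's measure \<Rightarrow> ereal" where
  "primal_value q U c V T \<nu> =
     (INF \<pi>\<in>{\<pi>. primal_feasible q U V T \<nu> \<pi>}. enn2ereal (\<integral>\<^sup>+(t, x, u). ennreal (c x u) \<partial>\<pi>))"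

end

theory Submission
  imports Defs
begin

text \<open>Since \<open>us x\<close> maximises \<open>G\<^sup>u h(x) - c(x,u)\<close>, the Poisson equation says that
\<open>gs + G\<^sup>u h(x) \<le> c(x,u)\<close> for every control, with equality at \<open>u = us x\<close>.  Both halves of the duality come
from averaging this inequality.  Under the stationary law of \<open>us\<close> the term with the generator vanishes
and the mean cost is exactly \<open>gs\<close> (\<open>mean_cost\<close>); the product of that law with Lebesgue measure is
a feasible plan of cost \<open>T * gs\<close>.  For an arbitrary feasible plan, the balance constraint applied to
test functions constant in time makes the generator term vanish again, so its cost is at least
\<open>T * gs\<close> (\<open>cost_ge_if_primal_feasible\<close>).  On the dual side, a solution of the Hamilton-Jacobi
equation satisfies \<open>\<partial>\<^sub>t f \<le> c - G f\<close> along \<open>us\<close>, so \<open>t \<mapsto> \<integral> f\<^sub>t\<close> grows at rate at most \<open>gs\<close>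
(\<open>dual_value_le\<close>), and \<open>h(x) + (t - T) gs\<close> grows at exactly this rate.

Stationarity of a law and balance of a plan concern bounded functions only, whereas \<open>h\<close> is merely bounded
by a multiple of \<open>1 + V\<close>.  Truncating \<open>h\<close> and applying dominated convergence, with the growth bound on
\<open>\<integral> (1 + V) dq\<close>, bridges the gap (\<open>integral_gen_weighted_eq_0\<close>).

The stationary law comes from the Poisson equation as well.  It reads \<open>G(-h)(x) = gs - c(x, us x)\<close>, so
\<open>-h\<close>, shifted to be nonnegative, is a Lyapunov function whose drift is at most \<open>gs - inf\<^sub>u c(x,u)\<close>, and
this tends to \<open>-\<infinity>\<close> at infinity.  As the rates are bounded by some \<open>\<Lambda>\<close>, the operator \<open>f + G f / \<Lambda>\<close> is that of
a discrete-time chain, the uniformised chain.  For this chain the drift gives tightness of the Cesaro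
averages and hence a stationary law (\<open>stationary_pmf_exists\<close>); accessibility of one state gives
uniqueness (\<open>stationary_pmf_unique\<close>).  Harris recurrence is a maximum principle: the function
\<open>L(x) = E\<^sub>x exp(- time spent in z)\<close> satisfies \<open>G L = 0\<close> off \<open>z\<close> and \<open>G L(z) = L(z)\<close>, which under the drift
condition forces \<open>L = 0\<close> (\<open>subharmonic_discounted_eq_0\<close>, \<open>harris_recurrent_if_drift\<close>).

Apart from non-explosion, the process enters through one identity, the decomposition of its noise at the first
jump (\<open>nn_integral_first_jump\<close>).  It yields the equations for \<open>L\<close> and also the backward equation
\<open>\<partial>\<^sub>t P\<^sub>t 1\<^sub>A = G P\<^sub>t 1\<^sub>A\<close> (\<open>backward_equation\<close>), by which a law is invariant for the process exactly
if it is stationary for the uniformised chain (\<open>invariant_prob_pmf_iff\<close>).\<close>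

section \<open>Stationary laws and a maximum principle for countable Markov chains\<close>

lemma pmf_eqI_le:
  assumes le: "\<And>y. pmf p y \<le> pmf q y"
  shows "p = q"
proof (rule pmf_eqI)
  have "(\<integral>\<^sup>+y. ennreal (pmf q y) - ennreal (pmf p y) \<partial>count_space UNIV) = 0"
    using le by (subst nn_integral_diff) (auto simp: nn_integral_pmf ennreal_leI)
  then have "ennreal (pmf q y) - ennreal (pmf p y) = 0" for y
    by (subst (asm) nn_integral_0_iff_AE) (auto simp: AE_count_space)
  then show "pmf p y = pmf q y" for y
    using le[of y] by (metis diff_eq_0_iff_ennreal ennreal_le_iff order_antisym pmf_nonneg ennreal_less_top ennreal_minus_eq_0)
qed

text \<open>Adding the bound \<open>B\<close> makes the integrand nonnegative, where the identity is known for the Lebesgue integral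
in the extended half-line.\<close>

lemma integral_bind_pmf_bounded:
  fixes f :: "'a \<Rightarrow> real"
  assumes B: "\<And>x. \<bar>f x\<bar> \<le> B"
  shows "(\<integral>y. f y \<partial>bind_pmf p K) = (\<integral>x. \<integral>y. f y \<partial>K x \<partial>p)"
proof -
  have int: "integrable (measure_pmf q) f" for q
    using B by (intro measure_pmf.integrable_const_bound[where B=B]) auto
  have shift: "(\<integral>y. f y + B \<partial>measure_pmf q) = (\<integral>y. f y \<partial>q) + B" for q
    using int[of q] by simp
  have nonneg: "0 \<le> f y + B" for y
    using B[of y] by linarith
  have bnd: "\<bar>\<integral>y. f y \<partial>measure_pmf q\<bar> \<le> B" for q
    using measure_pmf.integral_le_const[OF int, where c=B] measure_pmf.integral_ge_const[OF int, where c="-B"] B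
    by (auto simp: abs_le_iff minus_le_iff)
  have nn: "(\<integral>\<^sup>+y. ennreal (f y + B) \<partial>measure_pmf q) = ennreal ((\<integral>y. f y \<partial>q) + B)" for q
    using int[of q] nonneg by (subst nn_integral_eq_integral) auto
  have int2: "integrable (measure_pmf p) (\<lambda>x. \<integral>y. f y \<partial>K x)"
    using bnd by (intro measure_pmf.integrable_const_bound[where B=B]) auto
  have ge: "0 \<le> (\<integral>y. f y \<partial>measure_pmf q) + B" for q
    using bnd[of q] by linarith
  have "ennreal ((\<integral>y. f y \<partial>bind_pmf p K) + B) = (\<integral>\<^sup>+x. \<integral>\<^sup>+y. ennreal (f y + B) \<partial>K x \<partial>p)"
    unfolding nn[symmetric] by simp
  also have "\<dots> = ennreal ((\<integral>x. (\<integral>y. f y \<partial>K x) \<partial>p) + B)"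
    unfolding nn using int2 ge by (subst nn_integral_eq_integral) auto
  finally show ?thesis
    using ge[of "bind_pmf p K"] integral_nonneg_AE[of "\<lambda>x. (\<integral>y. f y \<partial>K x) + B" p] ge int2
    by (subst (asm) ennreal_inj) auto
qed

text \<open>On the set \<open>A\<close> where \<open>p\<close> exceeds \<open>q\<close>, the signed measure \<open>p - q\<close> is positive, and it is nonpositive elsewhere.
Stationarity of both laws gives \<open>\<Sum>\<^sub>x (p - q)(x) (1\<^sub>A(x) - K(x,A)) = 0\<close>, and every summand is
nonnegative; hence \<open>K(x,A) = 1\<close> for \<open>x\<close> in \<open>A\<close>.\<close>

lemma stationary_pmf_excess_set_closed:
  fixes K :: "'s::countable \<Rightarrow> 's pmf"
  assumes p: "bind_pmf p K = p" and q: "bind_pmf q K = q"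
    and x: "pmf q x < pmf p x" and y: "y \<in> set_pmf (K x)"
  shows "pmf q y < pmf p y"
proof -
  define A where "A = {x. pmf q x < pmf p x}"
  define d where "d x = pmf p x - pmf q x" for x
  have int1: "integrable (count_space UNIV) (pmf r)" for r :: "'s pmf"
    by (rule integrable_pmf)
  have int: "integrable (count_space UNIV) (\<lambda>x. pmf r x * f x)" if "\<And>x. \<bar>f x\<bar> \<le> 1"
    for r :: "'s pmf" and f :: "'s \<Rightarrow> real"
    using that by (intro Bochner_Integration.integrable_bound[OF int1[of r]])
      (auto simp: abs_mult mult_left_le)
  have eq: "(\<integral>x. pmf r x * f x \<partial>count_space UNIV) = (\<integral>x. f x \<partial>r)"
    for r :: "'s pmf" and f :: "'s \<Rightarrow> real"
    by (simp add: measure_pmf_eq_density integral_density)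
  have stat: "(\<integral>x. measure (K x) A \<partial>r) = (\<integral>x. indicator A x \<partial>measure_pmf r)" if "bind_pmf r K = r" for r
    using integral_bind_pmf_bounded[of "indicator A" 1 r K] that by simp
  have "(\<integral>x. d x * (indicator A x - measure (K x) A) \<partial>count_space UNIV) =
      (\<integral>x. (pmf p x * indicator A x - pmf p x * measure (K x) A)
          - (pmf q x * indicator A x - pmf q x * measure (K x) A) \<partial>count_space UNIV)"
    by (simp add: d_def algebra_simps)
  also have "\<dots> = 0"
    using p q by (simp add: int eq stat del: integral_indicator Bochner_Integration.integral_indicator)
  finally have 0: "(\<integral>x. d x * (indicator A x - measure (K x) A) \<partial>count_space UNIV) = 0" .
  have nonneg: "0 \<le> d x * (indicator A x - measure (K x) A)" for x
    by (cases "x \<in> A") (auto simp: A_def d_def not_less intro!: mult_nonneg_nonneg mult_nonpos_nonneg)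
  have "integrable (count_space UNIV) (\<lambda>x. d x * (indicator A x - measure (K x) A))"
    unfolding d_def left_diff_distrib
    by (intro Bochner_Integration.integrable_diff int) (auto simp: indicator_def)
  then have "d x * (indicator A x - measure (K x) A) = 0"
    using 0 nonneg by (subst (asm) integral_nonneg_eq_0_iff_AE) (auto simp: AE_count_space)
  then have "measure (K x) A = 1"
    using x by (auto simp: d_def A_def)
  then have "set_pmf (K x) \<subseteq> A"
    using measure_pmf.prob_eq_1[of A "K x"] by (auto simp: AE_measure_pmf_iff)
  with y show ?thesis by (auto simp: A_def)
qed

text \<open>If the two laws differed, each would exceed the other somewhere, since both have mass one.  The two
disjoint excess sets are closed under the chain, so both would contain \<open>z\<close>.\<close>

lemma stationary_pmf_unique:
  fixes K :: "'s::countable \<Rightarrow> 's pmf"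
  assumes p: "bind_pmf p K = p" and q: "bind_pmf q K = q"
    and z: "\<And>A. A \<noteq> {} \<Longrightarrow> (\<And>x. x \<in> A \<Longrightarrow> set_pmf (K x) \<subseteq> A) \<Longrightarrow> z \<in> A"
  shows "p = q"
proof (rule ccontr)
  assume "p \<noteq> q"
  then have "{x. pmf q x < pmf p x} \<noteq> {}" "{x. pmf p x < pmf q x} \<noteq> {}"
    using pmf_eqI_le[of p q] pmf_eqI_le[of q p] by (force simp: not_le[symmetric])+
  then have "z \<in> {x. pmf q x < pmf p x}" "z \<in> {x. pmf p x < pmf q x}"
    using stationary_pmf_excess_set_closed[OF p q] stationary_pmf_excess_set_closed[OF q p]
    by (intro z; blast)+
  then show False by simp
qed

text \<open>A Foster-Lyapunov condition in which the drift \<open>g - c\<close> tends to \<open>-\<infinity>\<close> off finite sets.  This is stronger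
than negativity off a finite set and makes the occupation averages tight.\<close>

locale drift_chain =
  fixes K :: "'s::countable \<Rightarrow> 's pmf" and w c :: "'s \<Rightarrow> real" and g :: real
  assumes w_nonneg: "\<And>x. 0 \<le> w x"
    and c_nonneg: "\<And>x. 0 \<le> c x"
    and w_finite_sublevel: "\<And>r. finite {x. w x \<le> r}"
    and c_finite_sublevel: "\<And>r. finite {x. c x \<le> r}"
    and w_integrable: "\<And>x. integrable (K x) w"
    and drift: "\<And>x. (\<integral>y. w y \<partial>K x) \<le> w x + g - c x"
begin

text \<open>The Krylov-Bogoliubov argument.  Summing the drift inequality along the chain bounds the mean of \<open>c\<close>
under the Cesaro averages \<open>\<alpha> n\<close> uniformly in \<open>n\<close>, so by Markov's inequality no mass escapes to infinity.
By Tychonoff's theorem a subsequence of the averages converges pointwise, and tightness gives the limit mass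
one.  Fatou's lemma shows that the limit dominates its own image under the chain; equal total mass turns this into
equality.\<close>

lemma stationary_pmf_exists: "\<exists>p. bind_pmf p K = p"
proof -
  define G where "G = max g 0"
  have G: "0 \<le> G" "g \<le> G" by (auto simp: G_def)
  have nn_drift: "(\<integral>\<^sup>+y. w y \<partial>K x) + ennreal (c x) \<le> ennreal (w x) + ennreal G" for x
  proof -
    have "(\<integral>\<^sup>+y. w y \<partial>K x) + ennreal (c x) = ennreal ((\<integral>y. w y \<partial>K x) + c x)"
      using w_integrable w_nonneg c_nonneg by (subst nn_integral_eq_integral) auto
    also have "\<dots> \<le> ennreal (w x + G)"
      using drift[of x] G by (intro ennreal_leI) linarith
    finally show ?thesis using G w_nonneg by simp
  qed
  define x0 :: 's where "x0 = undefined"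
  define \<mu> where "\<mu> n = ((\<lambda>p. bind_pmf p K) ^^ n) (return_pmf x0)" for n
  have \<mu>_Suc: "\<mu> (Suc n) = bind_pmf (\<mu> n) K" for n by (simp add: \<mu>_def)
  have step: "(\<integral>\<^sup>+x. c x \<partial>\<mu> n) + (\<integral>\<^sup>+x. w x \<partial>\<mu> (Suc n)) \<le> (\<integral>\<^sup>+x. w x \<partial>\<mu> n) + ennreal G" for n
  proof -
    have "(\<integral>\<^sup>+x. c x \<partial>\<mu> n) + (\<integral>\<^sup>+x. w x \<partial>\<mu> (Suc n)) = (\<integral>\<^sup>+x. (\<integral>\<^sup>+y. w y \<partial>K x) + ennreal (c x) \<partial>\<mu> n)"
      by (simp add: \<mu>_Suc nn_integral_add add.commute)
    also have "\<dots> \<le> (\<integral>\<^sup>+x. ennreal (w x) + ennreal G \<partial>\<mu> n)"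
      by (intro nn_integral_mono nn_drift)
    finally show ?thesis by (simp add: nn_integral_add)
  qed
  have sum_le: "(\<Sum>k<n. \<integral>\<^sup>+x. c x \<partial>\<mu> k) + (\<integral>\<^sup>+x. w x \<partial>\<mu> n) \<le> ennreal (w x0 + real n * G)" for n
  proof (induction n)
    case 0 then show ?case by (simp add: \<mu>_def)
  next
    case (Suc n)
    have "(\<Sum>k<Suc n. \<integral>\<^sup>+x. c x \<partial>\<mu> k) + (\<integral>\<^sup>+x. w x \<partial>\<mu> (Suc n)) \<le>
      (\<Sum>k<n. \<integral>\<^sup>+x. c x \<partial>\<mu> k) + ((\<integral>\<^sup>+x. w x \<partial>\<mu> n) + ennreal G)"
      using step[of n] by (simp add: add.assoc add_left_mono)
    also have "\<dots> \<le> ennreal (w x0 + real n * G) + ennreal G"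
      using Suc by (simp add: add.assoc[symmetric] add_right_mono)
    also have "\<dots> = ennreal (w x0 + real (Suc n) * G)"
      using w_nonneg[of x0] G by (subst ennreal_plus[symmetric]) (auto simp: algebra_simps)
    finally show ?case .
  qed
  define \<alpha> where "\<alpha> n = bind_pmf (pmf_of_set {..<Suc n}) \<mu>" for n
  define H where "H = w x0 + G"
  have H: "0 \<le> H" using w_nonneg[of x0] G by (simp add: H_def)
  have \<alpha>_cost: "(\<integral>\<^sup>+x. c x \<partial>\<alpha> n) \<le> ennreal H" for n
  proof -
    have "(\<integral>\<^sup>+x. c x \<partial>\<alpha> n) = (\<Sum>k<Suc n. \<integral>\<^sup>+x. c x \<partial>\<mu> k) / ennreal (Suc n)"
      unfolding \<alpha>_def nn_integral_bind_pmf
      by (subst nn_integral_pmf_of_set) (auto simp: ennreal_of_nat_eq_real_of_nat)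
    also have "\<dots> \<le> ennreal (w x0 + real (Suc n) * G) / ennreal (Suc n)"
      by (intro divide_right_mono_ennreal order_trans[OF _ sum_le[of "Suc n"]]) simp
    also have "\<dots> = ennreal ((w x0 + real (Suc n) * G) / real (Suc n))"
      using w_nonneg[of x0] G by (intro divide_ennreal) auto
    also have "\<dots> \<le> ennreal H"
      using w_nonneg[of x0] G unfolding H_def
      by (intro ennreal_leI) (simp add: field_simps)
    finally show ?thesis .
  qed
  have \<alpha>_invariant: "\<bar>pmf (bind_pmf (\<alpha> n) K) y - pmf (\<alpha> n) y\<bar> \<le> 1 / real (Suc n)" for n y
  proof -
    have 1: "pmf (\<alpha> n) y = (\<Sum>k<Suc n. pmf (\<mu> k) y) / real (Suc n)"
      unfolding \<alpha>_def pmf_bind by (subst integral_pmf_of_set) auto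
    have "bind_pmf (\<alpha> n) K = bind_pmf (pmf_of_set {..<Suc n}) (\<lambda>k. \<mu> (Suc k))"
      unfolding \<alpha>_def by (simp add: bind_assoc_pmf \<mu>_Suc)
    then have 2: "pmf (bind_pmf (\<alpha> n) K) y = (\<Sum>k<Suc n. pmf (\<mu> (Suc k)) y) / real (Suc n)"
      by (simp only: pmf_bind, subst integral_pmf_of_set) auto
    have "pmf (bind_pmf (\<alpha> n) K) y - pmf (\<alpha> n) y = (pmf (\<mu> (Suc n)) y - pmf (\<mu> 0) y) / real (Suc n)"
      unfolding 1 2 using sum_lessThan_telescope[of "\<lambda>k. pmf (\<mu> k) y" "Suc n"]
      by (simp add: diff_divide_distrib[symmetric] sum_subtractf del: sum.lessThan_Suc)
    moreover have "\<bar>pmf (\<mu> (Suc n)) y - pmf (\<mu> 0) y\<bar> \<le> 1"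
      using pmf_le_1[of "\<mu> (Suc n)" y] pmf_le_1[of "\<mu> 0" y] pmf_nonneg[of "\<mu> (Suc n)" y] pmf_nonneg[of "\<mu> 0" y]
      by linarith
    ultimately show ?thesis by (simp add: abs_divide divide_right_mono)
  qed
  have "compact (PiE UNIV (\<lambda>_. {0..1}) :: ('s \<Rightarrow> real) set)"
    using compactin_PiE[where I="UNIV :: 's set" and X="\<lambda>_. euclidean" and S="\<lambda>_. {0..1::real}"]
    by (auto simp: euclidean_product_topology)
  then have sc: "seq_compact (PiE UNIV (\<lambda>_. {0..1}) :: ('s \<Rightarrow> real) set)"
    by (simp only: compact_eq_seq_compact_metric)
  have "\<forall>n. pmf (\<alpha> n) \<in> PiE UNIV (\<lambda>_. {0..1})"
    by (auto simp: PiE_def pmf_le_1)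
  from seq_compactE[OF sc this] obtain l r where l: "l \<in> PiE UNIV (\<lambda>_. {0..1::real})" and r: "strict_mono r"
    and lim': "(\<lambda>n. pmf (\<alpha> (r n))) \<longlonglongrightarrow> l"
    by (auto simp: o_def)
  have lim: "(\<lambda>n. pmf (\<alpha> (r n)) y) \<longlonglongrightarrow> l y" for y
  proof -
    have "continuous_on UNIV (\<lambda>f :: 's \<Rightarrow> real. f y)" by simp
    then have "isCont (\<lambda>f. f y) l"
      by (rule continuous_on_eq_continuous_at[OF open_UNIV, THEN iffD1, THEN bspec, OF _ UNIV_I])
    from isCont_tendsto_compose[OF this lim'] show ?thesis by (simp add: o_def)
  qed
  have l_nonneg: "0 \<le> l y" for y
    using l by (auto simp: PiE_def Pi_def)
  have l_mass: "(\<integral>\<^sup>+y. l y \<partial>count_space UNIV) = 1"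
  proof (rule antisym)
    have "(\<integral>\<^sup>+y. l y \<partial>count_space UNIV) = (\<integral>\<^sup>+y. liminf (\<lambda>n. ennreal (pmf (\<alpha> (r n)) y)) \<partial>count_space UNIV)"
      using lim by (intro nn_integral_cong lim_imp_Liminf[symmetric] tendsto_ennrealI) auto
    also have "\<dots> \<le> liminf (\<lambda>n. \<integral>\<^sup>+y. ennreal (pmf (\<alpha> (r n)) y) \<partial>count_space UNIV)"
      by (intro nn_integral_liminf) auto
    also have "\<dots> = 1"
      by (simp add: nn_integral_pmf Liminf_const)
    finally show "(\<integral>\<^sup>+y. l y \<partial>count_space UNIV) \<le> 1" .
    have lower: "ennreal (1 - H / R) \<le> (\<integral>\<^sup>+y. l y \<partial>count_space UNIV)" if R: "0 < R" for R
    proof -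
      define F where "F = {x. c x \<le> R}"
      have F: "finite F" unfolding F_def by (rule c_finite_sublevel)
      have "1 - H / R \<le> (\<Sum>y\<in>F. pmf (\<alpha> n) y)" for n
      proof -
        have "ennreal R * emeasure (\<alpha> n) (-F) = (\<integral>\<^sup>+x. ennreal R * indicator (-F) x \<partial>\<alpha> n)"
          by (simp add: nn_integral_cmult_indicator)
        also have "\<dots> \<le> (\<integral>\<^sup>+x. c x \<partial>\<alpha> n)"
          by (intro nn_integral_mono) (auto simp: F_def indicator_def ennreal_leI)
        also have "\<dots> \<le> ennreal H" by (rule \<alpha>_cost)
        finally have "R * measure (\<alpha> n) (-F) \<le> H"
          using R H by (simp add: measure_pmf.emeasure_eq_measure ennreal_mult[symmetric])
        moreover have "measure (\<alpha> n) (-F) = 1 - measure (\<alpha> n) F"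
          using measure_pmf.prob_compl[of F "\<alpha> n"] by (simp add: Compl_eq_Diff_UNIV)
        ultimately have "1 - measure (\<alpha> n) F \<le> H / R"
          using R by (simp add: field_simps)
        then show ?thesis using F by (simp add: measure_measure_pmf_finite)
      qed
      then have "1 - H / R \<le> (\<Sum>y\<in>F. l y)"
        by (intro LIMSEQ_le_const[OF tendsto_sum[OF lim]]) auto
      then have "ennreal (1 - H / R) \<le> ennreal (\<Sum>y\<in>F. l y)" by (rule ennreal_leI)
      also have "\<dots> = (\<integral>\<^sup>+y. l y \<partial>count_space F)"
        using F l_nonneg by (simp add: nn_integral_count_space_finite)
      also have "\<dots> \<le> (\<integral>\<^sup>+y. l y \<partial>count_space UNIV)"
        by (subst nn_integral_count_space_indicator) (auto intro!: nn_integral_mono simp: indicator_def)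
      finally show ?thesis .
    qed
    have "(\<lambda>n. ennreal (1 - H / real (Suc n))) \<longlonglongrightarrow> ennreal (1 - 0)"
      by (intro tendsto_ennrealI tendsto_diff tendsto_const LIMSEQ_Suc[OF lim_const_over_n])
    then have "ennreal 1 \<le> (\<integral>\<^sup>+y. l y \<partial>count_space UNIV)"
      by (intro LIMSEQ_le_const2) (use lower in auto)
    then show "1 \<le> (\<integral>\<^sup>+y. l y \<partial>count_space UNIV)" by simp
  qed
  define p where "p = embed_pmf l"
  have p: "pmf p y = l y" for y
    unfolding p_def by (rule pmf_embed_pmf[OF l_nonneg l_mass])
  have "pmf (bind_pmf p K) y \<le> pmf p y" for y
  proof -
    have lim2: "(\<lambda>n. pmf (bind_pmf (\<alpha> (r n)) K) y) \<longlonglongrightarrow> l y"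
    proof (rule Lim_transform[OF lim[of y]])
      have "(\<lambda>n. 1 / real (Suc (r n))) \<longlonglongrightarrow> 0"
        using LIMSEQ_subseq_LIMSEQ[OF LIMSEQ_Suc[OF lim_const_over_n[of 1]] r] by (simp add: o_def)
      then show "(\<lambda>n. pmf (bind_pmf (\<alpha> (r n)) K) y - pmf (\<alpha> (r n)) y) \<longlonglongrightarrow> 0"
        by (rule Lim_null_comparison[rotated])
          (intro always_eventually allI, unfold real_norm_def, rule \<alpha>_invariant)
    qed
    have "ennreal (pmf (bind_pmf p K) y) = (\<integral>\<^sup>+x. ennreal (l x) * ennreal (pmf (K x) y) \<partial>count_space UNIV)"
      unfolding ennreal_pmf_bind nn_integral_measure_pmf p ..
    also have "\<dots> = (\<integral>\<^sup>+x. liminf (\<lambda>n. ennreal (pmf (\<alpha> (r n)) x) * ennreal (pmf (K x) y)) \<partial>count_space UNIV)"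
      using lim by (intro nn_integral_cong lim_imp_Liminf[symmetric] ennreal_tendsto_cmult tendsto_ennrealI)
        (auto simp: ennreal_mult[symmetric] l_nonneg intro!: tendsto_ennrealI tendsto_mult)
    also have "\<dots> \<le> liminf (\<lambda>n. \<integral>\<^sup>+x. ennreal (pmf (\<alpha> (r n)) x) * ennreal (pmf (K x) y) \<partial>count_space UNIV)"
      by (intro nn_integral_liminf) auto
    also have "\<dots> = liminf (\<lambda>n. ennreal (pmf (bind_pmf (\<alpha> (r n)) K) y))"
      unfolding ennreal_pmf_bind nn_integral_measure_pmf ..
    also have "\<dots> = ennreal (l y)"
      using lim2 by (intro lim_imp_Liminf tendsto_ennrealI) auto
    finally show ?thesis by (simp add: p l_nonneg)
  qed
  then show ?thesis using pmf_eqI_le by blast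
qed

text \<open>A strong maximum principle.  For \<open>e > 0\<close> the function \<open>L - e * w\<close> attains its maximum, because \<open>L\<close> is
bounded and \<open>w\<close> grows; off the finite set \<open>F\<close> where \<open>c \<le> g\<close> this function is strictly
subharmonic, so the maximum lies in \<open>F\<close>.  Letting \<open>e\<close> tend to 0, \<open>L\<close> attains its own maximum in \<open>F\<close>.
The set of its maximisers is closed under the chain and so contains \<open>z\<close>, where the factor \<open>\<theta> < 1\<close> forces the
maximum to be 0.\<close>

lemma subharmonic_discounted_eq_0:
  assumes L_nonneg: "\<And>x. 0 \<le> L x" and L_bdd: "\<And>x. L x \<le> B"
    and sub: "\<And>x. L x \<le> (\<integral>y. L y \<partial>K x)"
    and z: "\<And>A. A \<noteq> {} \<Longrightarrow> (\<And>x. x \<in> A \<Longrightarrow> set_pmf (K x) \<subseteq> A) \<Longrightarrow> z \<in> A"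
    and \<theta>: "0 \<le> \<theta>" "\<theta> < 1" and disc: "L z \<le> \<theta> * (\<integral>y. L y \<partial>K z)"
  shows "L x = (0::real)"
proof -
  define F where "F = {x. c x \<le> g}"
  have F: "finite F" unfolding F_def by (rule c_finite_sublevel)
  have int: "integrable (K x) L" for x
    using L_nonneg L_bdd by (intro measure_pmf.integrable_const_bound[where B=B]) auto
  have bound: "F \<noteq> {} \<and> L x0 \<le> e * w x0 + Max (L ` F)" if e: "0 < e" for e x0
  proof -
    define D where "D x = L x - e * w x" for x
    \<comment> \<open>outside the finite set \<open>S\<close> the penalty \<open>e * w\<close> exceeds \<open>B + e * w x0\<close>, so \<open>D\<close> lies below \<open>D x0\<close>\<close>
    define S where "S = {x. w x \<le> B / e + w x0}"
    have S: "finite S" unfolding S_def by (rule w_finite_sublevel)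
    have B: "0 \<le> B" using L_nonneg[of x0] L_bdd[of x0] by linarith
    have x0: "x0 \<in> S" using e B by (simp add: S_def)
    have "Max (D ` S) \<in> D ` S" using S x0 by (intro Max_in) auto
    then obtain x1 where x1S: "x1 \<in> S" "Max (D ` S) = D x1" by blast
    have x1: "D x \<le> D x1" if "x \<in> S" for x
      unfolding x1S(2)[symmetric] using S that by (intro Max_ge) auto
    have D: "D x \<le> D x1" for x
    proof (cases "x \<in> S")
      case False
      then have "B + e * w x0 < e * w x" using e by (simp add: S_def field_simps)
      then have "D x \<le> D x0" unfolding D_def using L_bdd[of x] L_nonneg[of x0] by linarith
      also have "\<dots> \<le> D x1" by (rule x1[OF x0])
      finally show ?thesis .
    qed (rule x1)
    have "x1 \<in> F"
    proof (rule ccontr)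
      assume "x1 \<notin> F"
      then have "(\<integral>y. w y \<partial>K x1) < w x1" using drift[of x1] by (simp add: F_def)
      then have "D x1 < (\<integral>y. L y \<partial>K x1) - e * (\<integral>y. w y \<partial>K x1)"
        using sub[of x1] e mult_strict_left_mono[of "(\<integral>y. w y \<partial>K x1)" "w x1" e]
        unfolding D_def by linarith
      also have "\<dots> = (\<integral>y. D y \<partial>K x1)"
        unfolding D_def using int w_integrable by simp
      also have "\<dots> \<le> D x1"
        using D int w_integrable unfolding D_def
        by (intro measure_pmf.integral_le_const) auto
      finally show False by simp
    qed
    moreover have "L x0 \<le> e * w x0 + L x1"
      using D[of x0] mult_nonneg_nonneg[OF less_imp_le[OF e] w_nonneg[of x1]] unfolding D_def by linarith
    moreover have "L x1 \<le> Max (L ` F)" using F \<open>x1 \<in> F\<close> by simp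
    ultimately show ?thesis by auto
  qed
  then have Fne: "F \<noteq> {}" using zero_less_one by blast
  have max: "L x \<le> Max (L ` F)" for x
  proof (rule tendsto_lowerbound)
    show "((\<lambda>e. e * w x + Max (L ` F)) \<longlongrightarrow> Max (L ` F)) (at_right 0)"
      by (auto intro!: tendsto_eq_intros)
    show "\<forall>\<^sub>F e in at_right 0. L x \<le> e * w x + Max (L ` F)"
      using bound[of _ x] by (auto simp: eventually_at_right_field intro!: exI[of _ 1])
  qed auto
  have "Max (L ` F) \<in> L ` F" using F Fne by (intro Max_in) auto
  then obtain x1 where x1: "L x1 = Max (L ` F)" by force
  define A where "A = {x. L x = L x1}"
  have "z \<in> A"
  proof (rule z)
    fix x assume x: "x \<in> A"
    have "(\<integral>y. L x1 - L y \<partial>K x) \<le> 0"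
      using sub[of x] x int by (simp add: A_def)
    moreover have "0 \<le> (\<integral>y. L x1 - L y \<partial>K x)"
      using max x1 by (intro Bochner_Integration.integral_nonneg) auto
    ultimately have "(\<integral>y. L x1 - L y \<partial>K x) = 0" by simp
    then have "AE y in K x. L x1 - L y = 0"
      using max x1 int by (subst (asm) integral_nonneg_eq_0_iff_AE) auto
    then show "set_pmf (K x) \<subseteq> A" by (auto simp: AE_measure_pmf_iff A_def)
  qed (auto simp: A_def)
  then have "L x1 \<le> \<theta> * (\<integral>y. L y \<partial>K z)" using disc by (simp add: A_def)
  also have "\<dots> \<le> \<theta> * L x1"
    using max x1 int \<theta> by (intro mult_left_mono measure_pmf.integral_le_const) auto
  finally have "(1 - \<theta>) * L x1 \<le> 0" by (simp add: algebra_simps)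
  then have "L x1 \<le> 0" using \<theta> by (simp add: mult_le_0_iff)
  with max[of x] x1 L_nonneg[of x] show ?thesis by simp
qed

end

section \<open>Differentiation under the integral sign\<close>

text \<open>The mean value inequality bounds the difference quotients by \<open>g\<close>, so dominated convergence applies to them.\<close>

lemma has_real_derivative_integral_dominated:
  fixes f f' :: "real \<Rightarrow> 'a \<Rightarrow> real"
  assumes S: "convex S" and t0: "t0 \<in> S"
    and deriv: "\<And>t x. t \<in> S \<Longrightarrow> ((\<lambda>s. f s x) has_real_derivative f' t x) (at t within S)"
    and dom: "\<And>t x. t \<in> S \<Longrightarrow> \<bar>f' t x\<bar> \<le> g x" and g: "integrable M g"
    and f: "\<And>t. t \<in> S \<Longrightarrow> integrable M (f t)" and f'[measurable]: "f' t0 \<in> borel_measurable M"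
  shows "((\<lambda>t. \<integral>x. f t x \<partial>M) has_real_derivative (\<integral>x. f' t0 x \<partial>M)) (at t0 within S)"
  unfolding has_field_derivative_iff tendsto_at_iff_sequentially
proof (intro allI impI)
  fix X :: "nat \<Rightarrow> real" assume X: "\<forall>i. X i \<in> S - {t0}" and lim: "X \<longlonglongrightarrow> t0"
  define D where "D i x = (f (X i) x - f t0 x) / (X i - t0)" for i x
  have int: "integrable M (D i)" for i
    unfolding D_def using X f t0 by auto
  have "(\<lambda>i. \<integral>x. D i x \<partial>M) \<longlonglongrightarrow> (\<integral>x. f' t0 x \<partial>M)"
  proof (rule integral_dominated_convergence)
    show "integrable M g" by (rule g)
    show "AE x in M. (\<lambda>i. D i x) \<longlonglongrightarrow> f' t0 x"
      using deriv[OF t0] X lim unfolding has_field_derivative_iff tendsto_at_iff_sequentially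
      by (auto simp: D_def o_def)
    show "AE x in M. norm (D i x) \<le> g x" for i
    proof (rule AE_I2)
      fix x
      have "norm (f (X i) x - f t0 x) \<le> g x * norm (X i - t0)"
        by (rule field_differentiable_bound[OF S deriv]) (use X t0 dom in auto)
      then show "norm (D i x) \<le> g x"
        using X by (auto simp: D_def field_simps)
    qed
  qed (use int in auto)
  then show "((\<lambda>y. ((\<integral>x. f y x \<partial>M) - (\<integral>x. f t0 x \<partial>M)) / (y - t0)) \<circ> X) \<longlonglongrightarrow> (\<integral>x. f' t0 x \<partial>M)"
    using X f t0 by (simp add: o_def D_def)
qed

section \<open>Exponential clocks\<close>

lemma sets_borel_discrete: "sets (borel :: 's::{countable,discrete_topology} measure) = UNIV"
proof -
  have "A \<in> sets borel" for A :: "'s set"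
    by (rule borel_open[OF discrete_topology_class.open_discrete])
  then show ?thesis by auto
qed

lemma measurable_from_discrete_borel [simp]:
  "f \<in> borel \<rightarrow>\<^sub>M N \<longleftrightarrow> range f \<subseteq> space N" for f :: "'s::{countable,discrete_topology} \<Rightarrow> _"
  by (auto simp: measurable_def sets_borel_discrete)

lemma measurable_into_discrete_borel:
  "M \<rightarrow>\<^sub>M (borel :: 's::{countable,discrete_topology} measure) = M \<rightarrow>\<^sub>M count_space UNIV"
  by (rule measurable_cong_sets) (auto simp: sets_borel_discrete)

lemma pmf_of_discrete_prob_space:
  fixes N :: "'s::countable measure"
  assumes "prob_space N" "sets N = UNIV"
  shows "measure_pmf (Abs_pmf N) = N"
proof -
  interpret prob_space N by fact
  have "AE x in N. measure N {x} \<noteq> 0"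
    using assms(2) by (subst AE_support_countable) (auto intro: exI[of _ UNIV])
  then show ?thesis using assms by (intro Abs_pmf_inverse) auto
qed

text \<open>The function \<open>exp (- a)\<close> on the extended half-line.  It turns sums of times into products, and it vanishes
exactly at infinity, so that a mean of \<open>exp_minus\<close> equal to 0 means that the time is almost surely infinite.\<close>

definition exp_minus :: "ennreal \<Rightarrow> ennreal" where
  "exp_minus a = (if a = \<infinity> then 0 else ennreal (exp (- enn2real a)))"

lemma exp_minus_add: "exp_minus (a + b) = exp_minus a * exp_minus b"
  by (auto simp: exp_minus_def enn2real_plus less_top exp_add ennreal_mult[symmetric] mult_exp_exp)

lemma exp_minus_eq_0_iff: "exp_minus a = 0 \<longleftrightarrow> a = \<infinity>"
  by (auto simp: exp_minus_def)

lemma exp_minus_le_1: "exp_minus a \<le> 1"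
  by (auto simp: exp_minus_def)

lemma exp_minus_ennreal: "0 \<le> t \<Longrightarrow> exp_minus (ennreal t) = ennreal (exp (- t))"
  by (auto simp: exp_minus_def)

lemma measurable_exp_minus [measurable]: "exp_minus \<in> borel_measurable borel"
  unfolding exp_minus_def[abs_def] by measurable

abbreviation std_exponential :: "real measure" where
  "std_exponential \<equiv> density lborel (exponential_density 1)"

lemma nn_integral_std_exponential:
  assumes [measurable]: "f \<in> borel_measurable borel"
  shows "(\<integral>\<^sup>+e. f e \<partial>std_exponential) = (\<integral>\<^sup>+e\<in>{0..}. ennreal (exp (- e)) * f e \<partial>lborel)"
  by (subst nn_integral_density)
    (auto intro!: nn_integral_cong simp: exponential_density_def split: split_indicator)

lemma AE_std_exponential_nonneg: "AE e in std_exponential. 0 \<le> e"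
  by (subst AE_density) (auto simp: exponential_density_def)

text \<open>The Laplace transform \<open>1 / (1 + 1/r)\<close> of the exponential law of parameter \<open>r\<close> at 1.\<close>

lemma std_exponential_laplace:
  assumes "0 < r"
  shows "(\<integral>\<^sup>+e. exp_minus (ennreal (e / r)) \<partial>std_exponential) = ennreal (r / (r + 1))"
proof -
  define a where "a = 1 + 1 / r"
  have a: "0 < a" "1 / a = r / (r + 1)" using assms by (auto simp: a_def field_simps)
  have "(\<integral>\<^sup>+e. exp_minus (ennreal (e / r)) \<partial>std_exponential) = (\<integral>\<^sup>+e\<in>{0..}. ennreal (exp (- a * e)) \<partial>lborel)"
    using assms by (subst nn_integral_std_exponential)
      (auto intro!: nn_integral_cong split: split_indicator
        simp: exp_minus_ennreal ennreal_mult[symmetric] mult_exp_exp a_def field_simps)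
  also have "\<dots> = ennreal (0 - (- exp (- a * 0) / a))"
  proof (rule nn_integral_FTC_atLeast)
    show "((\<lambda>e. - exp (- a * e) / a) \<longlongrightarrow> 0) at_top"
      using a(1) by real_asymp
  qed (use a(1) in \<open>auto intro!: derivative_eq_intros\<close>)
  finally show ?thesis using a by simp
qed

lemma std_exponential_tail:
  assumes "0 \<le> t"
  shows "(\<integral>\<^sup>+e. indicator {t<..} e \<partial>std_exponential) = ennreal (exp (- t))"
proof -
  have "(\<integral>\<^sup>+e. indicator {t<..} e \<partial>std_exponential) = (\<integral>\<^sup>+e. ennreal (exp (- e)) * indicator {t..} e \<partial>lborel)"
    using assms by (subst nn_integral_std_exponential, simp)
     (rule nn_integral_cong_AE, use AE_lborel_singleton[of t] in eventually_elim, auto split: split_indicator)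
  also have "\<dots> = ennreal (0 - (- exp (- t)))"
  proof (rule nn_integral_FTC_atLeast)
    show "((\<lambda>e. - exp (- e)) \<longlongrightarrow> (0::real)) at_top"
      by real_asymp
  qed (auto intro!: derivative_eq_intros)
  finally show ?thesis by simp
qed

lemma borel_measurable_integral_pmf:
  fixes f :: "'a \<Rightarrow> 's::countable \<Rightarrow> real"
  assumes [measurable]: "\<And>y. (\<lambda>t. f t y) \<in> borel_measurable N"
  shows "(\<lambda>t. \<integral>y. f t y \<partial>measure_pmf p) \<in> borel_measurable N"
proof -
  have "(\<lambda>(y, t). f t y) \<in> borel_measurable (count_space UNIV \<Otimes>\<^sub>M N)"
    by (rule measurable_pair_measure_countable1) auto
  then have "(\<lambda>(t, y). f t y) \<in> borel_measurable (N \<Otimes>\<^sub>M count_space UNIV)"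
    using measurable_pair_swap_iff[of "\<lambda>(y, t). f t y" "count_space UNIV" N] by (simp add: case_prod_beta)
  also have "borel_measurable (N \<Otimes>\<^sub>M count_space UNIV) = borel_measurable (N \<Otimes>\<^sub>M measure_pmf p)"
    by (intro measurable_cong_sets sets_pair_measure_cong) auto
  finally show ?thesis
    by (rule measure_pmf.borel_measurable_lebesgue_integral)
qed

section \<open>The generator and the uniformised chain\<close>

text \<open>The lower bound on \<open>\<Lambda>\<close> serves the absorbing states, whose holding rate is set to 1: with it, \<open>\<Lambda>\<close> bounds the
holding rate of every state.\<close>

locale bounded_jump_rates =
  fixes Q :: "'s::{countable,discrete_topology} \<Rightarrow> 's measure" and \<Lambda> :: real
  assumes finite_Q: "finite_measure (Q x)" and sets_Q: "sets (Q x) = sets borel"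
    and rate_le: "measure (Q x) UNIV \<le> \<Lambda>" and one_le: "1 \<le> \<Lambda>"
begin

abbreviation rate :: "'s \<Rightarrow> real" where "rate \<equiv> hold_rate Q"

definition generator :: "('s \<Rightarrow> real) \<Rightarrow> 's \<Rightarrow> real" where
  "generator f x = (LINT y|Q x. f y - f x)"

definition jump_pmf :: "'s \<Rightarrow> 's pmf" where
  "jump_pmf x = Abs_pmf (jump_dist Q x)"

lemma space_Q: "space (Q x) = UNIV"
  using sets_eq_imp_space_eq[OF sets_Q[of x]] by simp

lemma measurable_Q [measurable (raw)]: "f \<in> Q x \<rightarrow>\<^sub>M N" if "range f \<subseteq> space N"
  using that by (auto simp: measurable_cong_sets[OF sets_Q refl])

lemma rate_pos: "0 < rate x" and rate_le': "rate x \<le> \<Lambda>"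
  using rate_le[of x] one_le by (auto simp: hold_rate_def zero_less_measure_iff)

lemma prob_space_jump_dist: "prob_space (jump_dist Q x)"
proof -
  interpret finite_measure "Q x" by (rule finite_Q)
  show ?thesis
    by (auto simp: jump_dist_def space_Q emeasure_eq_measure
        intro!: prob_space_return prob_space_uniform_measure)
qed

lemma sets_jump_dist [simp]: "sets (jump_dist Q x) = UNIV"
  by (auto simp: jump_dist_def sets_borel_discrete sets_Q)

lemma space_jump_dist [simp]: "space (jump_dist Q x) = UNIV"
  using sets_eq_imp_space_eq[of "jump_dist Q x" "count_space UNIV"] by simp

lemma measure_jump_pmf: "measure_pmf (jump_pmf x) = jump_dist Q x"
  unfolding jump_pmf_def by (intro pmf_of_discrete_prob_space prob_space_jump_dist) simp

text \<open>In an absorbing state both sides vanish: the rate measure is null, and the jump law is the point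
mass at the state itself.\<close>

lemma
  fixes f :: "'s \<Rightarrow> real"
  assumes f: "integrable (Q x) f"
  shows integrable_jump_pmf: "integrable (jump_pmf x) f"
    and generator_eq: "generator f x = rate x * ((\<integral>y. f y \<partial>jump_pmf x) - f x)"
proof -
  interpret finite_measure "Q x" by (rule finite_Q)
  have "integrable (jump_pmf x) f \<and> generator f x = rate x * ((\<integral>y. f y \<partial>jump_pmf x) - f x)"
  proof (cases "measure (Q x) UNIV = 0")
    case True
    then have "AE y in Q x. False"
      by (subst AE_iff_measurable[of UNIV]) (auto simp: space_Q emeasure_eq_measure sets_Q sets_borel_discrete)
    then have "generator f x = 0"
      unfolding generator_def by (intro integral_eq_zero_AE) auto
    moreover have "integral\<^sup>L (return borel x) f = f x"
      by (intro integral_return) auto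
    moreover have "integrable (return borel x) f"
      by (intro integrableI_bounded) (auto simp: nn_integral_return)
    ultimately show ?thesis
      using True by (simp add: measure_jump_pmf jump_dist_def)
  next
    case False
    define m where "m = measure (Q x) UNIV"
    have m: "0 < m" using False by (simp add: m_def zero_less_measure_iff)
    have J: "measure_pmf (jump_pmf x) = density (Q x) (\<lambda>_. ennreal (1 / m))"
      using False m unfolding measure_jump_pmf jump_dist_def uniform_measure_def
      by (auto simp: m_def emeasure_eq_measure intro!: density_cong measurable_Q
          simp flip: ennreal_1 simp del: ennreal_1 simp: divide_ennreal)
    have f': "f \<in> borel_measurable (Q x)" using f by auto
    have "integrable (jump_pmf x) f"
      unfolding J using f f' m by (subst integrable_density) auto
    moreover have "(\<integral>y. f y \<partial>jump_pmf x) = (\<integral>y. f y \<partial>Q x) / m"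
      unfolding J using f' m by (subst integral_density) auto
    moreover have "generator f x = (\<integral>y. f y \<partial>Q x) - m * f x"
      unfolding generator_def using f by (simp add: space_Q m_def)
    ultimately show ?thesis
      using False m by (simp add: hold_rate_def m_def field_simps)
  qed
  then show "integrable (jump_pmf x) f" "generator f x = rate x * ((\<integral>y. f y \<partial>jump_pmf x) - f x)"
    by auto
qed

lemma integrable_Q_bounded: "integrable (Q x) f" if "\<And>y. \<bar>f y\<bar> \<le> B" for f :: "'s \<Rightarrow> real"
  using finite_measure.integrable_const_bound[OF finite_Q[of x], where f=f and B=B] that
  by (auto simp: measurable_Q)

text \<open>The chain that from \<open>x\<close> jumps with probability \<open>rate x / \<Lambda>\<close> and stays put otherwise.  Its transition operator is
\<open>f + generator f / \<Lambda>\<close>.\<close>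

definition unif_pmf :: "'s \<Rightarrow> 's pmf" where
  "unif_pmf x = bind_pmf (bernoulli_pmf (rate x / \<Lambda>)) (\<lambda>b. if b then jump_pmf x else return_pmf x)"

lemma unif_weight: "0 < rate x / \<Lambda>" "rate x / \<Lambda> \<le> 1"
  using rate_pos[of x] rate_le'[of x] one_le by (auto simp: divide_simps)

lemma
  fixes f :: "'s \<Rightarrow> real"
  assumes f: "integrable (Q x) f" and nonneg: "\<And>y. 0 \<le> f y"
  shows integrable_unif_pmf: "integrable (unif_pmf x) f"
    and integral_unif_pmf: "(\<integral>y. f y \<partial>unif_pmf x) = f x + generator f x / \<Lambda>"
proof -
  define \<theta> where "\<theta> = rate x / \<Lambda>"
  have \<theta>: "0 \<le> \<theta>" "\<theta> \<le> 1" using unif_weight[of x] by (auto simp: \<theta>_def)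
  define I where "I = (\<integral>y. f y \<partial>jump_pmf x)"
  have I: "0 \<le> I" unfolding I_def by (intro integral_nonneg_AE) (simp add: nonneg)
  have "(\<integral>\<^sup>+y. f y \<partial>unif_pmf x) = ennreal I * \<theta> + ennreal (f x) * (1 - \<theta>)"
    unfolding unif_pmf_def nn_integral_bind_pmf \<theta>_def[symmetric] using \<theta> nonneg
    by (subst nn_integral_bernoulli_pmf)
      (auto simp: I_def nn_integral_eq_integral[OF integrable_jump_pmf[OF f]])
  also have "\<dots> = ennreal (I * \<theta> + f x * (1 - \<theta>))"
    using \<theta> I nonneg by (simp add: ennreal_mult ennreal_plus)
  finally have eq: "(\<integral>\<^sup>+y. f y \<partial>unif_pmf x) = ennreal (I * \<theta> + f x * (1 - \<theta>))" .
  then show int: "integrable (unif_pmf x) f"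
    using nonneg by (intro integrableI_nonneg) auto
  have "(\<integral>y. f y \<partial>unif_pmf x) = I * \<theta> + f x * (1 - \<theta>)"
    using nonneg \<theta> I by (intro integral_eq_nn_integral[THEN trans]) (auto simp: eq simp del: ennreal_plus)
  also have "\<dots> = f x + generator f x / \<Lambda>"
    unfolding generator_eq[OF f] I_def[symmetric] \<theta>_def using one_le by (simp add: field_simps)
  finally show "(\<integral>y. f y \<partial>unif_pmf x) = f x + generator f x / \<Lambda>" .
qed

text \<open>The nonnegative case applies to \<open>f + B\<close>, since the generator ignores constants.\<close>

lemma integral_unif_pmf_bounded:
  fixes f :: "'s \<Rightarrow> real"
  assumes B: "\<And>y. \<bar>f y\<bar> \<le> B"
  shows "(\<integral>y. f y \<partial>unif_pmf x) = f x + generator f x / \<Lambda>"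
proof -
  interpret finite_measure "Q x" by (rule finite_Q)
  have int: "integrable (Q x) f" by (rule integrable_Q_bounded[OF B])
  have 0: "0 \<le> f y + B" for y using B[of y] by linarith
  have "generator (\<lambda>y. f y + B) x = generator f x"
    by (simp add: generator_def)
  moreover have "integrable (unif_pmf x) f"
    using B by (intro measure_pmf.integrable_const_bound[where B=B]) auto
  ultimately show ?thesis
    using integral_unif_pmf[of x "\<lambda>y. f y + B"] int 0 by simp
qed

lemma stationary_generator:
  assumes p: "bind_pmf p unif_pmf = p" and B: "\<And>y. \<bar>f y\<bar> \<le> B"
  shows "(\<integral>x. generator f x \<partial>p) = 0"
proof -
  have int: "integrable (measure_pmf p) f"
    using B by (intro measure_pmf.integrable_const_bound[where B=B]) auto
  have "\<bar>\<integral>y. f y \<partial>unif_pmf x\<bar> \<le> B" for x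
    using B by (intro integral_abs_bound[THEN order_trans] measure_pmf.integral_le_const)
      (auto intro!: measure_pmf.integrable_const_bound[where B=B])
  then have int': "integrable (measure_pmf p) (\<lambda>x. \<integral>y. f y \<partial>unif_pmf x)"
    by (intro measure_pmf.integrable_const_bound[where B=B]) auto
  have "(\<integral>x. generator f x \<partial>p) = (\<integral>x. \<Lambda> * ((\<integral>y. f y \<partial>unif_pmf x) - f x) \<partial>p)"
    using one_le by (simp add: integral_unif_pmf_bounded[OF B])
  also have "\<dots> = \<Lambda> * ((\<integral>y. f y \<partial>bind_pmf p unif_pmf) - (\<integral>y. f y \<partial>p))"
    using int int' by (simp add: integral_bind_pmf_bounded[of f B, OF B])
  finally show ?thesis unfolding p by simp
qed

lemma stationary_if_generator:
  fixes p :: "'s pmf"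
  assumes p: "\<And>A. (\<integral>x. generator (indicator A) x \<partial>measure_pmf p) = 0"
  shows "bind_pmf p unif_pmf = p"
proof (rule pmf_eqI)
  fix y :: 's
  have B: "\<bar>indicator {y} x :: real\<bar> \<le> 1" for x by simp
  have int: "integrable (measure_pmf p) (indicator {y} :: 's \<Rightarrow> real)"
    by (intro measure_pmf.integrable_const_bound[where B=1]) auto
  have gen: "generator (indicator {y}) x = \<Lambda> * (measure (unif_pmf x) {y} - indicator {y} x)" for x
    using integral_unif_pmf_bounded[of "indicator {y}" 1 x] one_le by (simp add: field_simps)
  have int': "integrable (measure_pmf p) (\<lambda>x. measure (unif_pmf x) {y})"
    by (intro measure_pmf.integrable_const_bound[where B=1]) auto
  have "0 = \<Lambda> * ((\<integral>x. measure (unif_pmf x) {y} \<partial>p) - (\<integral>x. indicator {y} x \<partial>p))"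
    using p[of "{y}"] int int' unfolding gen by simp
  then show "pmf (bind_pmf p unif_pmf) y = pmf p y"
    using one_le by (simp add: pmf_bind measure_pmf_single)
qed

section \<open>The process and its first jump\<close>

abbreviation driver :: "(('s \<Rightarrow> 's) \<times> real) measure" where
  "driver \<equiv> PiM UNIV (jump_dist Q) \<Otimes>\<^sub>M std_exponential"

lemma noise_eq: "noise Q = stream_space driver"
  by (simp add: noise_def)

lemma prob_space_PiM_jump: "prob_space (PiM UNIV (jump_dist Q))"
  by (intro prob_space_PiM prob_space_jump_dist)

lemma prob_space_std_exponential: "prob_space std_exponential"
  by (intro prob_space_exponential_density) simp

lemma prob_space_driver: "prob_space driver"
  by (intro prob_space_pair prob_space_PiM_jump prob_space_std_exponential)

lemma prob_space_noise: "prob_space (noise Q)"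
  unfolding noise_eq by (intro prob_space.prob_space_stream_space prob_space_driver)

lemma measurable_random_map [measurable]:
  "(\<lambda>\<phi>. \<phi> y) \<in> PiM UNIV (jump_dist Q) \<rightarrow>\<^sub>M count_space UNIV"
  by (rule measurable_cong_sets[OF refl, THEN equalityD1, THEN subsetD, OF _ measurable_component_singleton[of y UNIV "jump_dist Q"]]) auto

lemma measurable_noise_snth [measurable]: "(\<lambda>\<omega>. \<omega> !! n) \<in> noise Q \<rightarrow>\<^sub>M driver"
  unfolding noise_eq by measurable

lemma measurable_jump_chain [measurable]: "(\<lambda>\<omega>. jump_chain x \<omega> n) \<in> noise Q \<rightarrow>\<^sub>M count_space UNIV"
proof (induction n)
  case (Suc n)
  show ?case
    unfolding jump_chain.simps
    by (rule measurable_compose_countable[OF _ Suc]) measurable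
qed simp

lemma measurable_holding_time [measurable]: "(\<lambda>\<omega>. holding_time Q x \<omega> n) \<in> borel_measurable (noise Q)"
proof -
  have "(\<lambda>\<omega>. snd (\<omega> !! n) / hold_rate Q y) \<in> borel_measurable (noise Q)" for y
  proof -
    have "snd \<in> driver \<rightarrow>\<^sub>M borel" by measurable
    from measurable_compose[OF measurable_noise_snth this] show ?thesis by measurable
  qed
  then show ?thesis
    unfolding holding_time_def
    by (rule measurable_compose_countable[OF _ measurable_jump_chain])
qed

lemma measurable_state_at:
  "(\<lambda>p. state_at Q x (fst p) (snd p)) \<in> borel \<Otimes>\<^sub>M noise Q \<rightarrow>\<^sub>M count_space UNIV"
  unfolding state_at_def
proof (rule measurable_compose_countable[where f="\<lambda>n p. jump_chain x (snd p) n"])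
  show "(\<lambda>p. LEAST n. fst p < (\<Sum>k\<le>n. holding_time Q x (snd p) k)) \<in> borel \<Otimes>\<^sub>M noise Q \<rightarrow>\<^sub>M count_space UNIV"
    by measurable
qed measurable

lemma measurable_state_at_fixed [measurable]: "state_at Q x t \<in> noise Q \<rightarrow>\<^sub>M count_space UNIV"
  using measurable_compose[OF measurable_Pair1' measurable_state_at, of t] by simp

text \<open>Since every rate is at most \<open>\<Lambda>\<close>, the \<open>n\<close>-th jump time is at least \<open>1/\<Lambda>\<close> times the sum of the first \<open>n\<close>
clocks, so divergence of the series of clocks excludes explosion, simultaneously for all initial states.\<close>

definition clock_sum :: "(('s \<Rightarrow> 's) \<times> real) stream \<Rightarrow> ennreal" where
  "clock_sum \<omega> = (\<Sum>n. ennreal (snd (\<omega> !! n)))"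

lemma measurable_driver_snd [measurable]: "snd \<in> driver \<rightarrow>\<^sub>M borel"
  by measurable

lemma clock_sum_Stream: "clock_sum (a ## \<omega>) = ennreal (snd a) + clock_sum \<omega>"
  unfolding clock_sum_def using suminf_offset[of "\<lambda>n. ennreal (snd ((a ## \<omega>) !! n))" 1]
  by (simp add: add.commute)

lemma nn_integral_noise: "F \<in> borel_measurable (noise Q) \<Longrightarrow>
  (\<integral>\<^sup>+\<omega>. F \<omega> \<partial>noise Q) = (\<integral>\<^sup>+a. \<integral>\<^sup>+\<omega>. F (a ## \<omega>) \<partial>noise Q \<partial>driver)"
  unfolding noise_eq by (rule prob_space.nn_integral_stream_space[OF prob_space_driver])

lemma nn_integral_driver_snd:
  assumes [measurable]: "f \<in> borel_measurable borel"
  shows "(\<integral>\<^sup>+a. f (snd a) \<partial>driver) = (\<integral>\<^sup>+e. f e \<partial>std_exponential)"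
proof -
  interpret E: prob_space std_exponential by (rule prob_space_std_exponential)
  interpret P: prob_space "PiM UNIV (jump_dist Q)" by (rule prob_space_PiM_jump)
  have "(\<integral>\<^sup>+a. f (snd a) \<partial>driver) = (\<integral>\<^sup>+\<phi>. \<integral>\<^sup>+e. f e \<partial>std_exponential \<partial>PiM UNIV (jump_dist Q))"
    by (subst E.nn_integral_fst[symmetric]) auto
  then show ?thesis by (simp add: P.emeasure_space_1)
qed

text \<open>The mean \<open>I\<close> of \<open>exp_minus\<close> of the series satisfies \<open>I = I / 2\<close>: dropping the first clock leaves a
series of the same law, and the first clock contributes the factor \<open>1 / 2\<close>.\<close>

lemma AE_clock_sum: "AE \<omega> in noise Q. clock_sum \<omega> = \<infinity>"
proof -
  interpret N: prob_space "noise Q" by (rule prob_space_noise)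
  have snd_meas [measurable]: "(\<lambda>\<omega>. snd (\<omega> !! n)) \<in> borel_measurable (noise Q)" for n
    by (rule measurable_compose[OF measurable_noise_snth measurable_driver_snd])
  have [measurable]: "clock_sum \<in> borel_measurable (noise Q)"
    unfolding clock_sum_def[abs_def] by measurable
  define I where "I = (\<integral>\<^sup>+\<omega>. exp_minus (clock_sum \<omega>) \<partial>noise Q)"
  have "I \<le> (\<integral>\<^sup>+\<omega>. 1 \<partial>noise Q)"
    unfolding I_def by (intro nn_integral_mono exp_minus_le_1)
  then have I_le: "I \<le> 1" by (simp add: N.emeasure_space_1)
  have "I = (\<integral>\<^sup>+a. \<integral>\<^sup>+\<omega>. exp_minus (ennreal (snd a)) * exp_minus (clock_sum \<omega>) \<partial>noise Q \<partial>driver)"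
    unfolding I_def by (subst nn_integral_noise) (auto simp: clock_sum_Stream exp_minus_add)
  also have "\<dots> = (\<integral>\<^sup>+a. exp_minus (ennreal (snd a)) \<partial>driver) * I"
    unfolding I_def by (simp add: nn_integral_cmult nn_integral_multc)
  also have "(\<integral>\<^sup>+a. exp_minus (ennreal (snd a)) \<partial>driver) = ennreal (1 / 2)"
    using std_exponential_laplace[of 1] by (subst nn_integral_driver_snd) auto
  finally have I: "I = ennreal (1 / 2) * I" .
  obtain r where r: "0 \<le> r" "I = ennreal r" using I_le by (cases I rule: ennreal_cases) (auto simp: top_unique)
  have "ennreal r = ennreal (1 / 2 * r)"
    using I unfolding r(2) by (subst ennreal_mult) (use r in auto)
  then have "r = 1 / 2 * r" using r by (subst (asm) ennreal_inj) auto
  then have "I = 0" using r by simp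
  then show ?thesis
    unfolding I_def by (subst (asm) nn_integral_0_iff_AE) (auto simp: exp_minus_eq_0_iff)
qed

definition nonexplosive :: "(('s \<Rightarrow> 's) \<times> real) stream \<Rightarrow> bool" where
  "nonexplosive \<omega> \<longleftrightarrow> (\<forall>x t. \<exists>n. t < (\<Sum>k\<le>n. holding_time Q x \<omega> k))"

lemma AE_driver_nonneg: "AE a in driver. 0 \<le> snd a"
proof -
  interpret P: pair_sigma_finite "PiM UNIV (jump_dist Q)" std_exponential
    by (intro pair_sigma_finite.intro prob_space_imp_sigma_finite prob_space_PiM_jump prob_space_std_exponential)
  show ?thesis
  proof (rule P.AE_pair_measure)
    show "{a \<in> space driver. 0 \<le> snd a} \<in> sets driver" by measurable
  qed (use AE_std_exponential_nonneg in auto)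
qed

lemma AE_clock_nonneg: "AE \<omega> in noise Q. \<forall>n. 0 \<le> snd (\<omega> !! n)"
  using prob_space.AE_stream_all[OF prob_space_driver _ AE_driver_nonneg]
  unfolding noise_eq stream_all_def by measurable

lemma AE_nonexplosive: "AE \<omega> in noise Q. nonexplosive \<omega>"
  using AE_clock_sum AE_clock_nonneg
proof eventually_elim
  fix \<omega> assume sum: "clock_sum \<omega> = \<infinity>" and nonneg: "\<forall>n. 0 \<le> snd (\<omega> !! n)"
  show "nonexplosive \<omega>"
    unfolding nonexplosive_def
  proof (intro allI)
    fix x t
    have "\<not> (\<forall>n. (\<Sum>k<n. snd (\<omega> !! k)) \<le> \<Lambda> * max t 0)"
    proof
      assume le: "\<forall>n. (\<Sum>k<n. snd (\<omega> !! k)) \<le> \<Lambda> * max t 0"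
      have "clock_sum \<omega> \<le> ennreal (\<Lambda> * max t 0)"
        unfolding clock_sum_def using nonneg le
        by (intro suminf_le_const) (auto simp: sum_ennreal intro: ennreal_leI)
      with sum show False by (simp add: top_unique)
    qed
    then obtain n where n: "\<Lambda> * max t 0 < (\<Sum>k<n. snd (\<omega> !! k))" by (auto simp: not_le)
    have "(\<Sum>k<n. snd (\<omega> !! k)) \<le> (\<Sum>k\<le>n. snd (\<omega> !! k))"
      using nonneg by (intro sum_mono2) auto
    also have "\<dots> \<le> (\<Sum>k\<le>n. \<Lambda> * holding_time Q x \<omega> k)"
    proof (rule sum_mono)
      fix k
      show "snd (\<omega> !! k) \<le> \<Lambda> * holding_time Q x \<omega> k"
        using nonneg rate_pos[of "jump_chain x \<omega> k"]
          mult_left_mono[OF rate_le'[of "jump_chain x \<omega> k"], of "snd (\<omega> !! k)"]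
        by (auto simp: holding_time_def field_simps)
    qed
    also have "\<dots> = \<Lambda> * (\<Sum>k\<le>n. holding_time Q x \<omega> k)" by (simp add: sum_distrib_left)
    finally have "\<Lambda> * max t 0 < \<Lambda> * (\<Sum>k\<le>n. holding_time Q x \<omega> k)" using n by linarith
    then show "\<exists>n. t < (\<Sum>k\<le>n. holding_time Q x \<omega> k)"
      using one_le by (intro exI[of _ n]) (simp add: mult_less_cancel_left)
  qed
qed

lemma jump_chain_Stream: "jump_chain x (a ## \<omega>) (Suc n) = jump_chain (fst a x) \<omega> n"
  by (induction n) simp_all

lemma holding_time_Stream:
  "holding_time Q x (a ## \<omega>) 0 = snd a / rate x"
  "holding_time Q x (a ## \<omega>) (Suc n) = holding_time Q (fst a x) \<omega> n"
  unfolding holding_time_def jump_chain_Stream by simp_all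

text \<open>The jump counter in the definition of the state is a least index, and its value for the shifted noise is
smaller by one.  This needs the index to exist for the shifted noise, hence the hypothesis of non-explosion: an
unspecified value would not be compatible with the shift.\<close>

lemma state_at_Stream:
  assumes "nonexplosive \<omega>"
  shows "state_at Q x t (a ## \<omega>) =
    (if t < snd a / rate x then x else state_at Q (fst a x) (t - snd a / rate x) \<omega>)"
proof -
  define P where "P n \<longleftrightarrow> t < (\<Sum>k\<le>n. holding_time Q x (a ## \<omega>) k)" for n
  have P0: "P 0 \<longleftrightarrow> t < snd a / rate x"
    by (simp add: P_def holding_time_Stream)
  have PSuc: "P (Suc n) \<longleftrightarrow> t - snd a / rate x < (\<Sum>k\<le>n. holding_time Q (fst a x) \<omega> k)" for n
    unfolding P_def by (subst sum.atMost_Suc_shift) (auto simp: holding_time_Stream)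
  obtain n where n: "P (Suc n)" using assms unfolding PSuc nonexplosive_def by blast
  show ?thesis
  proof (cases "P 0")
    case True
    then have "(LEAST n. P n) = 0" by simp
    with True P0 show ?thesis by (simp add: state_at_def P_def[symmetric])
  next
    case False
    have "(LEAST n. P n) = Suc (LEAST n. P (Suc n))"
      by (rule Least_Suc[OF n False])
    with False P0 show ?thesis
      by (simp add: state_at_def P_def[symmetric] PSuc jump_chain_Stream del: jump_chain.simps)
  qed
qed

lemma space_noise: "space (noise Q) = UNIV"
proof -
  have "space driver = UNIV"
    by (auto simp: space_pair_measure space_PiM PiE_UNIV_domain)
  then show ?thesis unfolding noise_eq by (simp add: space_stream_space)
qed

text \<open>The strong Markov property at the first jump.  The first noise pair supplies a clock \<open>e\<close> and, through
the coordinate at \<open>x\<close> of its random map, a target \<open>y\<close>, independent of the clock and distributed as a jump from \<open>x\<close>; the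
remaining noise \<open>\<omega>\<close> is a fresh copy of the whole sequence.\<close>

lemma nn_integral_first_jump:
  assumes F: "\<And>y. (\<lambda>p. F y (fst p) (snd p)) \<in> borel_measurable (borel \<Otimes>\<^sub>M noise Q)"
    and H: "H \<in> borel_measurable (noise Q)"
    and eq: "AE \<omega> in noise Q. \<forall>a. 0 \<le> snd a \<longrightarrow> H (a ## \<omega>) = F (fst a x) (snd a) \<omega>"
  shows "(\<integral>\<^sup>+\<omega>. H \<omega> \<partial>noise Q) = (\<integral>\<^sup>+e. \<integral>\<^sup>+y. \<integral>\<^sup>+\<omega>. F y e \<omega> \<partial>noise Q \<partial>jump_pmf x \<partial>std_exponential)"
proof -
  interpret N: prob_space "noise Q" by (rule prob_space_noise)
  interpret P: pair_sigma_finite "PiM UNIV (jump_dist Q)" std_exponential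
    by (intro pair_sigma_finite.intro prob_space_imp_sigma_finite prob_space_PiM_jump prob_space_std_exponential)
  define g where "g y e = (\<integral>\<^sup>+\<omega>. F y e \<omega> \<partial>noise Q)" for y e
  have g: "g y \<in> borel_measurable borel" for y
    using N.borel_measurable_nn_integral_fst[OF F[of y]] by (simp add: g_def[abs_def])
  have g_snd: "(\<lambda>a. g y (snd a)) \<in> borel_measurable driver" for y
    by (rule measurable_compose[OF measurable_driver_snd g])
  have map: "(\<lambda>a. fst a x) \<in> driver \<rightarrow>\<^sub>M count_space UNIV"
    by (rule measurable_compose[OF measurable_fst measurable_random_map])
  have "(\<integral>\<^sup>+\<omega>. H \<omega> \<partial>noise Q) = (\<integral>\<^sup>+a. \<integral>\<^sup>+\<omega>. H (a ## \<omega>) \<partial>noise Q \<partial>driver)"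
    by (rule nn_integral_noise[OF H])
  also have "\<dots> = (\<integral>\<^sup>+a. g (fst a x) (snd a) \<partial>driver)"
    unfolding g_def
    using AE_driver_nonneg
    by (intro nn_integral_cong_AE) (elim eventually_mono, intro nn_integral_cong_AE, use eq in \<open>auto elim: eventually_mono\<close>)
  also have "\<dots> = (\<integral>\<^sup>+e. \<integral>\<^sup>+\<phi>. g (\<phi> x) e \<partial>PiM UNIV (jump_dist Q) \<partial>std_exponential)"
    using P.nn_integral_snd[OF measurable_compose_countable[where f="\<lambda>y a. g y (snd a)", OF g_snd map]] by simp
  also have "\<dots> = (\<integral>\<^sup>+e. \<integral>\<^sup>+y. g y e \<partial>jump_pmf x \<partial>std_exponential)"
  proof (intro nn_integral_cong)
    fix e
    have "(\<integral>\<^sup>+y. g y e \<partial>jump_pmf x) = (\<integral>\<^sup>+y. g y e \<partial>distr (PiM UNIV (jump_dist Q)) (jump_dist Q x) (\<lambda>\<phi>. \<phi> x))"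
      unfolding measure_jump_pmf by (subst distr_PiM_component) (auto intro: prob_space_jump_dist)
    also have "\<dots> = (\<integral>\<^sup>+\<phi>. g (\<phi> x) e \<partial>PiM UNIV (jump_dist Q))"
      by (rule nn_integral_distr) (auto simp: measurable_cong_sets[OF sets_jump_dist[unfolded sets_count_space[of UNIV, unfolded Pow_UNIV, symmetric]] refl])
    finally show "(\<integral>\<^sup>+\<phi>. g (\<phi> x) e \<partial>PiM UNIV (jump_dist Q)) = (\<integral>\<^sup>+y. g y e \<partial>jump_pmf x)" by simp
  qed
  finally show ?thesis by (simp add: g_def)
qed

lemma measurable_state_at_pair [measurable]:
  assumes [measurable]: "f \<in> M \<rightarrow>\<^sub>M borel" "h \<in> M \<rightarrow>\<^sub>M noise Q"
  shows "(\<lambda>p. state_at Q x (f p) (h p)) \<in> M \<rightarrow>\<^sub>M count_space UNIV"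
  using measurable_compose[OF measurable_Pair[OF assms] measurable_state_at] by simp

lemma measurable_occupation_time [measurable]: "occupation_time Q x A \<in> borel_measurable (noise Q)"
  unfolding occupation_time_def[abs_def] by measurable

lemma occupation_time_Stream:
  assumes "nonexplosive \<omega>" "0 \<le> snd a"
  shows "occupation_time Q x A (a ## \<omega>) =
    ennreal (snd a / rate x) * indicator A x + occupation_time Q (fst a x) A \<omega>"
proof -
  define \<tau> where "\<tau> = snd a / rate x"
  have \<tau>: "0 \<le> \<tau>" using assms rate_pos[of x] by (simp add: \<tau>_def)
  have "occupation_time Q x A (a ## \<omega>) = (\<integral>\<^sup>+t. indicator A x * indicator {0..<\<tau>} t +
      indicator A (state_at Q (fst a x) (t - \<tau>) \<omega>) * indicator {\<tau>..} t \<partial>lborel)"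
    unfolding occupation_time_def state_at_Stream[OF assms(1)] \<tau>_def[symmetric] using \<tau>
    by (intro nn_integral_cong) (auto split: split_indicator)
  also have "\<dots> = (\<integral>\<^sup>+t. indicator A x * indicator {0..<\<tau>} t \<partial>lborel) +
      (\<integral>\<^sup>+t. indicator A (state_at Q (fst a x) (t - \<tau>) \<omega>) * indicator {\<tau>..} t \<partial>lborel)"
    by (intro nn_integral_add) (auto simp: space_noise)
  also have "(\<integral>\<^sup>+t. indicator A (state_at Q (fst a x) (t - \<tau>) \<omega>) * indicator {\<tau>..} t \<partial>lborel) =
      occupation_time Q (fst a x) A \<omega>"
    unfolding occupation_time_def
    by (subst nn_integral_real_affine[where c=1 and t=\<tau>])
      (auto simp: space_noise intro!: nn_integral_cong split: split_indicator)
  also have "(\<integral>\<^sup>+t. indicator A x * indicator {0..<\<tau>} t \<partial>lborel) = ennreal \<tau> * indicator A x"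
    using \<tau> by (simp add: nn_integral_cmult_indicator mult.commute)
  finally show ?thesis by (simp add: \<tau>_def)
qed

section \<open>Recurrence\<close>

text \<open>The mean of \<open>exp\<close> of minus the total time in \<open>z\<close>, from the initial state \<open>x\<close>.  It vanishes exactly if
the time spent in \<open>z\<close> is almost surely infinite.\<close>

definition exp_occupation :: "'s \<Rightarrow> 's \<Rightarrow> real" where
  "exp_occupation z x = enn2real (\<integral>\<^sup>+\<omega>. exp_minus (occupation_time Q x {z} \<omega>) \<partial>noise Q)"

lemma
  shows exp_occupation_eq: "(\<integral>\<^sup>+\<omega>. exp_minus (occupation_time Q x {z} \<omega>) \<partial>noise Q) = ennreal (exp_occupation z x)"
    and exp_occupation_nonneg: "0 \<le> exp_occupation z x" and exp_occupation_le_1: "exp_occupation z x \<le> 1"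
proof -
  interpret N: prob_space "noise Q" by (rule prob_space_noise)
  have "(\<integral>\<^sup>+\<omega>. exp_minus (occupation_time Q x {z} \<omega>) \<partial>noise Q) \<le> (\<integral>\<^sup>+\<omega>. 1 \<partial>noise Q)"
    by (intro nn_integral_mono exp_minus_le_1)
  also have "\<dots> = 1" by (simp add: N.emeasure_space_1)
  finally have le: "(\<integral>\<^sup>+\<omega>. exp_minus (occupation_time Q x {z} \<omega>) \<partial>noise Q) \<le> 1" .
  then show eq: "(\<integral>\<^sup>+\<omega>. exp_minus (occupation_time Q x {z} \<omega>) \<partial>noise Q) = ennreal (exp_occupation z x)"
    unfolding exp_occupation_def by (intro ennreal_enn2real[symmetric]) (rule le_less_trans[OF le], simp)
  show "0 \<le> exp_occupation z x" by (simp add: exp_occupation_def)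
  show "exp_occupation z x \<le> 1" using le unfolding eq by simp
qed

text \<open>Before the first jump the process contributes its holding time if it started in \<open>z\<close>, and nothing
otherwise; the factor is the Laplace transform of that holding time.\<close>

lemma exp_occupation_first_jump:
  "exp_occupation z x = (if x = z then rate z / (rate z + 1) else 1) * (\<integral>y. exp_occupation z y \<partial>jump_pmf x)"
proof -
  interpret E: prob_space std_exponential by (rule prob_space_std_exponential)
  define F where "F y e \<omega> = exp_minus (ennreal (e / rate x) * indicator {z} x) * exp_minus (occupation_time Q y {z} \<omega>)"
    for y e \<omega>
  define I where "I = (\<integral>y. exp_occupation z y \<partial>jump_pmf x)"
  have int: "integrable (jump_pmf x) (exp_occupation z)"
    using exp_occupation_nonneg exp_occupation_le_1
    by (intro measure_pmf.integrable_const_bound[where B=1]) auto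
  have I: "0 \<le> I" unfolding I_def by (intro integral_nonneg_AE) (simp add: exp_occupation_nonneg)
  have nnI: "(\<integral>\<^sup>+y. ennreal (exp_occupation z y) \<partial>jump_pmf x) = ennreal I"
    unfolding I_def using int by (intro nn_integral_eq_integral) (auto simp: exp_occupation_nonneg)
  have "ennreal (exp_occupation z x) =
      (\<integral>\<^sup>+e. \<integral>\<^sup>+y. \<integral>\<^sup>+\<omega>. F y e \<omega> \<partial>noise Q \<partial>jump_pmf x \<partial>std_exponential)"
    unfolding exp_occupation_eq[symmetric]
  proof (rule nn_integral_first_jump)
    show "AE \<omega> in noise Q. \<forall>a. 0 \<le> snd a \<longrightarrow>
        exp_minus (occupation_time Q x {z} (a ## \<omega>)) = F (fst a x) (snd a) \<omega>"
      using AE_nonexplosive by eventually_elim (auto simp: occupation_time_Stream exp_minus_add F_def)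
  qed (auto simp: F_def)
  also have "\<dots> = (\<integral>\<^sup>+e. exp_minus (ennreal (e / rate x) * indicator {z} x) \<partial>std_exponential) * ennreal I"
    unfolding F_def by (simp add: nn_integral_cmult nn_integral_multc exp_occupation_eq nnI)
  also have "(\<integral>\<^sup>+e. exp_minus (ennreal (e / rate x) * indicator {z} x) \<partial>std_exponential) =
      ennreal (if x = z then rate z / (rate z + 1) else 1)"
  proof (cases "x = z")
    case True then show ?thesis using std_exponential_laplace[OF rate_pos[of z]] by simp
  next
    case False then show ?thesis using E.emeasure_space_1 by (simp add: exp_minus_def)
  qed
  finally have "ennreal (exp_occupation z x) = ennreal ((if x = z then rate z / (rate z + 1) else 1) * I)"
    using I rate_pos[of z] by (subst ennreal_mult) auto
  then show ?thesis
    unfolding I_def[symmetric] using I rate_pos[of z] exp_occupation_nonneg[of z x]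
    by (subst (asm) ennreal_inj) (auto intro!: mult_nonneg_nonneg)
qed

lemma generator_exp_occupation:
  "generator (exp_occupation z) x = (if x = z then exp_occupation z z else 0)"
proof -
  have int: "integrable (Q x) (exp_occupation z)"
    using exp_occupation_nonneg exp_occupation_le_1 by (intro integrable_Q_bounded[where B=1]) auto
  show ?thesis
    unfolding generator_eq[OF int] using exp_occupation_first_jump[of z x] rate_pos[of z]
    by (auto simp: field_simps)
qed

definition absorbing :: "'s set \<Rightarrow> bool" where
  "absorbing A \<longleftrightarrow> (\<forall>x\<in>A. set_pmf (unif_pmf x) \<subseteq> A)"

lemma set_jump_pmf_subset: "set_pmf (jump_pmf x) \<subseteq> set_pmf (unif_pmf x)"
proof -
  have "True \<in> set_pmf (bernoulli_pmf (rate x / \<Lambda>))"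
    using unif_weight[of x] unfolding set_pmf_iff by (subst pmf_bernoulli_True) auto
  then show ?thesis unfolding unif_pmf_def set_bind_pmf by fastforce
qed

text \<open>By induction on the number of jumps, conditioning on the first one.\<close>

lemma AE_jump_chain_absorbed:
  assumes "absorbing A" "x \<in> A"
  shows "AE \<omega> in noise Q. \<forall>n. jump_chain x \<omega> n \<in> A"
proof -
  have 0: "(\<integral>\<^sup>+\<omega>. indicator (- A) (jump_chain x \<omega> n) \<partial>noise Q) = (0 :: ennreal)" for n
    using \<open>x \<in> A\<close>
  proof (induction n arbitrary: x)
    case (Suc n)
    have "(\<integral>\<^sup>+\<omega>. indicator (- A) (jump_chain x \<omega> (Suc n)) \<partial>noise Q) =
        (\<integral>\<^sup>+e. \<integral>\<^sup>+y. \<integral>\<^sup>+\<omega>. indicator (- A) (jump_chain y \<omega> n) \<partial>noise Q \<partial>jump_pmf x \<partial>std_exponential :: ennreal)"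
      by (rule nn_integral_first_jump) (auto simp: jump_chain_Stream simp del: jump_chain.simps)
    also have "\<dots> = (\<integral>\<^sup>+e. \<integral>\<^sup>+y. 0 \<partial>jump_pmf x \<partial>std_exponential)"
      using Suc.prems assms(1) set_jump_pmf_subset[of x]
      by (intro nn_integral_cong nn_integral_cong_AE AE_pmfI Suc.IH) (auto simp: absorbing_def)
    finally show ?case by simp
  qed simp
  have "AE \<omega> in noise Q. jump_chain x \<omega> n \<in> A" for n
    using 0[of n] by (subst (asm) nn_integral_0_iff_AE) (auto simp: indicator_eq_0_iff)
  then show ?thesis by (simp add: AE_all_countable)
qed

text \<open>On a countable space some singleton \<open>{z}\<close> has positive irreducibility measure.  Started in an absorbing set
without \<open>z\<close>, the process would almost surely never visit \<open>z\<close>, contradicting the positive mean time that it spends there.\<close>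

lemma irreducible_imp_accessible_state:
  assumes "irreducible_process Q"
  obtains z where "\<And>A. A \<noteq> {} \<Longrightarrow> absorbing A \<Longrightarrow> z \<in> A"
proof -
  obtain \<phi> where \<phi>: "sets \<phi> = sets borel" "emeasure \<phi> UNIV \<noteq> 0"
    and irr: "\<And>A x. emeasure \<phi> A > 0 \<Longrightarrow> (\<integral>\<^sup>+\<omega>. occupation_time Q x A \<omega> \<partial>noise Q) > 0"
    using assms unfolding irreducible_process_def sets_borel_discrete by blast
  have "\<exists>z. emeasure \<phi> {z} > 0"
  proof (rule ccontr)
    assume "\<not> (\<exists>z. emeasure \<phi> {z} > 0)"
    then have "(\<Union>z. {z}) \<in> null_sets \<phi>"
      by (intro null_sets_UN) (auto simp: null_sets_def \<phi> sets_borel_discrete)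
    then show False using \<phi>(2) by (simp add: null_sets_def)
  qed
  then obtain z where z: "emeasure \<phi> {z} > 0" ..
  show thesis
  proof
    fix A :: "'s set" assume "A \<noteq> {}" "absorbing A"
    then obtain x where x: "x \<in> A" by auto
    show "z \<in> A"
    proof (rule ccontr)
      assume "z \<notin> A"
      have "(\<integral>\<^sup>+\<omega>. occupation_time Q x {z} \<omega> \<partial>noise Q) = (\<integral>\<^sup>+\<omega>. 0 \<partial>noise Q)"
      proof (rule nn_integral_cong_AE)
        show "AE \<omega> in noise Q. occupation_time Q x {z} \<omega> = 0"
          using AE_jump_chain_absorbed[OF \<open>absorbing A\<close> x]
        proof eventually_elim
          fix \<omega> assume "\<forall>n. jump_chain x \<omega> n \<in> A"
          then have "state_at Q x t \<omega> \<noteq> z" for t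
            using \<open>z \<notin> A\<close> unfolding state_at_def by metis
          then show "occupation_time Q x {z} \<omega> = 0" by (simp add: occupation_time_def)
        qed
      qed
      with irr[OF z, of x] show False by simp
    qed
  qed
qed

text \<open>For the uniformised chain \<open>L = exp_occupation z\<close> is harmonic off \<open>z\<close>, and at \<open>z\<close> it satisfies
\<open>L(z) = \<Lambda> / (\<Lambda> + 1) * (K L)(z)\<close>, so the maximum principle gives \<open>L = 0\<close>: the time in \<open>z\<close> is
infinite from every initial state.  The point mass at \<open>z\<close> is then a Harris measure.\<close>

lemma harris_recurrent_if_drift:
  assumes drift: "drift_chain unif_pmf w c g" and irr: "irreducible_process Q"
  shows "harris_recurrent Q"
proof -
  interpret D: drift_chain unif_pmf w c g by fact
  obtain z where z: "\<And>A. A \<noteq> {} \<Longrightarrow> absorbing A \<Longrightarrow> z \<in> A"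
    using irreducible_imp_accessible_state[OF irr] by blast
  have unif: "(\<integral>y. exp_occupation z y \<partial>unif_pmf x) = exp_occupation z x + (if x = z then exp_occupation z z else 0) / \<Lambda>" for x
    using exp_occupation_nonneg[of z] exp_occupation_le_1[of z]
    by (subst integral_unif_pmf_bounded[where B=1]) (auto simp: generator_exp_occupation)
  have 0: "exp_occupation z x = 0" for x
  proof (rule D.subharmonic_discounted_eq_0[where z=z and \<theta>="\<Lambda> / (\<Lambda> + 1)" and B=1])
    show "exp_occupation z x \<le> (\<integral>y. exp_occupation z y \<partial>unif_pmf x)" for x
      using one_le by (simp add: unif exp_occupation_nonneg)
    show "z \<in> A" if "A \<noteq> {}" "\<And>x. x \<in> A \<Longrightarrow> set_pmf (unif_pmf x) \<subseteq> A" for A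
      using that by (intro z) (auto simp: absorbing_def)
    show "exp_occupation z z \<le> \<Lambda> / (\<Lambda> + 1) * (\<integral>y. exp_occupation z y \<partial>unif_pmf z)"
    proof -
      have "\<Lambda> \<noteq> 0" "\<Lambda> + 1 \<noteq> 0" using one_le by auto
      moreover from this have "exp_occupation z z + exp_occupation z z / \<Lambda> = (\<Lambda> + 1) / \<Lambda> * exp_occupation z z"
        by (simp add: field_simps)
      ultimately show ?thesis by (simp add: unif)
    qed
  qed (use one_le in \<open>auto simp: exp_occupation_nonneg exp_occupation_le_1\<close>)
  have "AE \<omega> in noise Q. exp_minus (occupation_time Q x {z} \<omega>) = 0" for x
    using exp_occupation_eq[of x z] unfolding 0 ennreal_0 by (subst (asm) nn_integral_0_iff_AE) auto
  then have inf: "AE \<omega> in noise Q. occupation_time Q x {z} \<omega> = \<infinity>" for x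
    by (simp add: exp_minus_eq_0_iff)
  show ?thesis
    unfolding harris_recurrent_def
  proof (intro exI[of _ "return borel z"] conjI ballI impI allI)
    show "sigma_finite_measure (return borel z)"
      by (intro prob_space_imp_sigma_finite prob_space_return) simp
    fix A x assume "A \<in> sets borel" "0 < emeasure (return borel z) A"
    then have "z \<in> A" by (cases "z \<in> A") auto
    show "AE \<omega> in noise Q. occupation_time Q x A \<omega> = \<infinity>"
      using inf[of x]
    proof eventually_elim
      fix \<omega> assume "occupation_time Q x {z} \<omega> = \<infinity>"
      moreover have "occupation_time Q x {z} \<omega> \<le> occupation_time Q x A \<omega>"
        unfolding occupation_time_def using \<open>z \<in> A\<close>
        by (intro nn_integral_mono) (auto split: split_indicator)
      ultimately show "occupation_time Q x A \<omega> = \<infinity>" by (simp add: top_unique)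
    qed
  qed auto
qed


section \<open>The backward equation and invariant laws\<close>

definition prob_at :: "'s set \<Rightarrow> real \<Rightarrow> 's \<Rightarrow> real" where
  "prob_at A t x = measure (transition Q t x) A"

lemma nn_prob_at: "(\<integral>\<^sup>+\<omega>. indicator A (state_at Q x t \<omega>) \<partial>noise Q) = ennreal (prob_at A t x)"
proof -
  interpret N: prob_space "noise Q" by (rule prob_space_noise)
  have "state_at Q x t \<in> noise Q \<rightarrow>\<^sub>M borel"
    unfolding measurable_into_discrete_borel by (rule measurable_state_at_fixed)
  then have "ennreal (prob_at A t x) = emeasure (noise Q) (state_at Q x t -` A \<inter> space (noise Q))"
    unfolding prob_at_def transition_def
    by (subst measure_distr) (auto simp: N.emeasure_eq_measure sets_borel_discrete)
  also have "\<dots> = (\<integral>\<^sup>+\<omega>. indicator (state_at Q x t -` A \<inter> space (noise Q)) \<omega> \<partial>noise Q)"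
    by (intro nn_integral_indicator[symmetric] measurable_sets[OF measurable_state_at_fixed]) simp
  finally show ?thesis
    by (simp add: space_noise indicator_def cong: nn_integral_cong)
qed

lemma prob_at_nonneg: "0 \<le> prob_at A t x" and prob_at_le_1: "prob_at A t x \<le> 1"
proof -
  interpret N: prob_space "noise Q" by (rule prob_space_noise)
  show "0 \<le> prob_at A t x" by (simp add: prob_at_def)
  have "ennreal (prob_at A t x) \<le> (\<integral>\<^sup>+\<omega>. 1 \<partial>noise Q)"
    unfolding nn_prob_at[symmetric] by (intro nn_integral_mono) (simp add: indicator_def)
  then show "prob_at A t x \<le> 1" by (simp add: N.emeasure_space_1)
qed

lemma measurable_prob_at [measurable]: "(\<lambda>t. prob_at A t x) \<in> borel_measurable borel"
proof -
  interpret N: prob_space "noise Q" by (rule prob_space_noise)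
  have "(\<lambda>t. \<integral>\<^sup>+\<omega>. indicator A (state_at Q x t \<omega>) \<partial>noise Q) \<in> borel_measurable borel"
    by (intro N.borel_measurable_nn_integral) measurable
  then have "(\<lambda>t. enn2real (ennreal (prob_at A t x))) \<in> borel_measurable borel"
    unfolding nn_prob_at by measurable
  then show ?thesis by (simp add: prob_at_nonneg)
qed

definition prob_at_after_jump :: "'s set \<Rightarrow> real \<Rightarrow> 's \<Rightarrow> real" where
  "prob_at_after_jump A t x = (\<integral>y. prob_at A t y \<partial>jump_pmf x)"

lemma integrable_prob_at: "integrable (measure_pmf p) (prob_at A t)"
  using prob_at_nonneg prob_at_le_1 by (intro measure_pmf.integrable_const_bound[where B=1]) auto

lemma prob_at_after_jump_nonneg: "0 \<le> prob_at_after_jump A t x"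
  and prob_at_after_jump_le_1: "prob_at_after_jump A t x \<le> 1"
  unfolding prob_at_after_jump_def
  using prob_at_nonneg prob_at_le_1 integrable_prob_at
  by (auto intro!: integral_nonneg_AE measure_pmf.integral_le_const)

lemma measurable_prob_at_after_jump [measurable]:
  "(\<lambda>t. prob_at_after_jump A t x) \<in> borel_measurable borel"
  unfolding prob_at_after_jump_def by (intro borel_measurable_integral_pmf) measurable

lemma backward_integrand_integrable:
  "set_integrable lborel {0..t} (\<lambda>s. exp (rate x * s) * prob_at_after_jump A s x)"
proof (rule set_integrable_bound)
  show "set_integrable lborel {0..t} (\<lambda>s. exp (rate x * s))"
    by (intro borel_integrable_atLeastAtMost') (auto intro!: continuous_intros)
qed (auto simp: set_borel_measurable_def prob_at_after_jump_nonneg prob_at_after_jump_le_1 abs_mult)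

text \<open>Condition on the first jump: it occurs after time \<open>t\<close> with probability \<open>exp (- rate x * t)\<close>, and if it
occurs earlier the process starts afresh from the new state.  The clock \<open>e\<close> has
parameter 1 and the jump occurs at time \<open>e / rate x\<close>; the substitution \<open>e = rate x * (t - s)\<close> makes the
time \<open>s\<close> that remains after the jump the integration variable.\<close>

lemma backward_integral_equation:
  assumes t: "0 \<le> t"
  shows "prob_at A t x = exp (- rate x * t) *
    (indicator A x + rate x * integral {0..t} (\<lambda>s. exp (rate x * s) * prob_at_after_jump A s x))"
proof -
  define r where "r = rate x"
  have r: "0 < r" using rate_pos by (simp add: r_def)
  define v where "v s = prob_at_after_jump A s x" for s
  have v: "0 \<le> v s" for s by (simp add: v_def prob_at_after_jump_nonneg)
  have [measurable]: "v \<in> borel_measurable borel" unfolding v_def by measurable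
  define F :: "'s \<Rightarrow> real \<Rightarrow> _ \<Rightarrow> ennreal" where
    "F y e \<omega> = (if t < e / r then indicator A x else indicator A (state_at Q y (t - e / r) \<omega>))" for y e \<omega>
  have "ennreal (prob_at A t x) =
      (\<integral>\<^sup>+e. \<integral>\<^sup>+y. \<integral>\<^sup>+\<omega>. F y e \<omega> \<partial>noise Q \<partial>jump_pmf x \<partial>std_exponential)"
    unfolding nn_prob_at[symmetric]
  proof (rule nn_integral_first_jump)
    show "(\<lambda>p. F y (fst p) (snd p)) \<in> borel_measurable (borel \<Otimes>\<^sub>M noise Q)" for y
      unfolding F_def by measurable
    show "AE \<omega> in noise Q. \<forall>a. 0 \<le> snd a \<longrightarrow>
        indicator A (state_at Q x t (a ## \<omega>)) = F (fst a x) (snd a) \<omega>"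
      using AE_nonexplosive by eventually_elim (auto simp: state_at_Stream F_def r_def)
  qed measurable
  also have "\<dots> = (\<integral>\<^sup>+e. indicator A x * indicator {r * t<..} e +
      ennreal (v (t - e / r)) * indicator {..r * t} e \<partial>std_exponential)"
  proof (intro nn_integral_cong)
    fix e
    interpret N: prob_space "noise Q" by (rule prob_space_noise)
    have "t < e / r \<longleftrightarrow> e \<in> {r * t<..}" using r by (simp add: field_simps)
    moreover have "(\<integral>\<^sup>+y. ennreal (prob_at A s y) \<partial>jump_pmf x) = ennreal (v s)" for s
      unfolding v_def prob_at_after_jump_def
      by (intro nn_integral_eq_integral integrable_prob_at) (simp add: prob_at_nonneg)
    ultimately show "(\<integral>\<^sup>+y. \<integral>\<^sup>+\<omega>. F y e \<omega> \<partial>noise Q \<partial>jump_pmf x) =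
        indicator A x * indicator {r * t<..} e + ennreal (v (t - e / r)) * indicator {..r * t} e"
      by (cases "t < e / r") (auto simp: F_def nn_prob_at N.emeasure_space_1 not_less)
  qed
  also have "\<dots> = (\<integral>\<^sup>+e. indicator A x * indicator {r * t<..} e \<partial>std_exponential) +
      (\<integral>\<^sup>+e. ennreal (v (t - e / r)) * indicator {..r * t} e \<partial>std_exponential)"
    by (intro nn_integral_add) auto
  also have "(\<integral>\<^sup>+e. indicator A x * indicator {r * t<..} e \<partial>std_exponential) = ennreal (indicator A x * exp (- r * t))"
    using r t std_exponential_tail[of "r * t"]
    by (cases "x \<in> A") auto
  also have "(\<integral>\<^sup>+e. ennreal (v (t - e / r)) * indicator {..r * t} e \<partial>std_exponential) =
      (\<integral>\<^sup>+e\<in>{0..}. ennreal (exp (- e)) * (ennreal (v (t - e / r)) * indicator {..r * t} e) \<partial>lborel)"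
    by (rule nn_integral_std_exponential) measurable
  also have "\<dots> = ennreal r * (\<integral>\<^sup>+s. ennreal (exp (- (r * t - r * s))) * (ennreal (v s) * indicator {..r * t} (r * t - r * s))
      * indicator {0..} (r * t - r * s) \<partial>lborel)"
    using r by (subst nn_integral_real_affine[where c="- r" and t="r * t"]) (auto simp: diff_divide_distrib)
  also have "\<dots> = ennreal r * (\<integral>\<^sup>+s. ennreal (exp (- r * t)) * ennreal (indicator {0..t} s *\<^sub>R (exp (r * s) * v s)) \<partial>lborel)"
  proof (rule arg_cong2[where f="(*)", OF refl], rule nn_integral_cong)
    fix s
    have "indicator {..r * t} (r * t - r * s) = (indicator {0..} s :: ennreal)"
      "indicator {0..} (r * t - r * s) = (indicator {..t} s :: ennreal)"
      using r by (auto simp: indicator_def zero_le_mult_iff)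
    moreover have "exp (- (r * t - r * s)) = exp (- r * t) * exp (r * s)"
      by (simp add: mult_exp_exp)
    ultimately show "ennreal (exp (- (r * t - r * s))) * (ennreal (v s) * indicator {..r * t} (r * t - r * s))
        * indicator {0..} (r * t - r * s) = ennreal (exp (- r * t)) * ennreal (indicator {0..t} s *\<^sub>R (exp (r * s) * v s))"
      using v by (auto split: split_indicator simp: ennreal_mult mult.assoc)
  qed
  also have "\<dots> = ennreal r * (ennreal (exp (- r * t)) * ennreal (integral {0..t} (\<lambda>s. exp (r * s) * v s)))"
    using backward_integrand_integrable[of t x A] v
    unfolding v_def[symmetric] r_def[symmetric] set_borel_integral_eq_integral(2)[OF backward_integrand_integrable[of t x A, folded v_def r_def], symmetric]
    unfolding set_lebesgue_integral_def set_integrable_def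
    by (subst nn_integral_cmult) (auto simp: nn_integral_eq_integral)
  finally have "ennreal (prob_at A t x) = ennreal (indicator A x * exp (- r * t)) +
      ennreal r * (ennreal (exp (- r * t)) * ennreal (integral {0..t} (\<lambda>s. exp (r * s) * v s)))" .
  moreover have I: "0 \<le> integral {0..t} (\<lambda>s. exp (r * s) * v s)"
    using v by (intro integral_nonneg set_borel_integral_eq_integral(1)[OF backward_integrand_integrable[of t x A, folded v_def r_def]]) auto
  ultimately have "ennreal (prob_at A t x) = ennreal (indicator A x * exp (- r * t) +
      r * (exp (- r * t) * integral {0..t} (\<lambda>s. exp (r * s) * v s)))"
    using r by (simp add: ennreal_mult)
  then have "prob_at A t x = indicator A x * exp (- r * t) +
      r * (exp (- r * t) * integral {0..t} (\<lambda>s. exp (r * s) * v s))"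
    using I r by (subst (asm) ennreal_inj) (auto simp: prob_at_nonneg)
  then show ?thesis unfolding r_def v_def by (simp add: algebra_simps)
qed

text \<open>An indefinite integral is continuous, and the integral equation passes this on to \<open>prob_at\<close>, hence by dominated
convergence to \<open>prob_at_after_jump\<close>.  With the integrand continuous, the integral equation can be
differentiated.\<close>

lemma continuous_prob_at: "continuous_on {0..T} (\<lambda>t. prob_at A t x)"
proof -
  have "continuous_on {0..T} (\<lambda>t. exp (- rate x * t) *
    (indicator A x + rate x * integral {0..t} (\<lambda>s. exp (rate x * s) * prob_at_after_jump A s x)))"
    by (intro continuous_intros indefinite_integral_continuous_1
        set_borel_integral_eq_integral(1) backward_integrand_integrable)
  then show ?thesis
    by (rule continuous_on_cong[THEN iffD1, rotated 2]) (auto simp: backward_integral_equation)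
qed

lemma continuous_prob_at_after_jump: "continuous_on {0..T} (\<lambda>t. prob_at_after_jump A t x)"
  unfolding continuous_on_sequentially o_def prob_at_after_jump_def
proof (intro allI ballI impI)
  fix X a assume a: "a \<in> {0..T}" and X: "(\<forall>n. X n \<in> {0..T}) \<and> X \<longlonglongrightarrow> a"
  show "(\<lambda>n. \<integral>y. prob_at A (X n) y \<partial>jump_pmf x) \<longlonglongrightarrow> (\<integral>y. prob_at A a y \<partial>jump_pmf x)"
  proof (rule integral_dominated_convergence[where w="\<lambda>_. 1"])
    show "AE y in jump_pmf x. (\<lambda>n. prob_at A (X n) y) \<longlonglongrightarrow> prob_at A a y"
      using continuous_prob_at[of T A] a X unfolding continuous_on_sequentially o_def by blast
  qed (auto simp: prob_at_nonneg prob_at_le_1)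
qed

text \<open>Kolmogorov's backward equation, by differentiating the integral equation.\<close>

lemma backward_equation:
  assumes t: "t \<in> {0..T}"
  shows "((\<lambda>t. prob_at A t x) has_real_derivative generator (prob_at A t) x) (at t within {0..T})"
proof -
  have int: "integrable (Q x) (prob_at A t)"
    using prob_at_nonneg prob_at_le_1 by (intro integrable_Q_bounded[where B=1]) auto
  define k where "k s = exp (rate x * s) * prob_at_after_jump A s x" for s
  have k: "((\<lambda>t. integral {0..t} k) has_real_derivative k t) (at t within {0..T})"
    using t unfolding k_def
    by (intro integral_has_real_derivative continuous_intros continuous_prob_at_after_jump) auto
  have "((\<lambda>t. exp (- rate x * t) * (indicator A x + rate x * integral {0..t} k)) has_real_derivative
      (exp (- rate x * t) * (rate x * k t) - rate x * exp (- rate x * t) * (indicator A x + rate x * integral {0..t} k)))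
      (at t within {0..T})"
    by (auto intro!: derivative_eq_intros k)
  moreover have "exp (- rate x * t) * (rate x * k t) - rate x * exp (- rate x * t) * (indicator A x + rate x * integral {0..t} k)
      = generator (prob_at A t) x"
    unfolding generator_eq[OF int] using backward_integral_equation[of t A x] t
    by (simp add: k_def[symmetric] prob_at_after_jump_def[symmetric])
       (simp add: k_def mult_exp_exp algebra_simps)
  ultimately have "((\<lambda>t. exp (- rate x * t) * (indicator A x + rate x * integral {0..t} k)) has_real_derivative
      generator (prob_at A t) x) (at t within {0..T})" by simp
  then show ?thesis
    by (rule has_field_derivative_transform_within[where d=1])
      (use t in \<open>auto simp: backward_integral_equation k_def[abs_def]\<close>)
qed


lemma generator_bounded:
  assumes B: "\<And>y. 0 \<le> f y" "\<And>y. f y \<le> 1"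
  shows "\<bar>generator f x\<bar> \<le> \<Lambda>"
proof -
  have int: "integrable (Q x) f"
    using B by (intro integrable_Q_bounded[where B=1]) auto
  have "0 \<le> (\<integral>y. f y \<partial>jump_pmf x)" "(\<integral>y. f y \<partial>jump_pmf x) \<le> 1"
    using B integrable_jump_pmf[OF int]
    by (auto intro!: integral_nonneg_AE measure_pmf.integral_le_const)
  then have "\<bar>(\<integral>y. f y \<partial>jump_pmf x) - f x\<bar> \<le> 1" using B[of x] by linarith
  then have "rate x * \<bar>(\<integral>y. f y \<partial>jump_pmf x) - f x\<bar> \<le> \<Lambda> * 1"
    using rate_pos[of x] rate_le'[of x] by (intro mult_mono) auto
  then show ?thesis
    unfolding generator_eq[OF int] using rate_pos[of x] by (simp add: abs_mult)
qed

lemma law_at_time_derivative: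
  assumes "t \<in> {0..T}"
  shows "((\<lambda>t. \<integral>x. prob_at A t x \<partial>measure_pmf p) has_real_derivative
    (\<integral>x. generator (prob_at A t) x \<partial>p)) (at t within {0..T})"
  by (rule has_real_derivative_integral_dominated[where g="\<lambda>_. \<Lambda>"])
    (use assms in \<open>auto intro!: backward_equation generator_bounded integrable_prob_at
      simp: prob_at_nonneg prob_at_le_1\<close>)

lemma prob_at_0: "prob_at A 0 x = indicator A x"
  by (simp add: backward_integral_equation)

lemma measure_bind_transition:
  "measure (measure_pmf p \<bind> transition Q t) A = (\<integral>x. prob_at A t x \<partial>measure_pmf p)"
proof -
  have kernel: "transition Q t \<in> measure_pmf p \<rightarrow>\<^sub>M prob_algebra borel"
  proof -
    have "state_at Q x t \<in> noise Q \<rightarrow>\<^sub>M borel" for x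
      unfolding measurable_into_discrete_borel by (rule measurable_state_at_fixed)
    then have "transition Q t x \<in> space (prob_algebra borel)" for x
      unfolding transition_def by (auto simp: space_prob_algebra intro!: prob_space.prob_space_distr prob_space_noise)
    then show ?thesis by (auto simp: measurable_def)
  qed
  then have "transition Q t \<in> measure_pmf p \<rightarrow>\<^sub>M subprob_algebra borel"
    by (rule measurable_prob_algebraD)
  then show ?thesis
    unfolding prob_at_def by (subst measure_pmf.measure_bind) (auto simp: sets_borel_discrete)
qed

text \<open>Let \<open>\<phi>(t)\<close> be the mass of \<open>A\<close> at time \<open>t\<close> under the initial law \<open>p\<close>.  By the backward equation
\<open>\<phi>'(t)\<close> is the \<open>p\<close>-mean of \<open>G\<close> applied to \<open>prob_at A t\<close>.  If \<open>p\<close> is invariant, then \<open>\<phi>\<close> is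
constant, and \<open>\<phi>'(0) = 0\<close> says that the mean of \<open>G 1\<^sub>A\<close> vanishes.  Conversely stationarity for the uniformised
chain makes the means of \<open>G\<close> vanish for all bounded functions, so \<open>\<phi>' = 0\<close>.\<close>

lemma invariant_prob_pmf_iff: "invariant_prob Q (measure_pmf p) \<longleftrightarrow> bind_pmf p unif_pmf = p"
proof
  assume inv: "invariant_prob Q (measure_pmf p)"
  show "bind_pmf p unif_pmf = p"
  proof (rule stationary_if_generator)
    fix A
    define \<phi> where "\<phi> t = (\<integral>x. prob_at A t x \<partial>measure_pmf p)" for t
    have const: "\<phi> t = measure p A" if "0 \<le> t" for t
      using inv that unfolding \<phi>_def invariant_prob_def measure_bind_transition[symmetric] by simp
    have "(\<phi> has_real_derivative (\<integral>x. generator (prob_at A 0) x \<partial>p)) (at 0 within {0..1})"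
      unfolding \<phi>_def by (rule law_at_time_derivative) simp
    moreover have "(\<phi> has_real_derivative 0) (at 0 within {0..1})"
      by (rule has_field_derivative_transform_within[where f="\<lambda>_. measure p A" and d=1])
        (auto simp: const)
    ultimately have "(\<integral>x. generator (prob_at A 0) x \<partial>p) = 0"
      unfolding has_real_derivative_iff_has_vector_derivative
      by (intro vector_derivative_unique_within_closed_interval[of 0 1 0 \<phi>]) auto
    moreover have "prob_at A 0 = indicator A" by (auto simp: prob_at_0)
    ultimately show "(\<integral>x. generator (indicator A) x \<partial>measure_pmf p) = 0" by simp
  qed
next
  assume p: "bind_pmf p unif_pmf = p"
  show "invariant_prob Q (measure_pmf p)"
    unfolding invariant_prob_def
  proof (intro conjI allI impI)
    show "measure_pmf p \<in> space (prob_algebra borel)"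
      by (auto simp: space_prob_algebra sets_borel_discrete intro: measure_pmf.prob_space_axioms)
    fix t :: real assume t: "0 \<le> t"
    have "((\<lambda>t. \<integral>x. prob_at A t x \<partial>measure_pmf p) has_real_derivative 0) (at s within {0..t})"
      if "s \<in> {0..t}" for A s
      using law_at_time_derivative[OF that, where A=A and p=p]
        stationary_generator[OF p, of "prob_at A s" 1] prob_at_nonneg prob_at_le_1 by simp
    then have ex: "\<exists>c. \<forall>s\<in>{0..t}. (\<integral>x. prob_at A s x \<partial>measure_pmf p) = c" for A
      by (intro has_field_derivative_zero_constant) auto
    have "(\<integral>x. prob_at A t x \<partial>measure_pmf p) = (\<integral>x. prob_at A 0 x \<partial>measure_pmf p)" for A
    proof -
      obtain c where "\<forall>s\<in>{0..t}. (\<integral>x. prob_at A s x \<partial>measure_pmf p) = c" using ex by blast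
      then show ?thesis using t by simp
    qed
    then have eq: "measure (measure_pmf p \<bind> transition Q t) A = measure p A" for A
      unfolding measure_bind_transition by (simp add: prob_at_0)
    show "measure_pmf p \<bind> transition Q t = measure_pmf p"
    proof (rule measure_eqI)
      have "sets (transition Q t x) = UNIV" for x by (simp add: transition_def sets_borel_discrete)
      then show sets: "sets (measure_pmf p \<bind> transition Q t) = sets (measure_pmf p)"
        by (subst sets_bind[where N=borel]) (auto simp: sets_borel_discrete)
      fix A
      have "measure (measure_pmf p \<bind> transition Q t) UNIV = 1" using eq[of UNIV] by simp
      then have "emeasure (measure_pmf p \<bind> transition Q t) (space (measure_pmf p \<bind> transition Q t)) \<noteq> \<infinity>"
        using sets_eq_imp_space_eq[OF sets] by (auto simp: measure_def)
      then interpret finite_measure "measure_pmf p \<bind> transition Q t" by (intro finite_measureI)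
      show "emeasure (measure_pmf p \<bind> transition Q t) A = emeasure (measure_pmf p) A"
        unfolding emeasure_eq_measure measure_pmf.emeasure_eq_measure eq ..
    qed
  qed
qed

lemma positive_harris_recurrent_if_drift:
  assumes drift: "drift_chain unif_pmf w c g" and irr: "irreducible_process Q"
  obtains p where "positive_harris_recurrent Q" "bind_pmf p unif_pmf = p"
    "\<And>\<pi>. invariant_prob Q \<pi> \<longleftrightarrow> \<pi> = measure_pmf p"
proof -
  obtain p where p: "bind_pmf p unif_pmf = p"
    using drift_chain.stationary_pmf_exists[OF drift] by blast
  obtain z where z: "\<And>A. A \<noteq> {} \<Longrightarrow> absorbing A \<Longrightarrow> z \<in> A"
    using irreducible_imp_accessible_state[OF irr] by blast
  have unique: "\<pi> = measure_pmf p" if \<pi>: "invariant_prob Q \<pi>" for \<pi>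
  proof -
    have prob: "prob_space \<pi>" "sets \<pi> = UNIV"
      using \<pi> by (auto simp: invariant_prob_def space_prob_algebra sets_borel_discrete)
    note eq = pmf_of_discrete_prob_space[OF prob]
    have "bind_pmf (Abs_pmf \<pi>) unif_pmf = Abs_pmf \<pi>"
      using \<pi> unfolding invariant_prob_pmf_iff[symmetric] eq .
    then have "Abs_pmf \<pi> = p"
      using z by (rule stationary_pmf_unique[OF _ p]) (auto simp: absorbing_def)
    with eq show ?thesis by simp
  qed
  moreover have inv: "invariant_prob Q (measure_pmf p)" using p by (simp add: invariant_prob_pmf_iff)
  ultimately have iff: "invariant_prob Q \<pi> \<longleftrightarrow> \<pi> = measure_pmf p" for \<pi> by blast
  have "positive_harris_recurrent Q"
    using inv harris_recurrent_if_drift[OF drift irr] unfolding positive_harris_recurrent_def by blast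
  from this p iff show thesis by (rule that)
qed

end

section \<open>Controlled generators on V-bounded functions\<close>

lemma compact_discrete_imp_finite:
  fixes S :: "'s::discrete_topology set"
  assumes "compact (closure S)"
  shows "finite S"
proof -
  have "closure S \<subseteq> (\<Union>x\<in>closure S. {x})" by auto
  then obtain F where "F \<subseteq> closure S" "finite F" "closure S \<subseteq> (\<Union>x\<in>F. {x})"
    using compactE_image[OF assms, of "closure S" "\<lambda>x. {x}"] discrete_topology_class.open_discrete by blast
  then have "finite (closure S)" by (auto intro: finite_subset)
  then show ?thesis using closure_subset by (rule finite_subset[rotated])
qed

lemma Vnorm_bound:
  assumes V: "\<And>x. 0 \<le> V x" and fin: "Vnorm V f < \<infinity>"
  shows "\<bar>f x\<bar> \<le> enn2real (Vnorm V f) * (1 + V x)"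
proof -
  have "ennreal (\<bar>f x\<bar> / (1 + V x)) \<le> Vnorm V f"
    unfolding Vnorm_def by (rule SUP_upper) simp
  also have "\<dots> = ennreal (enn2real (Vnorm V f))"
    using fin by (simp add: ennreal_enn2real)
  finally have "\<bar>f x\<bar> / (1 + V x) \<le> enn2real (Vnorm V f)"
    by (subst (asm) ennreal_le_iff) auto
  then show ?thesis using V[of x] by (simp add: field_simps)
qed

lemma Vnorm_le:
  assumes V: "\<And>x. 0 \<le> V x" and le: "\<And>x. \<bar>f x\<bar> \<le> B * (1 + V x)"
  shows "Vnorm V f \<le> ennreal B"
  unfolding Vnorm_def
proof (rule SUP_least)
  fix x show "ennreal (\<bar>f x\<bar> / (1 + V x)) \<le> ennreal B"
    using le[of x] V[of x] by (intro ennreal_leI) (simp add: field_simps)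
qed

lemma Vnorm_SUP_bound:
  assumes V: "\<And>x. 0 \<le> V x" and fin: "(SUP t\<in>S. Vnorm V (f t)) < \<infinity>" and t: "t \<in> S"
  shows "\<bar>f t x\<bar> \<le> enn2real (SUP t\<in>S. Vnorm V (f t)) * (1 + V x)"
proof -
  have le: "Vnorm V (f t) \<le> (SUP t\<in>S. Vnorm V (f t))" using t by (rule SUP_upper)
  have "\<bar>f t x\<bar> \<le> enn2real (Vnorm V (f t)) * (1 + V x)"
    using le fin by (intro Vnorm_bound V) (rule le_less_trans)
  also have "\<dots> \<le> enn2real (SUP t\<in>S. Vnorm V (f t)) * (1 + V x)"
    using V[of x] fin by (intro mult_right_mono enn2real_mono le) auto
  finally show ?thesis .
qed

text \<open>The superlevel sets are relatively open in \<open>U\<close>.\<close>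

lemma lsc_on_borel_measurable:
  fixes g :: "'u::euclidean_space \<Rightarrow> real"
  assumes "lsc_on U g" and U: "U \<in> sets borel"
  shows "g \<in> borel_measurable (restrict_space borel U)"
  unfolding borel_measurable_iff_greater
proof
  fix a
  have "\<exists>S. open S \<and> u \<in> S \<and> (\<forall>v\<in>S \<inter> U. a < g v)" if "u \<in> U" "a < g u" for u
  proof -
    have "\<forall>\<^sub>F v in at u within U. a < g v" using assms(1) that by (auto simp: lsc_on_def)
    then obtain S where "open S" "u \<in> S" "\<forall>v\<in>S. v \<noteq> u \<longrightarrow> v \<in> U \<longrightarrow> a < g v"
      by (auto simp: eventually_at_topological)
    then show ?thesis using that by (intro exI[of _ S]) auto
  qed
  then have "{u \<in> U. a < g u} = \<Union> {S. open S \<and> (\<forall>v\<in>S \<inter> U. a < g v)} \<inter> U" by blast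
  moreover have "\<Union> {S. open S \<and> (\<forall>v\<in>S \<inter> U. a < g v)} \<in> sets borel"
    by (intro borel_open open_Union) auto
  ultimately show "{u \<in> space (restrict_space borel U). a < g u} \<in> sets (restrict_space borel U)"
    using U by (auto simp: space_restrict_space sets_restrict_space)
qed

lemma countable_space_eq_density:
  fixes M :: "'s::countable measure"
  assumes sets: "sets M = UNIV" and "finite_measure M"
  shows "M = density (count_space UNIV) (\<lambda>y. ennreal (measure M {y}))"
proof (rule measure_eqI_countable[where A=UNIV])
  interpret finite_measure M by fact
  fix a :: 's
  have "emeasure (density (count_space UNIV) (\<lambda>y. ennreal (measure M {y}))) {a} =
      (\<integral>\<^sup>+y. ennreal (measure M {y}) * indicator {a} y \<partial>count_space UNIV)"
    by (simp add: emeasure_density)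
  then show "emeasure M {a} = emeasure (density (count_space UNIV) (\<lambda>y. ennreal (measure M {y}))) {a}"
    by (simp add: emeasure_eq_measure)
qed (use sets in auto)

text \<open>Controlled rates that are uniformly bounded and integrate the weight \<open>1 + V\<close> with uniform growth \<open>\<kappa>\<close>.
Functions bounded by a multiple of \<open>1 + V\<close> are then in the domain of every generator.\<close>

locale weighted_jump_control =
  fixes q :: "'s::{countable,discrete_topology} \<Rightarrow> 'u::euclidean_space \<Rightarrow> 's measure"
    and U :: "'u set" and V :: "'s \<Rightarrow> real" and \<Lambda> \<kappa> :: real
  assumes kernel: "jump_rate_kernel U q"
    and V_nonneg: "\<And>x. 0 \<le> V x"
    and one_le: "1 \<le> \<Lambda>" and kappa_nonneg: "0 \<le> \<kappa>"
    and rate_bound: "\<And>x u. u \<in> U \<Longrightarrow> measure (q x u) UNIV \<le> \<Lambda>"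
    and weight_bound: "\<And>x u. u \<in> U \<Longrightarrow> (\<integral>\<^sup>+y. ennreal (1 + V y) \<partial>q x u) \<le> ennreal (\<kappa> * (1 + V x))"
begin

lemma finite_q: "u \<in> U \<Longrightarrow> finite_measure (q x u)" and sets_q: "u \<in> U \<Longrightarrow> sets (q x u) = UNIV"
  using kernel by (auto simp: jump_rate_kernel_def sets_borel_discrete)

lemma measurable_q: "u \<in> U \<Longrightarrow> f \<in> borel_measurable (q x u)" for f :: "'s \<Rightarrow> 'c::topological_space"
  by (auto simp: measurable_def sets_q)

lemma space_q: "u \<in> U \<Longrightarrow> space (q x u) = UNIV"
  using sets_eq_imp_space_eq[of "q x u" "count_space UNIV"] by (simp add: sets_q)

lemma bounded_jump_rates_control: "(\<And>x. \<mu> x \<in> U) \<Longrightarrow> bounded_jump_rates (controlled_rates q \<mu>) \<Lambda>"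
  by (intro bounded_jump_rates.intro) (auto simp: controlled_rates_def finite_q sets_q sets_borel_discrete rate_bound one_le)

lemma
  assumes u: "u \<in> U" and f: "\<And>y. \<bar>f y\<bar> \<le> B * (1 + V y)"
  shows weighted_integrable: "integrable (q x u) f"
    and gen_weighted_eq: "gen q u f x = (\<integral>y. f y \<partial>q x u) - measure (q x u) UNIV * f x"
    and gen_weighted_bound: "\<bar>gen q u f x\<bar> \<le> B * (\<kappa> + \<Lambda>) * (1 + V x)"
proof -
  interpret finite_measure "q x u" using u by (rule finite_q)
  have B: "0 \<le> B" using f[of x] V_nonneg[of x] abs_ge_zero[of "f x"] order_trans zero_le_mult_iff
    by (smt (verit, best))
  have w: "integrable (q x u) (\<lambda>y. 1 + V y)"
    using weight_bound[OF u, of x] V_nonneg u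
    by (intro integrableI_nonneg measurable_q) (auto intro: le_less_trans)
  have "ennreal (\<integral>y. 1 + V y \<partial>q x u) \<le> ennreal (\<kappa> * (1 + V x))"
    using weight_bound[OF u, of x] V_nonneg w by (subst (asm) nn_integral_eq_integral) auto
  then have w_le: "(\<integral>y. 1 + V y \<partial>q x u) \<le> \<kappa> * (1 + V x)"
    using kappa_nonneg V_nonneg[of x] by (subst (asm) ennreal_le_iff) auto
  show int: "integrable (q x u) f"
    using f u by (intro Bochner_Integration.integrable_bound[OF integrable_mult_right[OF w, of B]] measurable_q)
      (auto intro: order_trans[OF _ abs_ge_self])
  show eq: "gen q u f x = (\<integral>y. f y \<partial>q x u) - measure (q x u) UNIV * f x"
    unfolding gen_def using int u by (simp add: space_q)
  have "\<bar>\<integral>y. f y \<partial>q x u\<bar> \<le> (\<integral>y. B * (1 + V y) \<partial>q x u)"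
    using f int w by (intro integral_abs_bound[THEN order_trans] integral_mono) auto
  also have "\<dots> \<le> B * (\<kappa> * (1 + V x))"
    using w_le B by (simp add: mult_left_mono)
  finally have 1: "\<bar>\<integral>y. f y \<partial>q x u\<bar> \<le> B * (\<kappa> * (1 + V x))" .
  have "\<bar>measure (q x u) UNIV * f x\<bar> \<le> \<Lambda> * (B * (1 + V x))"
    unfolding abs_mult using f[of x] rate_bound[OF u, of x] one_le by (intro mult_mono) auto
  with 1 show "\<bar>gen q u f x\<bar> \<le> B * (\<kappa> + \<Lambda>) * (1 + V x)"
    unfolding eq by (simp add: algebra_simps)
qed

text \<open>A finite measure on a countable space has a density with respect to counting measure, so the generator is a
countable sum of products of functions measurable in the parameter \<open>a\<close>.\<close>

lemma measurable_gen:
  fixes f :: "'a \<Rightarrow> 's \<Rightarrow> real"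
  assumes f [measurable]: "\<And>y. (\<lambda>a. f a y) \<in> borel_measurable N"
    and f_bound: "\<And>a y. a \<in> space N \<Longrightarrow> \<bar>f a y\<bar> \<le> B * (1 + V y)"
    and v [measurable]: "v \<in> N \<rightarrow>\<^sub>M restrict_space borel U" and X: "X \<in> N \<rightarrow>\<^sub>M borel"
  shows "(\<lambda>a. gen q (v a) (f a) (X a)) \<in> borel_measurable N"
proof -
  interpret C: sigma_finite_measure "count_space (UNIV :: 's set)"
    by (rule sigma_finite_measure_count_space)
  have v_in: "v a \<in> U" if "a \<in> space N" for a
    using measurable_space[OF v that] by (simp add: space_restrict_space)
  have [measurable]: "(\<lambda>u. emeasure (q x u) A) \<in> borel_measurable (restrict_space borel U)" for x A
    using kernel by (auto simp: jump_rate_kernel_def sets_borel_discrete)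
  have [measurable]: "(\<lambda>u. measure (q x u) A) \<in> borel_measurable (restrict_space borel U)" for x A
    unfolding measure_def by measurable
  have [measurable]: "(\<lambda>a. measure (q x (v a)) A) \<in> borel_measurable N" for x A
    by measurable
  have "(\<lambda>a. gen q (v a) (f a) x) \<in> borel_measurable N" for x
  proof -
    have "(\<lambda>(y, a). measure (q x (v a)) {y} * f a y) \<in> borel_measurable (count_space UNIV \<Otimes>\<^sub>M N)"
      by (rule measurable_pair_measure_countable1) auto
    then have "(\<lambda>(a, y). measure (q x (v a)) {y} * f a y) \<in> borel_measurable (N \<Otimes>\<^sub>M count_space UNIV)"
      using measurable_pair_swap_iff[of "\<lambda>(y, a). measure (q x (v a)) {y} * f a y" "count_space UNIV" N]
      by (simp add: case_prod_beta)
    then have [measurable]: "(\<lambda>a. \<integral>y. measure (q x (v a)) {y} * f a y \<partial>count_space UNIV) \<in> borel_measurable N"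
      by (rule C.borel_measurable_lebesgue_integral)
    have "(\<lambda>a. (\<integral>y. measure (q x (v a)) {y} * f a y \<partial>count_space UNIV) - measure (q x (v a)) UNIV * f a x)
        \<in> borel_measurable N"
      by measurable
    then show ?thesis
    proof (rule measurable_cong[THEN iffD1, rotated])
      fix a assume a: "a \<in> space N"
      have "(\<integral>y. f a y \<partial>q x (v a)) = (\<integral>y. f a y \<partial>density (count_space UNIV) (\<lambda>y. ennreal (measure (q x (v a)) {y})))"
        using countable_space_eq_density[OF sets_q finite_q, OF v_in[OF a] v_in[OF a]] by simp
      also have "\<dots> = (\<integral>y. measure (q x (v a)) {y} * f a y \<partial>count_space UNIV)"
        by (subst integral_density) auto
      finally show "(\<integral>y. measure (q x (v a)) {y} * f a y \<partial>count_space UNIV) - measure (q x (v a)) UNIV * f a x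
          = gen q (v a) (f a) x"
        unfolding gen_weighted_eq[OF v_in[OF a] f_bound[OF a]] by simp
    qed
  qed
  moreover have "X \<in> N \<rightarrow>\<^sub>M count_space UNIV"
    using X unfolding measurable_into_discrete_borel .
  ultimately show ?thesis
    by (rule measurable_compose_countable[where f="\<lambda>x a. gen q (v a) (f a) x"])
qed

text \<open>Extension of a balance identity from bounded to \<open>V\<close>-bounded functions.  Truncate \<open>f\<close> at height \<open>n\<close>; the
growth bound dominates the generators of the truncations by a multiple of \<open>1 + V\<close>, uniformly in \<open>n\<close>.  The
index \<open>w\<close> is a state in the case of a stationary law, and a triple of time, state and control in the case of a plan.\<close>

lemma integral_gen_weighted_eq_0:
  fixes X :: "'w \<Rightarrow> 's" and u :: "'w \<Rightarrow> 'u"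
  assumes bdd: "\<And>f B. (\<And>x. \<bar>f x\<bar> \<le> B) \<Longrightarrow> (\<integral>w. gen q (u w) f (X w) \<partial>M) = 0"
    and u: "\<And>w. w \<in> space M \<Longrightarrow> u w \<in> U"
    and meas: "\<And>f B. (\<And>y. \<bar>f y\<bar> \<le> B * (1 + V y)) \<Longrightarrow> (\<lambda>w. gen q (u w) f (X w)) \<in> borel_measurable M"
    and V: "integrable M (\<lambda>w. 1 + V (X w))"
    and f: "\<And>y. \<bar>f y\<bar> \<le> B * (1 + V y)"
  shows "(\<integral>w. gen q (u w) f (X w) \<partial>M) = 0" "integrable M (\<lambda>w. gen q (u w) f (X w))"
proof -
  define g where "g n y = max (- real n) (min (real n) (f y))" for n :: nat and y
  have g: "\<bar>g n y\<bar> \<le> B * (1 + V y)" for n y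
    using f[of y] by (auto simp: g_def)
  have gn: "\<bar>g n y\<bar> \<le> real n" for n y by (auto simp: g_def)
  have lim: "(\<lambda>n. g n y) \<longlonglongrightarrow> f y" for y
  proof (rule tendsto_eventually)
    obtain N where "\<bar>f y\<bar> \<le> real N" using real_arch_simple by blast
    then show "\<forall>\<^sub>F n in sequentially. g n y = f y"
      unfolding eventually_sequentially by (intro exI[of _ N]) (auto simp: g_def)
  qed
  have "(\<lambda>n. \<integral>w. gen q (u w) (g n) (X w) \<partial>M) \<longlonglongrightarrow> (\<integral>w. gen q (u w) f (X w) \<partial>M)"
  proof (rule integral_dominated_convergence)
    show "integrable M (\<lambda>w. B * (\<kappa> + \<Lambda>) * (1 + V (X w)))" using V by simp
    show "AE w in M. norm (gen q (u w) (g n) (X w)) \<le> B * (\<kappa> + \<Lambda>) * (1 + V (X w))" for n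
      using gen_weighted_bound[OF u g] by (intro AE_I2) simp
    show "AE w in M. (\<lambda>n. gen q (u w) (g n) (X w)) \<longlonglongrightarrow> gen q (u w) f (X w)"
    proof (rule AE_I2)
      fix w assume w: "w \<in> space M"
      have "(\<lambda>n. \<integral>y. g n y \<partial>q (X w) (u w)) \<longlonglongrightarrow> (\<integral>y. f y \<partial>q (X w) (u w))"
      proof (rule integral_dominated_convergence)
        show "integrable (q (X w) (u w)) (\<lambda>y. \<bar>f y\<bar>)"
          using weighted_integrable[OF u[OF w] f] by simp
        show "AE y in q (X w) (u w). norm (g n y) \<le> \<bar>f y\<bar>" for n
          by (auto simp: g_def)
      qed (use lim u[OF w] in \<open>auto intro: measurable_q\<close>)
      then show "(\<lambda>n. gen q (u w) (g n) (X w)) \<longlonglongrightarrow> gen q (u w) f (X w)"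
        unfolding gen_weighted_eq[OF u[OF w] f] gen_weighted_eq[OF u[OF w] g]
        by (intro tendsto_intros lim)
    qed
  qed (rule meas, rule f, rule meas, rule g)
  moreover have "(\<integral>w. gen q (u w) (g n) (X w) \<partial>M) = 0" for n
    by (rule bdd) (rule gn)
  ultimately show "(\<integral>w. gen q (u w) f (X w) \<partial>M) = 0"
    by (simp add: LIMSEQ_const_iff)
  show "integrable M (\<lambda>w. gen q (u w) f (X w))"
  proof (rule Bochner_Integration.integrable_bound)
    show "integrable M (\<lambda>w. B * (\<kappa> + \<Lambda>) * (1 + V (X w)))" using V by simp
    show "AE w in M. norm (gen q (u w) f (X w)) \<le> norm (B * (\<kappa> + \<Lambda>) * (1 + V (X w)))"
      using gen_weighted_bound[OF u f] by (intro AE_I2) (auto intro: order_trans[OF _ abs_ge_self])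
  qed (rule meas, rule f)
qed

text \<open>A supremum of reals is an upper bound only if the set is bounded above.  Here this follows from the
growth bound on \<open>gen q u f x\<close>, which is uniform in \<open>u\<close>, and from nonnegativity of the cost.\<close>

lemma gen_minus_cost_le_Ham:
  assumes u: "u \<in> U" and c: "\<And>u. u \<in> U \<Longrightarrow> 0 \<le> c x u" and f: "\<And>y. \<bar>f y\<bar> \<le> B * (1 + V y)"
  shows "gen q u f x - c x u \<le> Ham q U c f x"
  unfolding Ham_def
proof (rule cSUP_upper[OF u], rule bdd_aboveI2)
  fix v assume v: "v \<in> U"
  show "gen q v f x - c x v \<le> B * (\<kappa> + \<Lambda>) * (1 + V x)"
    using gen_weighted_bound[OF v f, of x] c[OF v] by linarith
qed

lemma Ham_eq_maximum:
  assumes "is_arg_max (\<lambda>u. gen q u f x - c x u) (\<lambda>u. u \<in> U) u"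
  shows "Ham q U c f x = gen q u f x - c x u"
  unfolding Ham_def using assms by (intro cSup_eq_maximum) (auto simp: is_arg_max_def not_less)

end

section \<open>The dual problem\<close>

lemma time_deriv_works:
  assumes "time_differentiable T f" "t \<in> {0..T}"
  shows "((\<lambda>s. f s x) has_real_derivative time_deriv T f t x) (at t within {0..T})"
  using assms unfolding time_differentiable_def time_deriv_def differentiable_on_def
    has_real_derivative_iff_has_vector_derivative
  by (simp add: vector_derivative_works)

lemma time_deriv_eqI:
  assumes "0 < T" "t \<in> {0..T}" "((\<lambda>s. f s x) has_real_derivative d) (at t within {0..T})"
  shows "time_deriv T f t x = d"
  unfolding time_deriv_def using assms
  by (intro vector_derivative_within_cbox[of 0 T t, unfolded box_real])
    (auto simp: has_real_derivative_iff_has_vector_derivative)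

text \<open>A solution of the Poisson equation together with a stationary law \<open>p\<close> of its maximiser that integrates \<open>V\<close>.\<close>

locale stationary_optimal_control = weighted_jump_control q U V \<Lambda> \<kappa>
  for q :: "'s::{countable,discrete_topology} \<Rightarrow> 'u::euclidean_space \<Rightarrow> 's measure"
    and U V \<Lambda> \<kappa> +
  fixes c :: "'s \<Rightarrow> 'u \<Rightarrow> real" and h :: "'s \<Rightarrow> real" and gs :: real and us :: "'s \<Rightarrow> 'u"
    and p :: "'s pmf" and B :: real
  assumes c_nonneg: "\<And>x u. u \<in> U \<Longrightarrow> 0 \<le> c x u" and c_lsc: "\<And>x. lsc_on U (c x)"
    and U_borel: "U \<in> sets borel"
    and h_bound: "\<And>y. \<bar>h y\<bar> \<le> B * (1 + V y)"
    and us_argmax: "\<And>x. is_arg_max (\<lambda>u. gen q u h x - c x u) (\<lambda>u. u \<in> U) (us x)"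
    and poisson: "\<And>x. gs + gen q (us x) h x = c x (us x)"
    and stationary: "bind_pmf p (bounded_jump_rates.unif_pmf (controlled_rates q us) \<Lambda>) = p"
    and V_integrable: "(\<integral>\<^sup>+x. ennreal (V x) \<partial>p) < \<infinity>"
begin

lemma us_in: "us x \<in> U"
  using us_argmax[of x] by (simp add: is_arg_max_def)

sublocale R: bounded_jump_rates "controlled_rates q us" \<Lambda>
  by (rule bounded_jump_rates_control) (rule us_in)

lemma generator_us: "R.generator f x = gen q (us x) f x"
  by (simp add: R.generator_def gen_def controlled_rates_def)

lemma integrable_weight: "integrable (measure_pmf p) (\<lambda>x. 1 + V x)"
proof -
  have "integrable (measure_pmf p) V"
    using V_integrable V_nonneg by (intro integrableI_nonneg) auto
  then show ?thesis by simp
qed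

lemma integrable_weighted: "integrable (measure_pmf p) f" if "\<And>y. \<bar>f y\<bar> \<le> D * (1 + V y)" for f :: "'s \<Rightarrow> real"
  by (rule Bochner_Integration.integrable_bound[OF integrable_mult_right[OF integrable_weight, of D]])
    (use that in \<open>auto intro: order_trans[OF _ abs_ge_self]\<close>)

lemma stationary_bounded: "(\<integral>x. gen q (us x) f x \<partial>p) = 0" if "\<And>y. \<bar>f y\<bar> \<le> D"
  using R.stationary_generator[OF stationary that] by (simp add: generator_us)

lemma
  assumes "\<And>y. \<bar>f y\<bar> \<le> D * (1 + V y)"
  shows stationary_weighted: "(\<integral>x. gen q (us x) f x \<partial>p) = 0"
    and integrable_gen_weighted: "integrable (measure_pmf p) (\<lambda>x. gen q (us x) f x)"
  using integral_gen_weighted_eq_0[where M="measure_pmf p" and u=us and X="\<lambda>x. x" and f=f and B=D]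
    stationary_bounded us_in integrable_weight assms by auto

lemma
  shows mean_cost: "(\<integral>x. c x (us x) \<partial>p) = gs"
    and integrable_cost: "integrable (measure_pmf p) (\<lambda>x. c x (us x))"
  using stationary_weighted[OF h_bound] integrable_gen_weighted[OF h_bound]
  unfolding poisson[symmetric] by auto

lemma gs_nonneg: "0 \<le> gs"
  unfolding mean_cost[symmetric] by (intro integral_nonneg_AE) (simp add: c_nonneg us_in)

lemma Ham_h: "Ham q U c h x = - gs"
  using Ham_eq_maximum[where c=c and f=h and x=x, OF us_argmax] poisson[of x] by simp

text \<open>The inequality on which both bounds rest, valid for every control.\<close>

lemma poisson_inequality: "u \<in> U \<Longrightarrow> gs + gen q u h x \<le> c x u"
  using gen_minus_cost_le_Ham[where c=c and u=u and x=x, OF _ c_nonneg h_bound] by (simp add: Ham_h)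

lemma gen_shift: "gen q u (\<lambda>x. f x + a) x = gen q u f x"
  by (simp add: gen_def)

lemma poisson_time_deriv:
  assumes "0 < T" "t \<in> {0..T}"
  shows "time_deriv T (\<lambda>t x. h x + (t - T) * gs) t x = gs"
  using assms by (intro time_deriv_eqI) (auto intro!: derivative_eq_intros)

lemma poisson_solves_HJB: "0 < T \<Longrightarrow> solves_HJB q U c T (\<lambda>t x. h x + (t - T) * gs)"
  unfolding solves_HJB_def
  by (auto simp: poisson_time_deriv Ham_h[unfolded Ham_def] Ham_def gen_shift)

lemma poisson_in_dual_class:
  assumes T: "0 < T"
  shows "(\<lambda>t x. h x + (t - T) * gs) \<in> dual_class q U c V T"
proof -
  define f where "f = (\<lambda>t x. h x + (t - T) * gs)"
  have td: "time_deriv T f t = (\<lambda>x. gs)" if "t \<in> {0..T}" for t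
    using poisson_time_deriv[OF T that] by (auto simp: f_def)
  have s1: "(SUP t\<in>{0..T}. Vnorm V (f t)) \<le> ennreal (B + T * \<bar>gs\<bar>)"
  proof (intro SUP_least Vnorm_le V_nonneg)
    fix t x assume t: "t \<in> {0..T}"
    have "\<bar>(t - T) * gs\<bar> \<le> T * \<bar>gs\<bar>"
      unfolding abs_mult using t by (intro mult_right_mono) auto
    also have "\<dots> \<le> T * \<bar>gs\<bar> * (1 + V x)"
      using V_nonneg[of x] T mult_left_mono[of 1 "1 + V x" "T * \<bar>gs\<bar>"] by simp
    finally have "\<bar>(t - T) * gs\<bar> \<le> T * \<bar>gs\<bar> * (1 + V x)" .
    then show "\<bar>f t x\<bar> \<le> (B + T * \<bar>gs\<bar>) * (1 + V x)"
      using h_bound[of x] abs_triangle_ineq[of "h x" "(t - T) * gs"]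
      unfolding f_def by (simp add: distrib_right)
  qed
  have s2: "(SUP t\<in>{0..T}. Vnorm V (time_deriv T f t)) \<le> ennreal \<bar>gs\<bar>"
  proof (intro SUP_least Vnorm_le V_nonneg)
    fix t x assume t: "t \<in> {0..T}"
    show "\<bar>time_deriv T f t x\<bar> \<le> \<bar>gs\<bar> * (1 + V x)"
      using V_nonneg[of x] unfolding td[OF t] by (simp add: distrib_left)
  qed
  have "(SUP t\<in>{0..T}. Vnorm V (f t)) + (SUP t\<in>{0..T}. Vnorm V (time_deriv T f t)) < \<infinity>"
    by (rule le_less_trans[OF add_mono[OF s1 s2]]) (simp add: ennreal_add_less_top)
  moreover have "time_differentiable T f"
    unfolding time_differentiable_def f_def by (intro allI derivative_intros)
  moreover have "continuous_on {0..T} (\<lambda>t. time_deriv T f t x)" for x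
    by (rule continuous_on_cong[THEN iffD1, OF refl _ continuous_on_const[of _ gs]]) (simp add: td)
  moreover have "solves_HJB q U c T f"
    unfolding f_def by (rule poisson_solves_HJB[OF T])
  ultimately show ?thesis unfolding dual_class_def f_def[symmetric] by blast
qed

text \<open>The Hamiltonian dominates its value at the control \<open>us x\<close>, so
\<open>\<partial>\<^sub>t f \<le> c(x, us x) - G f\<close>.  Under the stationary law the right-hand side has mean \<open>gs\<close>, so the mean of
\<open>f t\<close> increases at rate at most \<open>gs\<close>.\<close>

lemma dual_value_le:
  assumes T: "0 < T" and f: "f \<in> dual_class q U c V T"
  shows "(\<integral>x. f T x - f 0 x \<partial>p) \<le> T * gs"
proof -
  define B1 where "B1 = enn2real (SUP t\<in>{0..T}. Vnorm V (f t))"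
  define B2 where "B2 = enn2real (SUP t\<in>{0..T}. Vnorm V (time_deriv T f t))"
  have fin: "(SUP t\<in>{0..T}. Vnorm V (f t)) < \<infinity>" "(SUP t\<in>{0..T}. Vnorm V (time_deriv T f t)) < \<infinity>"
    using f unfolding dual_class_def by (auto simp: ennreal_add_less_top)
  have B1: "\<bar>f t y\<bar> \<le> B1 * (1 + V y)" if "t \<in> {0..T}" for t y
    unfolding B1_def by (rule Vnorm_SUP_bound[OF V_nonneg fin(1) that])
  have B2: "\<bar>time_deriv T f t y\<bar> \<le> B2 * (1 + V y)" if "t \<in> {0..T}" for t y
    unfolding B2_def by (rule Vnorm_SUP_bound[OF V_nonneg fin(2) that])
  have diff: "time_differentiable T f" and hjb: "solves_HJB q U c T f"
    using f by (auto simp: dual_class_def)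
  define \<phi> where "\<phi> t = (\<integral>x. f t x \<partial>measure_pmf p)" for t
  have deriv: "(\<phi> has_real_derivative (\<integral>x. time_deriv T f t x \<partial>measure_pmf p)) (at t within {0..T})"
    if t: "t \<in> {0..T}" for t
    unfolding \<phi>_def
    by (rule has_real_derivative_integral_dominated[where g="\<lambda>x. B2 * (1 + V x)"])
      (use t B1 B2 in \<open>auto intro!: time_deriv_works[OF diff] integrable_weighted[of _ B1] integrable_weight\<close>)
  have le: "(\<integral>x. time_deriv T f t x \<partial>measure_pmf p) \<le> gs" if t: "t \<in> {0..T}" for t
  proof -
    have "(\<integral>x. time_deriv T f t x \<partial>measure_pmf p) \<le> (\<integral>x. c x (us x) - gen q (us x) (f t) x \<partial>measure_pmf p)"
    proof (rule integral_mono)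
      show "integrable (measure_pmf p) (time_deriv T f t)" by (rule integrable_weighted[OF B2[OF t]])
      show "integrable (measure_pmf p) (\<lambda>x. c x (us x) - gen q (us x) (f t) x)"
        by (intro Bochner_Integration.integrable_diff integrable_cost integrable_gen_weighted[OF B1[OF t]])
      fix x
      show "time_deriv T f t x \<le> c x (us x) - gen q (us x) (f t) x"
        using gen_minus_cost_le_Ham[where c=c and u="us x" and x=x, OF us_in c_nonneg B1[OF t]]
          hjb[unfolded solves_HJB_def, rule_format, OF t, of x] by linarith
    qed
    also have "\<dots> = gs"
      using integrable_cost integrable_gen_weighted[OF B1[OF t]] stationary_weighted[OF B1[OF t]] mean_cost by simp
    finally show ?thesis .
  qed
  obtain s where s: "s \<in> {0<..<T}" "\<phi> T - \<phi> 0 = (\<integral>x. time_deriv T f s x \<partial>measure_pmf p) * (T - 0)"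
    using mvt_simple[OF T, of \<phi> "\<lambda>s. (*) (\<integral>x. time_deriv T f s x \<partial>measure_pmf p)"] deriv
    unfolding has_field_derivative_def by auto
  have "\<phi> T - \<phi> 0 \<le> gs * T"
    unfolding s(2) using le[of s] s(1) T by (simp add: mult_right_mono)
  moreover have "(\<integral>x. f T x - f 0 x \<partial>p) = \<phi> T - \<phi> 0"
    unfolding \<phi>_def using integrable_weighted[OF B1[of T]] integrable_weighted[OF B1[of 0]] T
    by (intro Bochner_Integration.integral_diff) auto
  ultimately show ?thesis by (simp add: mult.commute)
qed

lemma SUP_dual_value:
  assumes T: "0 < T"
  shows "(SUP f\<in>dual_class q U c V T. ereal (\<integral>x. f T x - f 0 x \<partial>p)) = ereal (T * gs)"
proof (rule antisym)
  show "(SUP f\<in>dual_class q U c V T. ereal (\<integral>x. f T x - f 0 x \<partial>p)) \<le> ereal (T * gs)"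
    using dual_value_le[OF T] by (intro SUP_least) auto
  show "ereal (T * gs) \<le> (SUP f\<in>dual_class q U c V T. ereal (\<integral>x. f T x - f 0 x \<partial>p))"
    by (rule SUP_upper2[OF poisson_in_dual_class[OF T]]) simp
qed

section \<open>The primal problem\<close>

abbreviation path_space :: "real \<Rightarrow> (real \<times> 's \<times> 'u) measure" where
  "path_space T \<equiv> restrict_space borel {0..T} \<Otimes>\<^sub>M borel \<Otimes>\<^sub>M restrict_space borel U"

lemma space_path_space: "space (path_space T) = {0..T} \<times> UNIV \<times> U"
  by (simp add: space_pair_measure space_restrict_space)

lemma measurable_path_state: "(\<lambda>w. fst (snd w)) \<in> path_space T \<rightarrow>\<^sub>M borel"
  by (rule measurable_compose[OF measurable_snd measurable_fst])

lemma measurable_path_control: "(\<lambda>w. snd (snd w)) \<in> path_space T \<rightarrow>\<^sub>M restrict_space borel U"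
  by (rule measurable_compose[OF measurable_snd measurable_snd])

lemma measurable_path_weight: "(\<lambda>(t, x, u). f x) \<in> borel_measurable (path_space T)" for f :: "'s \<Rightarrow> 'c::topological_space"
proof -
  have "f \<in> borel_measurable borel" by simp
  then show ?thesis unfolding case_prod_beta by measurable
qed

text \<open>The conditional law at each time in \<open>[0,T]\<close> is a probability measure, so the plan has the mass of its time marginal.\<close>

lemma primal_mass:
  assumes T: "0 < T" and feas: "primal_feasible q U V T \<nu> \<pi>"
  shows "emeasure \<pi> (space \<pi>) = ennreal T"
proof -
  have sets: "sets \<pi> = sets (path_space T)" using feas by (simp add: primal_feasible_def)
  then have space: "space \<pi> = {0..T} \<times> UNIV \<times> U"
    using sets_eq_imp_space_eq space_path_space by blast
  obtain r where r: "r \<in> restrict_space borel {0..T} \<rightarrow>\<^sub>M prob_algebra (borel \<Otimes>\<^sub>M restrict_space borel U)"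
    and em: "\<And>A. A \<in> sets \<pi> \<Longrightarrow> emeasure \<pi> A = (\<integral>\<^sup>+t\<in>{0..T}. emeasure (r t) (Pair t -` A) \<partial>lborel)"
    using feas unfolding primal_feasible_def by blast
  have "emeasure \<pi> (space \<pi>) = (\<integral>\<^sup>+t. indicator {0..T} t \<partial>lborel)"
    unfolding em[OF sets.top]
  proof (intro nn_integral_cong)
    fix t
    show "emeasure (r t) (Pair t -` space \<pi>) * indicator {0..T} t = indicator {0..T} t"
    proof (cases "t \<in> {0..T}")
      case True
      then have "r t \<in> space (prob_algebra (borel \<Otimes>\<^sub>M restrict_space borel U))"
        using measurable_space[OF r] by (simp add: space_restrict_space)
      then have r_t: "prob_space (r t)" "sets (r t) = sets (borel \<Otimes>\<^sub>M restrict_space borel U)"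
        by (auto simp: space_prob_algebra)
      have "Pair t -` space \<pi> = space (r t)"
        using True unfolding space sets_eq_imp_space_eq[OF r_t(2)]
        by (auto simp: space_pair_measure space_restrict_space)
      with r_t(1) True show ?thesis by (simp add: prob_space.emeasure_space_1)
    qed simp
  qed
  then show ?thesis using T by simp
qed

text \<open>Integrate \<open>gs + G\<^sup>u h \<le> c\<close> against the plan.  For a bounded function that is constant in time, both the
time derivative and the boundary term of the balance constraint vanish, so the generator has mean 0; by
truncation the same holds for \<open>h\<close>.\<close>

lemma cost_ge_if_primal_feasible:
  assumes T: "0 < T" and feas: "primal_feasible q U V T \<nu> \<pi>"
  shows "ennreal (T * gs) \<le> (\<integral>\<^sup>+(t, x, u). ennreal (c x u) \<partial>\<pi>)"
proof -
  have sets: "sets \<pi> = sets (path_space T)" using feas by (simp add: primal_feasible_def)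
  then have space: "space \<pi> = {0..T} \<times> UNIV \<times> U"
    using sets_eq_imp_space_eq space_path_space by blast
  note meas_cong = measurable_cong_sets[OF sets refl]
  have mass: "emeasure \<pi> (space \<pi>) = ennreal T" by (rule primal_mass[OF T feas])
  interpret finite_measure \<pi> by (rule finite_measureI) (simp add: mass)
  have total: "measure \<pi> (space \<pi>) = T" using mass T by (simp add: measure_def)
  have test: "(\<integral>x. f T x - f 0 x \<partial>\<nu>) = (\<integral>w. time_deriv T f (fst w) (fst (snd w)) + gen q (snd (snd w)) (f (fst w)) (fst (snd w)) \<partial>\<pi>)"
    if "f \<in> test_functions T" for f
  proof -
    have "(LINT x|\<nu>. f T x - f 0 x) = (LINT (t, x, u)|\<pi>. time_deriv T f t x + gen q u (f t) x)"
      using feas that unfolding primal_feasible_def by blast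
    then show ?thesis unfolding case_prod_beta .
  qed
  have weight: "integrable \<pi> (\<lambda>w. 1 + V (fst (snd w)))"
  proof (rule integrableI_nonneg)
    show "(\<integral>\<^sup>+w. ennreal (1 + V (fst (snd w))) \<partial>\<pi>) < \<infinity>"
    proof -
      have "(\<integral>\<^sup>+(t, x, u). ennreal (1 + V x) \<partial>\<pi>) < \<infinity>"
        using feas unfolding primal_feasible_def by blast
      then show ?thesis unfolding case_prod_beta .
    qed
    show "(\<lambda>w. 1 + V (fst (snd w))) \<in> borel_measurable \<pi>"
    proof -
      have "(\<lambda>(t :: real, x, u :: 'u). 1 + V x) \<in> borel_measurable \<pi>"
        unfolding meas_cong by (rule measurable_path_weight)
      then show ?thesis unfolding case_prod_beta .
    qed
  qed (simp add: V_nonneg)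
  have bdd: "(\<integral>w. gen q (snd (snd w)) f (fst (snd w)) \<partial>\<pi>) = 0" if D: "\<And>x. \<bar>f x\<bar> \<le> D" for f D
  proof -
    have td: "time_deriv T (\<lambda>_. f) t x = 0" if "t \<in> {0..T}" for t x
      using T that by (intro time_deriv_eqI) auto
    have uc: "bdd_unif_cont T g" if "\<And>t x. t \<in> {0..T} \<Longrightarrow> g t x = g0 x" "\<And>x. \<bar>g0 x\<bar> \<le> C" for g g0 C
      unfolding bdd_unif_cont_def
    proof (intro conjI allI impI)
      show "\<exists>B. \<forall>t\<in>{0..T}. \<forall>x. \<bar>g t x\<bar> \<le> B" using that by auto
      fix e :: real assume "0 < e"
      then show "\<exists>d>0. \<forall>s\<in>{0..T}. \<forall>t\<in>{0..T}. \<bar>s - t\<bar> < d \<longrightarrow> (\<forall>x. \<bar>g s x - g t x\<bar> < e)"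
        using that by (intro exI[of _ 1]) auto
    qed
    have "(\<lambda>_. f) \<in> test_functions T"
      using uc[of "\<lambda>_. f" f D] uc[of "time_deriv T (\<lambda>_. f)" "\<lambda>_. 0" 0] D
      by (auto simp: td test_functions_def time_differentiable_def)
    from test[OF this] have "0 = (\<integral>w. time_deriv T (\<lambda>_. f) (fst w) (fst (snd w)) + gen q (snd (snd w)) f (fst (snd w)) \<partial>\<pi>)"
      by simp
    also have "\<dots> = (\<integral>w. gen q (snd (snd w)) f (fst (snd w)) \<partial>\<pi>)"
      by (rule Bochner_Integration.integral_cong) (auto simp: space td)
    finally show ?thesis by simp
  qed
  have gen_meas: "(\<lambda>w. gen q (snd (snd w)) f (fst (snd w))) \<in> borel_measurable \<pi>"
    if "\<And>y. \<bar>f y\<bar> \<le> D * (1 + V y)" for f D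
    unfolding meas_cong using that
    by (intro measurable_gen[OF _ _ measurable_path_control measurable_path_state]) auto
  have gen_0: "(\<integral>w. gen q (snd (snd w)) h (fst (snd w)) \<partial>\<pi>) = 0"
    "integrable \<pi> (\<lambda>w. gen q (snd (snd w)) h (fst (snd w)))"
    by (rule integral_gen_weighted_eq_0[where u="\<lambda>w. snd (snd w)" and X="\<lambda>w. fst (snd w)" and B=B];
      (fact bdd | fact gen_meas | fact weight | fact h_bound | simp add: space mem_Times_iff))+
  \<comment> \<open>\<open>k\<close> may be negative, hence the passage to \<open>max 0 (k w)\<close> before comparing with the nonnegative cost\<close>
  define k where "k w = gs + gen q (snd (snd w)) h (fst (snd w))" for w :: "real \<times> 's \<times> 'u"
  have k: "integrable \<pi> k" "(\<integral>w. k w \<partial>\<pi>) = T * gs"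
    unfolding k_def using gen_0 by (auto simp: total)
  have "T * gs \<le> (\<integral>w. max 0 (k w) \<partial>\<pi>)"
    unfolding k(2)[symmetric] using k(1) by (intro integral_mono) auto
  then have "ennreal (T * gs) \<le> ennreal (\<integral>w. max 0 (k w) \<partial>\<pi>)" by (rule ennreal_leI)
  also have "\<dots> = (\<integral>\<^sup>+w. ennreal (max 0 (k w)) \<partial>\<pi>)"
    using k(1) by (intro nn_integral_eq_integral[symmetric]) auto
  also have "\<dots> \<le> (\<integral>\<^sup>+(t, x, u). ennreal (c x u) \<partial>\<pi>)"
    using poisson_inequality c_nonneg
    by (intro nn_integral_mono) (auto simp: space k_def intro!: ennreal_leI)
  finally show ?thesis .
qed

lemma primal_value_ge:
  assumes T: "0 < T"
  shows "ereal (T * gs) \<le> primal_value q U c V T \<nu>"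
  unfolding primal_value_def
proof (intro INF_greatest)
  fix \<pi> assume "\<pi> \<in> {\<pi>. primal_feasible q U V T \<nu> \<pi>}"
  then have "ennreal (T * gs) \<le> (\<integral>\<^sup>+(t, x, u). ennreal (c x u) \<partial>\<pi>)"
    using cost_ge_if_primal_feasible[OF T] by simp
  then have "enn2ereal (ennreal (T * gs)) \<le> enn2ereal (\<integral>\<^sup>+(t, x, u). ennreal (c x u) \<partial>\<pi>)"
    by (simp add: less_eq_ennreal.rep_eq)
  then show "ereal (T * gs) \<le> enn2ereal (\<integral>\<^sup>+(t, x, u). ennreal (c x u) \<partial>\<pi>)"
    using T gs_nonneg by (simp add: enn2ereal_ennreal)
qed

text \<open>Uniform in time, the state at each time distributed as \<open>p\<close>, and the control \<open>us\<close>.\<close>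

definition stationary_plan :: "real \<Rightarrow> (real \<times> 's \<times> 'u) measure" where
  "stationary_plan T = distr (restrict_space lborel {0..T} \<Otimes>\<^sub>M measure_pmf p) (path_space T) (\<lambda>(t, x). (t, x, us x))"

lemma measurable_state_control:
  "(\<lambda>x. (x, us x)) \<in> measure_pmf p \<rightarrow>\<^sub>M borel \<Otimes>\<^sub>M restrict_space borel U"
  by (auto simp: space_pair_measure space_restrict_space us_in)

lemma measurable_plan_map:
  "(\<lambda>(t, x). (t, x, us x)) \<in> restrict_space lborel {0..T} \<Otimes>\<^sub>M measure_pmf p \<rightarrow>\<^sub>M path_space T"
proof -
  have "(\<lambda>t. t) \<in> restrict_space lborel {0..T} \<rightarrow>\<^sub>M restrict_space borel {0..T}"
    by (intro measurable_ident_sets sets_restrict_space_cong) simp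
  then have 1: "fst \<in> restrict_space lborel {0..T} \<Otimes>\<^sub>M measure_pmf p \<rightarrow>\<^sub>M restrict_space borel {0..T}"
    by (rule measurable_compose[OF measurable_fst])
  have 2: "(\<lambda>w. (snd w, us (snd w))) \<in> restrict_space lborel {0..T} \<Otimes>\<^sub>M measure_pmf p \<rightarrow>\<^sub>M borel \<Otimes>\<^sub>M restrict_space borel U"
    by (rule measurable_compose[OF measurable_snd measurable_state_control])
  show ?thesis
    using measurable_Pair[OF 1 2] unfolding case_prod_beta .
qed

lemma nn_integral_stationary_plan:
  assumes F: "F \<in> borel_measurable (path_space T)"
  shows "(\<integral>\<^sup>+w. F w \<partial>stationary_plan T) = (\<integral>\<^sup>+t\<in>{0..T}. \<integral>\<^sup>+x. F (t, x, us x) \<partial>p \<partial>lborel)"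
proof -
  have "(\<integral>\<^sup>+w. F w \<partial>stationary_plan T) =
      (\<integral>\<^sup>+w. F (case w of (t, x) \<Rightarrow> (t, x, us x)) \<partial>(restrict_space lborel {0..T} \<Otimes>\<^sub>M measure_pmf p))"
    unfolding stationary_plan_def by (rule nn_integral_distr[OF measurable_plan_map]) (simp add: F)
  also have "\<dots> = (\<integral>\<^sup>+t. \<integral>\<^sup>+x. F (t, x, us x) \<partial>p \<partial>restrict_space lborel {0..T})"
    by (subst measure_pmf.nn_integral_fst[symmetric])
      (auto intro: measurable_compose[OF measurable_plan_map F])
  also have "\<dots> = (\<integral>\<^sup>+t\<in>{0..T}. \<integral>\<^sup>+x. F (t, x, us x) \<partial>p \<partial>lborel)"
    by (rule nn_integral_restrict_space) simp
  finally show ?thesis .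
qed

text \<open>By Fubini's theorem the integral against the plan is \<open>\<integral> \<psi>(t) dt\<close> over \<open>[0,T]\<close>, where \<open>\<psi>(t)\<close> is the
\<open>p\<close>-mean of \<open>\<partial>\<^sub>t f + G f\<close>.  Stationarity removes the generator, and what remains is the derivative of the mean
\<open>\<phi>(t)\<close> of \<open>f t\<close>.  The gauge integral is used for the fundamental theorem because it asks for no continuity of
\<open>\<psi>\<close>.\<close>

lemma stationary_plan_test_function:
  assumes T: "0 < T" and f: "f \<in> test_functions T"
  shows "(\<integral>x. f T x - f 0 x \<partial>p) =
    (LINT (t, x, u)|stationary_plan T. time_deriv T f t x + gen q u (f t) x)"
proof -
  have diff: "time_differentiable T f" and bu: "bdd_unif_cont T f" "bdd_unif_cont T (time_deriv T f)"
    using f by (simp_all add: test_functions_def)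
  from bu(1)[unfolded bdd_unif_cont_def, THEN conjunct1] obtain D1
    where "\<forall>t\<in>{0..T}. \<forall>x. \<bar>f t x\<bar> \<le> D1" ..
  then have D1: "\<bar>f t x\<bar> \<le> D1" if "t \<in> {0..T}" for t x using that by simp
  from bu(2)[unfolded bdd_unif_cont_def, THEN conjunct1] obtain D2
    where "\<forall>t\<in>{0..T}. \<forall>x. \<bar>time_deriv T f t x\<bar> \<le> D2" ..
  then have D2: "\<bar>time_deriv T f t x\<bar> \<le> D2" if "t \<in> {0..T}" for t x using that by simp
  have T0: "0 \<in> {0..T}" "T \<in> {0..T}" using T by auto
  have nonneg: "0 \<le> D1" "0 \<le> D2"
    using order_trans[OF abs_ge_zero D1[OF T0(1)]] order_trans[OF abs_ge_zero D2[OF T0(1)]] by auto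
  let ?S = "restrict_space lborel {0..T}"
  define G where "G t x = time_deriv T f t x + gen q (us x) (f t) x" for t x
  have uc: "continuous_on {0..T} (\<lambda>t. g t x)" if "bdd_unif_cont T g" for g :: "real \<Rightarrow> 's \<Rightarrow> real" and x
    unfolding continuous_on_iff
  proof (intro ballI allI impI)
    fix t e :: real assume t: "t \<in> {0..T}" and "0 < e"
    from that[unfolded bdd_unif_cont_def, THEN conjunct2, rule_format, OF \<open>0 < e\<close>]
    obtain d where "0 < d" "\<forall>s\<in>{0..T}. \<forall>t\<in>{0..T}. \<bar>s - t\<bar> < d \<longrightarrow> (\<forall>x. \<bar>g s x - g t x\<bar> < e)"
      by auto
    with t show "\<exists>d>0. \<forall>s\<in>{0..T}. dist s t < d \<longrightarrow> dist (g s x) (g t x) < e"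
      by (intro exI[of _ d]) (auto simp: dist_real_def)
  qed
  have f_meas: "(\<lambda>t. f t x) \<in> borel_measurable (restrict_space borel {0..T})"
    "(\<lambda>t. time_deriv T f t x) \<in> borel_measurable (restrict_space borel {0..T})" for x
    by (rule borel_measurable_continuous_on_restrict[OF uc[OF bu(1)]],
        rule borel_measurable_continuous_on_restrict[OF uc[OF bu(2)]])
  have F_meas: "(\<lambda>(t, x, u). time_deriv T f t x + gen q u (f t) x) \<in> borel_measurable (path_space T)"
    unfolding case_prod_beta
  proof (rule borel_measurable_add)
    have "(\<lambda>w. fst (snd w)) \<in> path_space T \<rightarrow>\<^sub>M count_space UNIV"
      by (rule measurable_path_state[unfolded measurable_into_discrete_borel])
    then show "(\<lambda>w. time_deriv T f (fst w) (fst (snd w))) \<in> borel_measurable (path_space T)"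
      by (rule measurable_compose_countable[rotated, where f="\<lambda>x w. time_deriv T f (fst w) x"])
        (rule measurable_compose[OF measurable_fst f_meas(2)])
    show "(\<lambda>w. gen q (snd (snd w)) (f (fst w)) (fst (snd w))) \<in> borel_measurable (path_space T)"
    proof (rule measurable_gen[OF _ _ measurable_path_control measurable_path_state, where B=D1])
      show "(\<lambda>w. f (fst w) y) \<in> borel_measurable (path_space T)" for y
        by (rule measurable_compose[OF measurable_fst f_meas(1)])
      show "\<bar>f (fst w) y\<bar> \<le> D1 * (1 + V y)" if "w \<in> space (path_space T)" for w y
      proof -
        have "\<bar>f (fst w) y\<bar> \<le> D1" using that D1 by (auto simp: space_path_space)
        also have "\<dots> \<le> D1 * (1 + V y)" using nonneg V_nonneg[of y] by (simp add: distrib_left)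
        finally show ?thesis .
      qed
    qed
  qed
  have G_pair: "(\<lambda>(t, x). G t x) \<in> borel_measurable (?S \<Otimes>\<^sub>M measure_pmf p)"
    using measurable_compose[OF measurable_plan_map F_meas] by (simp add: case_prod_beta G_def)
  have G_bound: "\<bar>G t x\<bar> \<le> D2 + \<Lambda> * (2 * D1)" if t: "t \<in> {0..T}" for t x
  proof -
    have int: "integrable (controlled_rates q us x) (f t)"
      using D1[OF t] by (rule R.integrable_Q_bounded)
    have "\<bar>\<integral>y. f t y \<partial>R.jump_pmf x\<bar> \<le> D1"
      using D1[OF t] R.integrable_jump_pmf[OF int]
      by (intro integral_abs_bound[THEN order_trans] measure_pmf.integral_le_const) auto
    then have "\<bar>(\<integral>y. f t y \<partial>R.jump_pmf x) - f t x\<bar> \<le> 2 * D1"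
      using D1[OF t, of x] by linarith
    then have "\<bar>R.generator (f t) x\<bar> \<le> \<Lambda> * (2 * D1)"
      unfolding R.generator_eq[OF int] abs_mult
      using R.rate_pos[of x] R.rate_le'[of x] by (intro mult_mono) auto
    then show ?thesis
      unfolding G_def generator_us[symmetric] using D2[OF t, of x] by linarith
  qed
  interpret S: finite_measure ?S
    by (rule finite_measureI) (use T in \<open>simp add: emeasure_restrict_space space_restrict_space\<close>)
  interpret P: pair_sigma_finite ?S "measure_pmf p" ..
  have finite: "finite_measure (?S \<Otimes>\<^sub>M measure_pmf p)"
    by (rule finite_measure_pair_measure[OF measure_pmf.finite_measure_axioms S.finite_measure_axioms])
  have G_int: "integrable (?S \<Otimes>\<^sub>M measure_pmf p) (\<lambda>(t, x). G t x)"
    using G_bound by (intro finite_measure.integrable_const_bound[OF finite _ G_pair, where B="D2 + \<Lambda> * (2 * D1)"])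
      (auto simp: space_pair_measure space_restrict_space)
  define \<phi> where "\<phi> t = (\<integral>x. f t x \<partial>measure_pmf p)" for t
  define \<psi> where "\<psi> t = (\<integral>x. G t x \<partial>measure_pmf p)" for t
  have int_bdd: "integrable (measure_pmf p) g" if "\<And>x. \<bar>g x\<bar> \<le> D" for g :: "'s \<Rightarrow> real" and D
    using that by (intro measure_pmf.integrable_const_bound[where B=D]) auto
  have \<psi>: "\<psi> t = (\<integral>x. time_deriv T f t x \<partial>measure_pmf p)" if t: "t \<in> {0..T}" for t
  proof -
    have wb: "\<bar>f t y\<bar> \<le> D1 * (1 + V y)" for y
      using D1[OF t, of y] nonneg V_nonneg[of y] mult_nonneg_nonneg[of D1 "V y"]
      unfolding distrib_left by linarith
    show ?thesis
      unfolding \<psi>_def G_def using int_bdd[of "time_deriv T f t", OF D2[OF t]]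
        integrable_gen_weighted[OF wb] stationary_weighted[OF wb] by simp
  qed
  have "((\<lambda>t. \<psi> t) has_integral \<phi> T - \<phi> 0) {0..T}"
  proof (rule fundamental_theorem_of_calculus)
    fix t assume t: "t \<in> {0..T}"
    have "(\<phi> has_real_derivative (\<integral>x. time_deriv T f t x \<partial>measure_pmf p)) (at t within {0..T})"
      unfolding \<phi>_def
      by (rule has_real_derivative_integral_dominated[where g="\<lambda>_. D2"])
        (use t D1 D2 in \<open>auto intro!: time_deriv_works[OF diff] int_bdd[of _ D1]\<close>)
    then show "(\<phi> has_vector_derivative \<psi> t) (at t within {0..T})"
      unfolding \<psi>[OF t] has_real_derivative_iff_has_vector_derivative .
  qed (use T in simp)
  then have "integral {0..T} \<psi> = \<phi> T - \<phi> 0" by (rule integral_unique)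
  moreover have "integrable ?S \<psi>"
    unfolding \<psi>_def using P.integrable_fst'[OF G_int] by simp
  then have "set_integrable lborel {0..T} \<psi>"
    unfolding set_integrable_def by (subst (asm) integrable_restrict_space) auto
  then have "(\<integral>t. \<psi> t \<partial>?S) = integral {0..T} \<psi>"
    using set_borel_integral_eq_integral(2)[of "{0..T}" \<psi>]
    by (simp add: integral_restrict_space set_lebesgue_integral_def)
  moreover have "(\<integral>t. \<psi> t \<partial>?S) = (\<integral>(t, x). G t x \<partial>(?S \<Otimes>\<^sub>M measure_pmf p))"
    unfolding \<psi>_def using P.integral_fst'[OF G_int] by simp
  moreover have "(LINT (t, x, u)|stationary_plan T. time_deriv T f t x + gen q u (f t) x) =
      (\<integral>(t, x). G t x \<partial>(?S \<Otimes>\<^sub>M measure_pmf p))"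
    unfolding stationary_plan_def
    by (subst integral_distr[OF measurable_plan_map F_meas])
      (auto intro!: Bochner_Integration.integral_cong simp: G_def)
  moreover have "(\<integral>x. f T x - f 0 x \<partial>p) = \<phi> T - \<phi> 0"
    unfolding \<phi>_def using int_bdd[of "f 0", OF D1[OF T0(1)]] int_bdd[of "f T", OF D1[OF T0(2)]] by simp
  ultimately show ?thesis by simp
qed

lemma stationary_plan_feasible:
  assumes T: "0 < T"
  shows "primal_feasible q U V T (measure_pmf p) (stationary_plan T)"
proof -
  define P where "P = distr (measure_pmf p) (borel \<Otimes>\<^sub>M restrict_space borel U) (\<lambda>x. (x, us x))"
  have sets: "sets (stationary_plan T) = sets (path_space T)"
    by (simp add: stationary_plan_def)
  have p_prob: "measure_pmf p \<in> space (prob_algebra borel)"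
    by (auto simp: space_prob_algebra sets_borel_discrete intro: measure_pmf.prob_space_axioms)
  have P_prob: "P \<in> space (prob_algebra (borel \<Otimes>\<^sub>M restrict_space borel U))"
    unfolding P_def
    by (auto simp: space_prob_algebra intro!: measure_pmf.prob_space_distr measurable_state_control)
  have disint: "emeasure (stationary_plan T) A = (\<integral>\<^sup>+t\<in>{0..T}. emeasure P (Pair t -` A) \<partial>lborel)"
    if A: "A \<in> sets (stationary_plan T)" for A
  proof -
    have "emeasure (stationary_plan T) A = (\<integral>\<^sup>+w. indicator A w \<partial>stationary_plan T)"
      using A by simp
    also have "\<dots> = (\<integral>\<^sup>+t\<in>{0..T}. \<integral>\<^sup>+x. indicator A (t, x, us x) \<partial>p \<partial>lborel)"
      using A by (intro nn_integral_stationary_plan) (auto simp: sets)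
    also have "\<dots> = (\<integral>\<^sup>+t\<in>{0..T}. emeasure P (Pair t -` A) \<partial>lborel)"
    proof (intro nn_integral_cong)
      fix t
      show "(\<integral>\<^sup>+x. indicator A (t, x, us x) \<partial>p) * indicator {0..T} t = emeasure P (Pair t -` A) * indicator {0..T} t"
      proof (cases "t \<in> {0..T}")
        case True
        then have "Pair t -` A \<in> sets (borel \<Otimes>\<^sub>M restrict_space borel U)"
          using A unfolding sets by (intro sets_Pair1) 
        then have "emeasure P (Pair t -` A) = emeasure p ((\<lambda>x. (x, us x)) -` (Pair t -` A))"
          unfolding P_def by (subst emeasure_distr[OF measurable_state_control]) auto
        also have "\<dots> = (\<integral>\<^sup>+x. indicator ((\<lambda>x. (x, us x)) -` (Pair t -` A)) x \<partial>p)" by simp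
        also have "\<dots> = (\<integral>\<^sup>+x. indicator A (t, x, us x) \<partial>p)"
          by (intro nn_integral_cong) (simp add: indicator_def)
        finally show ?thesis by simp
      qed simp
    qed
    finally show ?thesis .
  qed
  have marginal: "distr P borel fst = measure_pmf p"
  proof (rule measure_eqI)
    fix A assume "A \<in> sets (distr P borel fst)"
    have "distr P borel fst = distr (measure_pmf p) borel (\<lambda>x. x)"
      unfolding P_def by (subst distr_distr[OF _ measurable_state_control]) (auto simp: o_def)
    then show "emeasure (distr P borel fst) A = emeasure p A"
      by (simp add: emeasure_distr sets_borel_discrete)
  qed (simp add: sets_borel_discrete)
  have "(\<integral>\<^sup>+(t, x, u). ennreal (1 + V x) \<partial>stationary_plan T) = (\<integral>\<^sup>+t\<in>{0..T}. \<integral>\<^sup>+x. ennreal (1 + V x) \<partial>p \<partial>lborel)"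
    by (subst nn_integral_stationary_plan[OF measurable_path_weight]) simp
  also have "\<dots> = (\<integral>\<^sup>+x. ennreal (1 + V x) \<partial>p) * ennreal T"
    using T by (simp add: nn_integral_cmult_indicator)
  also have "\<dots> < \<infinity>"
    using V_integrable V_nonneg by (simp add: nn_integral_add ennreal_mult_less_top)
  finally have weight: "(\<integral>\<^sup>+(t, x, u). ennreal (1 + V x) \<partial>stationary_plan T) < \<infinity>" .
  show ?thesis
    unfolding primal_feasible_def
  proof (intro conjI exI[of _ "\<lambda>_. P"] exI[of _ "\<lambda>_. measure_pmf p"] ballI allI impI)
    show "(\<lambda>_. P) \<in> restrict_space borel {0..T} \<rightarrow>\<^sub>M prob_algebra (borel \<Otimes>\<^sub>M restrict_space borel U)"
      using P_prob by (rule measurable_const)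
    show "AE t in lborel. t \<in> {0..T} \<longrightarrow> distr P borel fst = measure_pmf p"
      by (simp add: marginal)
  qed (use sets disint p_prob weight stationary_plan_test_function[OF T] in auto)
qed

lemma cost_stationary_plan:
  assumes T: "0 < T"
  shows "(\<integral>\<^sup>+(t, x, u). ennreal (c x u) \<partial>stationary_plan T) = ennreal (T * gs)"
proof -
  have "(\<lambda>(x, u). ennreal (c x u)) \<in> borel_measurable (count_space UNIV \<Otimes>\<^sub>M restrict_space borel U)"
    by (rule measurable_pair_measure_countable1)
      (auto intro: measurable_compose[OF lsc_on_borel_measurable[OF c_lsc U_borel]])
  also have "borel_measurable (count_space UNIV \<Otimes>\<^sub>M restrict_space borel U) =
      borel_measurable ((borel :: 's measure) \<Otimes>\<^sub>M restrict_space borel U)"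
    by (intro measurable_cong_sets sets_pair_measure_cong) (auto simp: sets_borel_discrete)
  finally have "(\<lambda>(x, u). ennreal (c x u)) \<in> borel_measurable ((borel :: 's measure) \<Otimes>\<^sub>M restrict_space borel U)" .
  from measurable_compose[OF measurable_snd this]
  have meas: "(\<lambda>(t, x, u). ennreal (c x u)) \<in> borel_measurable (path_space T)"
    unfolding case_prod_beta .
  have "(\<integral>\<^sup>+(t, x, u). ennreal (c x u) \<partial>stationary_plan T) = (\<integral>\<^sup>+t\<in>{0..T}. \<integral>\<^sup>+x. ennreal (c x (us x)) \<partial>p \<partial>lborel)"
    by (subst nn_integral_stationary_plan[OF meas]) simp
  also have "\<dots> = (\<integral>\<^sup>+t\<in>{0..T}. ennreal gs \<partial>lborel)"
    using integrable_cost mean_cost by (simp add: nn_integral_eq_integral c_nonneg us_in)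
  also have "\<dots> = ennreal (T * gs)"
    using T gs_nonneg by (simp add: nn_integral_cmult_indicator ennreal_mult mult.commute)
  finally show ?thesis .
qed

lemma primal_value_stationary:
  assumes T: "0 < T"
  shows "primal_value q U c V T (measure_pmf p) = ereal (T * gs)"
proof (rule antisym[OF _ primal_value_ge[OF T]])
  have "primal_value q U c V T (measure_pmf p) \<le> enn2ereal (\<integral>\<^sup>+(t, x, u). ennreal (c x u) \<partial>stationary_plan T)"
    unfolding primal_value_def by (rule INF_lower) (simp add: stationary_plan_feasible[OF T])
  then show "primal_value q U c V T (measure_pmf p) \<le> ereal (T * gs)"
    using T gs_nonneg by (simp add: cost_stationary_plan[OF T] enn2ereal_ennreal)
qed

end

section \<open>Ergodic control and finite-horizon duality\<close>

theorem theorem3p4: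
  fixes q :: "'s::{countable,discrete_topology} \<Rightarrow> 'u::euclidean_space \<Rightarrow> 's measure"
    and U :: "'u set" and c :: "'s \<Rightarrow> 'u \<Rightarrow> real"
    and V W :: "'s \<Rightarrow> real" and C :: "'s set" and b \<kappa> :: real
    and Adm :: "('s \<Rightarrow> 'u) set"
    and h :: "'s \<Rightarrow> real" and gs :: real and us :: "'s \<Rightarrow> 'u"
  assumes U_compact: "compact U"
    and q_kernel: "jump_rate_kernel U q"
    and V_nonneg: "\<And>x. 0 \<le> V x"
    and V_sublevel: "\<And>r. compact (closure {x. V x \<le> r})"
    and W_ge_1: "\<And>x. 1 \<le> W x"
    and C_compact: "compact C"
    and Adm_controls: "\<And>\<mu> x. \<mu> \<in> Adm \<Longrightarrow> \<mu> x \<in> U"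
    and Adm_irreducible: "\<And>\<mu>. \<mu> \<in> Adm \<Longrightarrow> irreducible_process (controlled_rates q \<mu>)"
    and Adm_drift: "\<And>\<mu> x. \<mu> \<in> Adm \<Longrightarrow> gen q (\<mu> x) V x \<le> - W x + b * indicator C x"
    and c_bounds: "\<And>x u. u \<in> U \<Longrightarrow> 0 \<le> c x u \<and> c x u \<le> W x"
    \<comment> \<open>(1)\<close>
    and c_lsc: "\<And>x. lsc_on U (c x)"
    and c_convex: "\<And>x. convex_on U (c x)"
    \<comment> \<open>(2)\<close>
    and U_convex: "convex U"
    and gen_affine: "\<And>f x. f \<in> core \<Longrightarrow> affine_fun_on U (\<lambda>u. gen q u f x)"
    \<comment> \<open>(3)\<close>
    and q_bounded: "(SUP x. SUP u\<in>U. emeasure (q x u) UNIV) < \<infinity>"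
    and q_V: "\<And>x. (SUP u\<in>U. \<integral>\<^sup>+y. ennreal (1 + V y) \<partial>q x u) \<le> ennreal (\<kappa> * (1 + V x))"
    \<comment> \<open>(4)\<close>
    and h_Vnorm: "Vnorm V h < \<infinity>"
    and us_argmax: "\<And>x. is_arg_max (\<lambda>u. gen q u h x - c x u) (\<lambda>u. u \<in> U) (us x)"
    and poisson: "\<And>x. gs + gen q (us x) h x = c x (us x)"
    \<comment> \<open>(5)\<close>
    and c_inf_sublevel: "\<And>r. compact (closure {x. (INF u\<in>U. c x u) \<le> r})"
    and c_locally_bounded:
      "\<And>K. compact K \<Longrightarrow> K \<subseteq> UNIV \<times> U \<Longrightarrow> bounded ((\<lambda>(x, u). c x u) ` K)"
    and h_bounded_below: "\<exists>m. \<forall>x. m \<le> - h x"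
    and h_sublevel: "\<And>r. compact (closure {x. - h x \<le> r})"
    and us_irreducible: "irreducible_process (controlled_rates q us)"
  shows "positive_harris_recurrent (controlled_rates q us) \<and>
    (\<exists>\<pi>s. invariant_prob (controlled_rates q us) \<pi>s \<and>
       (\<forall>\<pi>. invariant_prob (controlled_rates q us) \<pi> \<longrightarrow> \<pi> = \<pi>s) \<and>
       (\<forall>f\<in>core. (LINT x|\<pi>s. gen q (us x) f x) = 0) \<and>
       ((\<integral>\<^sup>+x. ennreal (V x) \<partial>\<pi>s) < \<infinity> \<longrightarrow>
         (\<forall>T>0. let fs = (\<lambda>t x. h x + (t - T) * gs) in
           \<comment> \<open>(i)\<close>
           solves_HJB q U c T fs \<and> fs \<in> dual_class q U c V T \<and>
           \<comment> \<open>(ii)\<close>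
           (LINT x|\<pi>s. fs T x - fs 0 x) = T * gs \<and>
           (SUP f\<in>dual_class q U c V T. ereal (LINT x|\<pi>s. f T x - f 0 x)) = ereal (T * gs) \<and>
           \<comment> \<open>(iii)\<close>
           (\<forall>\<nu>\<in>space (prob_algebra borel). ereal (T * gs) \<le> primal_value q U c V T \<nu>) \<and>
           (INF \<nu>\<in>space (prob_algebra borel). primal_value q U c V T \<nu>) = ereal (T * gs) \<and>
           primal_value q U c V T \<pi>s = ereal (T * gs))))"
proof -
  have us_in: "us x \<in> U" for x using us_argmax[of x] by (simp add: is_arg_max_def)
  define M where "M = (SUP x. SUP u\<in>U. emeasure (q x u) UNIV)"
  \<comment> \<open>\<open>max 1\<close> provides the rate 1 that absorbing states receive\<close>
  define \<Lambda> where "\<Lambda> = max 1 (enn2real M)"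
  have finite_q: "finite_measure (q x u)" if "u \<in> U" for x u
    using q_kernel that by (simp add: jump_rate_kernel_def)
  have rate: "measure (q x u) UNIV \<le> \<Lambda>" if u: "u \<in> U" for x u
  proof -
    have "emeasure (q x u) UNIV \<le> M"
      unfolding M_def using u by (intro SUP_upper2[of x] SUP_upper) auto
    then have "measure (q x u) UNIV \<le> enn2real M"
      unfolding measure_def using q_bounded by (intro enn2real_mono) (auto simp: M_def)
    then show ?thesis by (simp add: \<Lambda>_def)
  qed
  interpret weighted_jump_control q U V \<Lambda> "max 0 \<kappa>"
  proof
    fix x u assume u: "u \<in> U"
    have "(\<integral>\<^sup>+y. ennreal (1 + V y) \<partial>q x u) \<le> ennreal (\<kappa> * (1 + V x))"
      by (rule order_trans[OF SUP_upper[OF u] q_V])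
    also have "\<dots> \<le> ennreal (max 0 \<kappa> * (1 + V x))"
      using V_nonneg[of x] by (intro ennreal_leI mult_right_mono) auto
    finally show "(\<integral>\<^sup>+y. ennreal (1 + V y) \<partial>q x u) \<le> ennreal (max 0 \<kappa> * (1 + V x))" .
  qed (use q_kernel V_nonneg rate in \<open>auto simp: \<Lambda>_def\<close>)
  let ?Q = "controlled_rates q us"
  interpret R: bounded_jump_rates ?Q \<Lambda> by (rule bounded_jump_rates_control) (rule us_in)
  define B where "B = enn2real (Vnorm V h)"
  have h_bound: "\<bar>h y\<bar> \<le> B * (1 + V y)" for y
    unfolding B_def by (rule Vnorm_bound[OF V_nonneg h_Vnorm])
  obtain m where m: "\<And>x. m \<le> - h x" using h_bounded_below by auto
  \<comment> \<open>the Lyapunov function; dividing the cost by \<open>\<Lambda>\<close> matches the step of the uniformised chain\<close>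
  define w where "w x = - h x - m" for x
  define cs where "cs x = c x (us x) / \<Lambda>" for x
  have w_nonneg: "0 \<le> w x" for x using m[of x] by (simp add: w_def)
  have w_int: "integrable (?Q x) w" for x
  proof -
    interpret finite_measure "?Q x" by (rule R.finite_Q)
    have "integrable (?Q x) h"
      unfolding controlled_rates_def by (rule weighted_integrable[OF us_in h_bound])
    then show ?thesis by (simp add: w_def[abs_def])
  qed
  have gen_w: "R.generator w x = gs - c x (us x)" for x
  proof -
    have "R.generator w x = - gen q (us x) h x"
      unfolding R.generator_def gen_def controlled_rates_def Bochner_Integration.integral_minus[symmetric]
      by (intro arg_cong[where f="integral\<^sup>L _"]) (auto simp: w_def)
    then show ?thesis using poisson[of x] by simp
  qed
  have drift: "drift_chain R.unif_pmf w cs (gs / \<Lambda>)"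
  proof
    fix x r
    show "0 \<le> w x" by (rule w_nonneg)
    show "0 \<le> cs x" using c_bounds[OF us_in, of x x] R.one_le by (simp add: cs_def)
    show "finite {x. w x \<le> r}"
      using compact_discrete_imp_finite[OF h_sublevel[of "r + m"]] by (simp add: w_def algebra_simps)
    have "(INF u\<in>U. c x u) \<le> c x (us x)" for x
      using c_bounds us_in by (intro cINF_lower bdd_belowI2[where m=0]) auto
    then have "{x. cs x \<le> r} \<subseteq> {x. (INF u\<in>U. c x u) \<le> r * \<Lambda>}"
      using R.one_le by (auto simp: cs_def field_simps intro: order_trans)
    then show "finite {x. cs x \<le> r}"
      using compact_discrete_imp_finite[OF c_inf_sublevel] by (rule finite_subset)
    show "integrable (R.unif_pmf x) w" by (rule R.integrable_unif_pmf[OF w_int w_nonneg])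
    show "(\<integral>y. w y \<partial>R.unif_pmf x) \<le> w x + gs / \<Lambda> - cs x"
      unfolding R.integral_unif_pmf[OF w_int w_nonneg] gen_w cs_def by (simp add: diff_divide_distrib)
  qed
  obtain p where harris: "positive_harris_recurrent ?Q" and p: "bind_pmf p R.unif_pmf = p"
    and invariant: "\<And>\<pi>. invariant_prob ?Q \<pi> \<longleftrightarrow> \<pi> = measure_pmf p"
    using R.positive_harris_recurrent_if_drift[OF drift us_irreducible] by blast
  have core: "(\<integral>x. gen q (us x) f x \<partial>measure_pmf p) = 0" if f: "f \<in> core" for f
  proof -
    obtain a b F where F: "finite F" and f: "f = (\<lambda>x. a + (\<Sum>y\<in>F. b y * indicator {y} x))"
      using f by (auto simp: core_def)
    have "\<bar>f x\<bar> \<le> \<bar>a\<bar> + (\<Sum>y\<in>F. \<bar>b y\<bar>)" for x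
    proof -
      have "\<bar>\<Sum>y\<in>F. b y * indicator {y} x\<bar> \<le> (\<Sum>y\<in>F. \<bar>b y\<bar>)"
        by (intro order_trans[OF sum_abs] sum_mono) (auto simp: indicator_def)
      then show ?thesis unfolding f using abs_triangle_ineq[of a] by (meson add_left_mono order_trans)
    qed
    from R.stationary_generator[OF p this] show ?thesis
      by (simp add: R.generator_def gen_def controlled_rates_def)
  qed
  show ?thesis
  proof (intro conjI exI[of _ "measure_pmf p"] allI impI ballI)
    fix T :: real assume V_int: "(\<integral>\<^sup>+x. ennreal (V x) \<partial>measure_pmf p) < \<infinity>" and T: "0 < T"
    interpret O: stationary_optimal_control q U V \<Lambda> "max 0 \<kappa>" c h gs us p B
      by unfold_locales
        (use c_bounds c_lsc U_compact h_bound us_argmax poisson p V_int in \<open>auto intro: borel_compact\<close>)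
    let ?f = "\<lambda>t x. h x + (t - T) * gs"
    have p_prob: "measure_pmf p \<in> space (prob_algebra borel)"
      using invariant[of "measure_pmf p"] by (simp add: invariant_prob_def)
    have INF: "(INF \<nu>\<in>space (prob_algebra borel). primal_value q U c V T \<nu>) = ereal (T * gs)"
    proof (rule antisym)
      show "(INF \<nu>\<in>space (prob_algebra borel). primal_value q U c V T \<nu>) \<le> ereal (T * gs)"
        unfolding O.primal_value_stationary[OF T, symmetric] by (rule INF_lower[OF p_prob])
      show "ereal (T * gs) \<le> (INF \<nu>\<in>space (prob_algebra borel). primal_value q U c V T \<nu>)"
        by (intro INF_greatest O.primal_value_ge[OF T])
    qed
    show "let fs = ?f in
           solves_HJB q U c T fs \<and> fs \<in> dual_class q U c V T \<and>
           (LINT x|measure_pmf p. fs T x - fs 0 x) = T * gs \<and>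
           (SUP f\<in>dual_class q U c V T. ereal (LINT x|measure_pmf p. f T x - f 0 x)) = ereal (T * gs) \<and>
           (\<forall>\<nu>\<in>space (prob_algebra borel). ereal (T * gs) \<le> primal_value q U c V T \<nu>) \<and>
           (INF \<nu>\<in>space (prob_algebra borel). primal_value q U c V T \<nu>) = ereal (T * gs) \<and>
           primal_value q U c V T (measure_pmf p) = ereal (T * gs)"
      unfolding Let_def
      using O.poisson_solves_HJB[OF T] O.poisson_in_dual_class[OF T] O.SUP_dual_value[OF T]
        O.primal_value_ge[OF T] INF O.primal_value_stationary[OF T]
      by (intro conjI ballI) simp_all
  qed (use harris invariant core in auto)
qed

end
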